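(* (1) Fix $1\le p\le\infty$. Let $\{\omega^{s,t}\}_{s,t\in[0,1]}$ be weights on $\mathbb{T}\otimes\mathbb{T}$ with $\omega^{s,t}\in A_p^d(\mathbb{T}\otimes\mathbb{T})$, such that (i) $(s,t,x,y)\mapsto\omega^{s,t}(x,y)$ is measurable; (ii) $\int_0^1\!\int_0^1\!\int_0^1\!\int_0^1|\log\omega^{s,t}(x,y)|\,dx\,dy\,ds\,dt<\infty$; (iii) $A_p^d(\omega^{s,t})\le V$ for all $s,t$. Then \[\Omega(x,y)=\exp\Big\{\int_0^1\!\!\int_0^1\log\omega^{s,t}(x+s,y+t)\,ds\,dt\Big\}\] belongs to $A_p(\mathbb{T}\otimes\mathbb{T})$, with constant depending only on $p$ and $V$. (2) Fix $1<p\le\infty$. If instead each $\omega^{s,t}\in RH_p^d(\mathbb{T}\otimes\mathbb{T})$, (i) and (ii) hold, and (iii$'$) $RH_p^d(\omega^{s,t})\le V$ for all $s,t$, then $\Omega\in RH_p(\mathbb{T}\otimes\mathbb{T})$ with constant depending only on $p$ and $V$.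
   Context: $\mathbb{T}$ is the circle $[0,1]$ with endpoints identified, additions mod 1; $\mathbb{T}\otimes\mathbb{T}=\mathbb{T}^2$ with product Lebesgue measure. A rectangle is $R=Q_1\times Q_2$ with $Q_1,Q_2$ intervals of $\mathbb{T}$; a dyadic rectangle is $I\times J$ with $I,J$ dyadic intervals ($\mathcal{D}=\{[0,1]\}\cup\{[j2^{-k},(j+1)2^{-k})\}$). $-\!\!\!\!\!\!\int_E f=\frac1{|E|}\int_Ef$. Product weight classes are defined as in one variable with intervals replaced by rectangles: for $1<p<\infty$, $A_p(\omega)=\sup_R(-\!\!\!\!\!\!\int_R\omega)(-\!\!\!\!\!\!\int_R\omega^{-1/(p-1)})^{p-1}$; $A_1(\omega)=\sup_R(-\!\!\!\!\!\!\int_R\omega)/\operatorname{ess\,inf}_R\omega$; $A_\infty(\omega)=\sup_R(-\!\!\!\!\!\!\int_R\omega)\exp(-\!\!\!\!\!\!\int_R\log(1/\omega))$; $RH_p(\omega)=\sup_R(-\!\!\!\!\!\!\int_R\omega^p)^{1/p}(-\!\!\!\!\!\!\int_R\omega)^{-1}$ ($1<p<\infty$), $RH_\infty(\omega)=\sup_R(\operatorname{ess\,sup}_R\omega)(-\!\!\!\!\!\!\int_R\omega)^{-1}$, suprema over all rectangles. Dyadic versions take suprema over dyadic rectangles; $RH_p^d$ additionally requires dyadic doubling, $\int_{\widetilde I\times\widetilde J}\omega\le C\int_{I\times J}\omega$ for dyadic $I,J$ (with $\widetilde I$ the dyadic interval of length $2|I|$ containing $I$), and $RH_p^d(\omega)$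 is the max of the dyadic supremum and the dyadic doubling constant. *)

theory Defs
  imports "HOL-Analysis.Analysis"
begin

text \<open>The circle T is modelled as [0,1) with addition mod 1 (via frac).
  Functions on T x T are functions real x real => real, only their values on [0,1)^2 matter.\<close>

definition torus :: "real set" where
  "torus = {0..<1}"

definition T2 :: "(real \<times> real) set" where
  "T2 = torus \<times> torus"

definition arc :: "real \<Rightarrow> real \<Rightarrow> real set" where
  "arc a l = {x \<in> torus. frac (x - a) < l}"

definition intervals :: "real set set" where
  "intervals = {arc a l | a l. a \<in> torus \<and> 0 < l \<and> l \<le> 1}"

definition rects :: "(real \<times> real) set set" where
  "rects = {I \<times> J | I J. I \<in> intervals \<and> J \<in> intervals}"

definition dint :: "nat \<Rightarrow> nat \<Rightarrow> real set" where
  "dint j k = {real j / 2 ^ k ..< (real j + 1) / 2 ^ k}"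

definition drects :: "(real \<times> real) set set" where
  "drects = {dint j k \<times> dint j' k' | j k j' k'. j < 2 ^ k \<and> j' < 2 ^ k'}"

text \<open>Dyadic parent (the dyadic interval of twice the length containing it);
  the parent of [0,1) is taken to be [0,1) itself.\<close>
definition dparent :: "nat \<Rightarrow> nat \<Rightarrow> real set" where
  "dparent j k = dint (j div 2) (k - 1)"

definition avg :: "(real \<times> real) set \<Rightarrow> (real \<times> real \<Rightarrow> real) \<Rightarrow> ennreal" where
  "avg R f = (\<integral>\<^sup>+ z. ennreal (f z) * indicator R z \<partial>lebesgue) / emeasure lebesgue R"

definition ess_sup_on :: "(real \<times> real) set \<Rightarrow> (real \<times> real \<Rightarrow> real) \<Rightarrow> ennreal" where
  "ess_sup_on R f = Inf {c. AE z in lebesgue. z \<in> R \<longrightarrow> ennreal (f z) \<le> c}"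

definition ess_inf_on :: "(real \<times> real) set \<Rightarrow> (real \<times> real \<Rightarrow> real) \<Rightarrow> ennreal" where
  "ess_inf_on R f = Sup {c. AE z in lebesgue. z \<in> R \<longrightarrow> c \<le> ennreal (f z)}"

text \<open>x^r for x in [0,\<infinity>], r > 0.\<close>
definition epow :: "ennreal \<Rightarrow> real \<Rightarrow> ennreal" where
  "epow x r = (if x = top then top else ennreal (enn2real x powr r))"

definition weight :: "(real \<times> real \<Rightarrow> real) \<Rightarrow> bool" where
  "weight \<omega> \<longleftrightarrow> set_borel_measurable lebesgue T2 \<omega>
     \<and> (AE z in lebesgue. z \<in> T2 \<longrightarrow> 0 < \<omega> z)
     \<and> set_integrable lebesgue T2 \<omega>"

definition Ap_rect :: "ereal \<Rightarrow> (real \<times> real \<Rightarrow> real) \<Rightarrow> (real \<times> real) set \<Rightarrow> ennreal" where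
  "Ap_rect p \<omega> R =
    (if p = 1 then avg R \<omega> / ess_inf_on R \<omega>
     else if p = \<infinity> then
       (if set_integrable lebesgue R (\<lambda>z. ln (1 / \<omega> z))
        then avg R \<omega> * ennreal (exp (set_lebesgue_integral lebesgue R (\<lambda>z. ln (1 / \<omega> z))
                                      / measure lebesgue R))
        else top)
     else avg R \<omega> * epow (avg R (\<lambda>z. \<omega> z powr (-1 / (real_of_ereal p - 1)))) (real_of_ereal p - 1))"

definition Ap_const :: "ereal \<Rightarrow> (real \<times> real \<Rightarrow> real) \<Rightarrow> ennreal" where
  "Ap_const p \<omega> = (SUP R\<in>rects. Ap_rect p \<omega> R)"

definition Apd_const :: "ereal \<Rightarrow> (real \<times> real \<Rightarrow> real) \<Rightarrow> ennreal" where
  "Apd_const p \<omega> = (SUP R\<in>drects. Ap_rect p \<omega> R)"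

definition inAp :: "ereal \<Rightarrow> (real \<times> real \<Rightarrow> real) \<Rightarrow> bool" where
  "inAp p \<omega> \<longleftrightarrow> weight \<omega> \<and> Ap_const p \<omega> < top"

definition inApd :: "ereal \<Rightarrow> (real \<times> real \<Rightarrow> real) \<Rightarrow> bool" where
  "inApd p \<omega> \<longleftrightarrow> weight \<omega> \<and> Apd_const p \<omega> < top"

definition RH_rect :: "ereal \<Rightarrow> (real \<times> real \<Rightarrow> real) \<Rightarrow> (real \<times> real) set \<Rightarrow> ennreal" where
  "RH_rect p \<omega> R =
    (if p = \<infinity> then ess_sup_on R \<omega> / avg R \<omega>
     else epow (avg R (\<lambda>z. \<omega> z powr real_of_ereal p)) (1 / real_of_ereal p) / avg R \<omega>)"

definition RH_const :: "ereal \<Rightarrow> (real \<times> real \<Rightarrow> real) \<Rightarrow> ennreal" where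
  "RH_const p \<omega> = (SUP R\<in>rects. RH_rect p \<omega> R)"

definition doubling_const :: "(real \<times> real \<Rightarrow> real) \<Rightarrow> ennreal" where
  "doubling_const \<omega> =
    (SUP q\<in>{(j, k, j', k'). j < (2::nat) ^ k \<and> j' < (2::nat) ^ k'}.
       (case q of (j, k, j', k') \<Rightarrow>
         (\<integral>\<^sup>+ z. ennreal (\<omega> z) * indicator (dparent j k \<times> dparent j' k') z \<partial>lebesgue)
         / (\<integral>\<^sup>+ z. ennreal (\<omega> z) * indicator (dint j k \<times> dint j' k') z \<partial>lebesgue)))"

definition RHd_const :: "ereal \<Rightarrow> (real \<times> real \<Rightarrow> real) \<Rightarrow> ennreal" where
  "RHd_const p \<omega> = max (SUP R\<in>drects. RH_rect p \<omega> R) (doubling_const \<omega>)"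

definition inRH :: "ereal \<Rightarrow> (real \<times> real \<Rightarrow> real) \<Rightarrow> bool" where
  "inRH p \<omega> \<longleftrightarrow> weight \<omega> \<and> RH_const p \<omega> < top"

definition inRHd :: "ereal \<Rightarrow> (real \<times> real \<Rightarrow> real) \<Rightarrow> bool" where
  "inRHd p \<omega> \<longleftrightarrow> weight \<omega> \<and> RHd_const p \<omega> < top"

definition S4 :: "((real \<times> real) \<times> (real \<times> real)) set" where
  "S4 = ({0..1} \<times> {0..1}) \<times> T2"

definition family_cond :: "(real \<Rightarrow> real \<Rightarrow> real \<times> real \<Rightarrow> real) \<Rightarrow> bool" where
  "family_cond w \<longleftrightarrow>
     set_borel_measurable lebesgue S4 (\<lambda>(st, z). w (fst st) (snd st) z)
     \<and> (\<integral>\<^sup>+ q. ennreal \<bar>ln (w (fst (fst q)) (snd (fst q)) (snd q))\<bar> * indicator S4 q \<partial>lebesgue) < top"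

definition Omega :: "(real \<Rightarrow> real \<Rightarrow> real \<times> real \<Rightarrow> real) \<Rightarrow> real \<times> real \<Rightarrow> real" where
  "Omega w z = exp (set_lebesgue_integral lebesgue ({0..1} \<times> {0..1})
      (\<lambda>st. ln (w (fst st) (snd st) (frac (fst z + fst st), frac (snd z + snd st)))))"

end

theory Submission
  imports Defs
begin

text \<open>
  Write \<open>c\<^sub>R\<close> for the mean of \<open>log \<omega>\<close> over a dyadic rectangle \<open>R\<close>. By Jensen, every dyadic \<open>A\<^sub>p\<close> condition bounds
  the averages over \<open>R\<close> of \<open>exp (log \<omega> - c\<^sub>R)\<close> and of the dual power \<open>exp (- (log \<omega> - c\<^sub>R) / (p - 1))\<close>; in
  particular the means over a rectangle and over its dyadic parent in one variable differ by a bounded amount.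

  Let \<open>Q\<close> be a rectangle of sides about \<open>2\<^sup>-\<^sup>n\<close> and \<open>2\<^sup>-\<^sup>m\<close>. Split \<open>log \<omega>\<^sup>s\<^sup>,\<^sup>t(x + s, y + t)\<close> into its mean over the
  dyadic rectangle of that scale containing \<open>(x + s, y + t)\<close> and a fluctuation. Two points at distance \<open>2\<^sup>-\<^sup>n\<close>
  translated by a random \<open>s\<close> are separated by the dyadic grid of scale \<open>2\<^sup>-\<^sup>i\<close> with probability at most \<open>2\<^sup>i\<^sup>-\<^sup>n\<close>,
  so the average over \<open>(s, t)\<close> of the mean part is constant on \<open>Q\<close> up to a bounded error. The fluctuations are
  controlled by Jensen and Fubini, because \<open>Q + (s, t)\<close> meets at most four dyadic rectangles.

  A dyadic reverse Hoelder weight with dyadic doubling is dyadic \<open>A\<^sub>\<infinity>\<close>, by a Bellman function argument on the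
  tree of rectangles obtained by bisecting both sides; this reduces the second part to the same estimates.
\<close>

section \<open>Haar measure on the torus\<close>

text \<open>For a given rectangle, one number \<open>k\<close>, the translation average of the
  dyadic means at its corner, centres all estimates. Averages of \<open>exp (r * lam)\<close> are
  compared with \<open>exp (r * k)\<close> for every exponent \<open>r\<close> that a class
  involves, and the powers of \<open>exp k\<close> cancel in each product or quotient that defines a
  class. So a weight has to be known only through averages of \<open>exp (r * (h - mean))\<close>
  over dyadic rectangles, or through an essential bound on \<open>h - mean\<close>.

  The reverse Hoelder case is harder because that condition contains no lower bound: a weight equal
  to 1 on one half of the torus and to a small constant on the other has a bounded reverse Hoelder
  constant, while its logarithm oscillates arbitrarily much. Doubling limits the loss in each step
  down the tree, but the losses must also be summed over all generations; the Bellman function makes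
  their total bounded.

  The weights are only Lebesgue measurable, jointly in four variables, and are evaluated at a
  translate depending on the parameters. All analysis therefore runs on a Borel representative of
  the logarithm.\<close>

definition circ :: "real measure" where
  "circ = density lborel (indicator {0..<1})"

definition tor :: "(real \<times> real) measure" where
  "tor = circ \<Otimes>\<^sub>M circ"

definition rot :: "real \<times> real \<Rightarrow> real \<times> real \<Rightarrow> real \<times> real" where
  "rot st z = (frac (fst z + fst st), frac (snd z + snd st))"

lemma sets_circ [measurable_cong, simp]: "sets circ = sets borel"
  by (simp add: circ_def)

lemma space_circ [simp]: "space circ = UNIV"
  by (simp add: circ_def)

lemma emeasure_circ:
  assumes "A \<in> sets borel" "A \<subseteq> {0..<1}"
  shows "emeasure circ A = emeasure lborel A"
  using assms by (simp add: circ_def emeasure_density indicator_inter_arith[symmetric] Int_absorb1)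

lemma emeasure_circ_space: "emeasure circ UNIV = 1"
  by (simp add: circ_def emeasure_density)

lemma sigma_finite_circ: "sigma_finite_measure circ"
proof -
  interpret finite_measure circ
    by (rule finite_measureI) (simp add: emeasure_circ_space)
  show ?thesis ..
qed

lemma sets_tor [measurable_cong, simp]: "sets tor = sets borel"
  unfolding tor_def by (simp add: borel_prod[symmetric] cong: sets_pair_measure_cong)

lemma space_tor [simp]: "space tor = UNIV"
  by (simp add: tor_def space_pair_measure)

lemma tor_eq_density: "tor = density lborel (indicator T2)"
proof -
  have "tor = density (lborel \<Otimes>\<^sub>M lborel) (\<lambda>(x, y). indicator {0..<1} x * indicator {0..<1} y)"
    unfolding tor_def circ_def
    by (rule pair_measure_density) (use sigma_finite_circ in \<open>auto simp: circ_def sigma_finite_lborel\<close>)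
  also have "\<dots> = density lborel (indicator T2)"
    by (simp add: lborel_prod T2_def torus_def indicator_def case_prod_unfold mem_Times_iff if_distrib cong: if_cong)
       (rule arg_cong[where f = "density lborel"], auto)
  finally show ?thesis .
qed

lemma T2_borel [measurable, simp]: "T2 \<in> sets borel"
  by (simp add: T2_def torus_def borel_Times)

lemma emeasure_tor_space: "emeasure tor UNIV = 1"
proof -
  interpret sigma_finite_measure circ by (rule sigma_finite_circ)
  have "emeasure tor (UNIV \<times> UNIV) = 1"
    unfolding tor_def by (subst emeasure_pair_measure_Times) (auto simp: emeasure_circ_space)
  then show ?thesis by simp
qed

lemma finite_tor: "finite_measure tor"
  by (rule finite_measureI) (simp add: emeasure_tor_space)

interpretation tor: finite_measure tor
  by (rule finite_tor)

interpretation circ: sigma_finite_measure circ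
  by (rule sigma_finite_circ)

interpretation tor2: pair_sigma_finite tor tor ..

lemma measure_tor_space [simp]: "measure tor UNIV = 1"
  by (simp add: measure_def emeasure_tor_space)

lemma nn_integral_tor:
  assumes [measurable]: "f \<in> borel_measurable borel"
  shows "(\<integral>\<^sup>+z. f z \<partial>tor) = (\<integral>\<^sup>+x. \<integral>\<^sup>+y. f (x, y) \<partial>circ \<partial>circ)"
proof -
  have "f \<in> borel_measurable (circ \<Otimes>\<^sub>M circ)"
    using assms by (simp add: tor_def[symmetric] measurable_cong_sets[OF sets_tor refl])
  from circ.nn_integral_fst[OF this] show ?thesis
    by (simp add: tor_def)
qed

lemma frac_measurable [measurable]: "(frac :: real \<Rightarrow> real) \<in> borel_measurable borel"
  unfolding frac_def by measurable

lemma nn_integral_circ_frac: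
  fixes f :: "real \<Rightarrow> ennreal"
  assumes [measurable]: "f \<in> borel_measurable borel"
  shows "(\<integral>\<^sup>+x. f (frac (x + s)) \<partial>circ) = (\<integral>\<^sup>+x. f x \<partial>circ)"
proof -
  define c where "c = frac s"
  have c: "0 \<le> c" "c < 1" by (auto simp: c_def frac_lt_1)
  have fr: "frac (x + s) = (if x < 1 - c then x + c else x + c - 1)" if "x \<in> {0..<1}" for x
  proof -
    have e: "x + s = x + c + of_int \<lfloor>s\<rfloor>"
      by (simp add: c_def frac_def)
    show ?thesis
      unfolding frac_unique_iff e using that c
      by (auto intro: Ints_add)
  qed
  have shift: "(\<integral>\<^sup>+x. g (x + a) \<partial>lborel) = (\<integral>\<^sup>+x. g x \<partial>lborel)" if [measurable]: "g \<in> borel_measurable borel"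
    for g :: "real \<Rightarrow> ennreal" and a
    using nn_integral_real_affine[of g 1 a] by (simp add: add.commute)
  have "(\<integral>\<^sup>+x. f (frac (x + s)) \<partial>circ) = (\<integral>\<^sup>+x. indicator {0..<1} x * f (frac (x + s)) \<partial>lborel)"
    unfolding circ_def by (subst nn_integral_density) auto
  \<comment> \<open>The rotation moves [0, 1 - c) onto [c, 1) and [1 - c, 1) onto [0, c), each by a
    plain shift; at every point at most one of the two indicators is nonzero.\<close>
  also have "\<dots> = (\<integral>\<^sup>+x. indicator {c..<1} (x + c) * f (x + c) + indicator {0..<c} (x + (c - 1)) * f (x + (c - 1)) \<partial>lborel)"
    using c by (intro nn_integral_cong) (auto simp: fr indicator_def add_diff_eq)
  also have "\<dots> = (\<integral>\<^sup>+x. indicator {c..<1} (x + c) * f (x + c) \<partial>lborel) + (\<integral>\<^sup>+x. indicator {0..<c} (x + (c - 1)) * f (x + (c - 1)) \<partial>lborel)"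
    by (intro nn_integral_add) auto
  also have "\<dots> = (\<integral>\<^sup>+x. indicator {c..<1} x * f x \<partial>lborel) + (\<integral>\<^sup>+x. indicator {0..<c} x * f x \<partial>lborel)"
    by (intro arg_cong2[where f = "(+)"] shift[where g = "\<lambda>x. indicator {c..<1} x * f x"]
        shift[where g = "\<lambda>x. indicator {0..<c} x * f x"]) auto
  also have "\<dots> = (\<integral>\<^sup>+x. indicator {c..<1} x * f x + indicator {0..<c} x * f x \<partial>lborel)"
    by (intro nn_integral_add[symmetric]) auto
  also have "\<dots> = (\<integral>\<^sup>+x. indicator {0..<1} x * f x \<partial>lborel)"
    using c by (intro nn_integral_cong) (auto simp: indicator_def)
  also have "\<dots> = (\<integral>\<^sup>+x. f x \<partial>circ)"
    unfolding circ_def by (subst nn_integral_density) auto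
  finally show ?thesis .
qed

lemma fst_borel [measurable]: "(fst :: real \<times> real \<Rightarrow> real) \<in> borel_measurable borel"
  by (simp add: borel_prod[symmetric])

lemma snd_borel [measurable]: "(snd :: real \<times> real \<Rightarrow> real) \<in> borel_measurable borel"
  by (simp add: borel_prod[symmetric])

lemma Pair_borel [measurable (raw)]:
  assumes "f \<in> borel_measurable M" "g \<in> borel_measurable M"
  shows "(\<lambda>x. (f x, g x) :: real \<times> real) \<in> borel_measurable M"
  using assms by (rule borel_measurable_Pair)

lemma rot_measurable [measurable (raw)]:
  assumes [measurable]: "f \<in> borel_measurable M" "g \<in> borel_measurable M"
  shows "(\<lambda>x. rot (f x) (g x)) \<in> borel_measurable M"
  unfolding rot_def by measurable

lemma nn_integral_tor_rot:
  fixes f :: "real \<times> real \<Rightarrow> ennreal"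
  assumes [measurable]: "f \<in> borel_measurable borel"
  shows "(\<integral>\<^sup>+z. f (rot st z) \<partial>tor) = (\<integral>\<^sup>+z. f z \<partial>tor)"
proof -
  have "(\<integral>\<^sup>+z. f (rot st z) \<partial>tor) = (\<integral>\<^sup>+x. \<integral>\<^sup>+y. f (rot st (x, y)) \<partial>circ \<partial>circ)"
    by (rule nn_integral_tor) measurable
  also have "\<dots> = (\<integral>\<^sup>+x. \<integral>\<^sup>+y. f (frac (x + fst st), y) \<partial>circ \<partial>circ)"
    unfolding rot_def fst_conv snd_conv
    by (intro nn_integral_cong nn_integral_circ_frac) measurable
  also have "\<dots> = (\<integral>\<^sup>+x. \<integral>\<^sup>+y. f (x, y) \<partial>circ \<partial>circ)"
    by (rule nn_integral_circ_frac[where f = "\<lambda>x. \<integral>\<^sup>+y. f (x, y) \<partial>circ"]) measurable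
  also have "\<dots> = (\<integral>\<^sup>+z. f z \<partial>tor)"
    by (rule nn_integral_tor[symmetric]) measurable
  finally show ?thesis .
qed

lemma AE_tor_T2: "AE z in tor. z \<in> T2"
  unfolding tor_eq_density by (subst AE_density) (auto simp: indicator_def)

lemma AE_tor_iff: "(AE z in tor. Q z) \<longleftrightarrow> (AE z in lebesgue. z \<in> T2 \<longrightarrow> Q z)"
  unfolding tor_eq_density AE_completion_iff by (subst AE_density) (auto simp: indicator_def)

lemma nn_integral_lebesgue_tor:
  assumes [measurable]: "f \<in> borel_measurable borel" "R \<in> sets borel" and "R \<subseteq> T2"
  shows "(\<integral>\<^sup>+z. f z * indicator R z \<partial>lebesgue) = (\<integral>\<^sup>+z. f z * indicator R z \<partial>tor)"
  unfolding tor_eq_density nn_integral_completion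
  using assms by (subst nn_integral_density) (auto intro!: nn_integral_cong simp: indicator_def)

lemma emeasure_lebesgue_tor:
  assumes "R \<in> sets borel" "R \<subseteq> T2"
  shows "emeasure lebesgue R = emeasure tor R"
  using assms by (simp add: tor_eq_density emeasure_density indicator_inter_arith[symmetric] Int_absorb1)

section \<open>Dyadic rectangles and means\<close>

definition drect :: "nat \<Rightarrow> nat \<Rightarrow> nat \<Rightarrow> nat \<Rightarrow> (real \<times> real) set" where
  "drect n m j k = dint j n \<times> dint k m"

text \<open>Periodic in \<open>x\<close>, so that sums such as \<open>x + s\<close> can be used
  without reducing them modulo 1.\<close>

definition idx :: "nat \<Rightarrow> real \<Rightarrow> nat" where
  "idx n x = nat \<lfloor>2 ^ n * frac x\<rfloor>"

lemma idx_less: "idx n x < 2 ^ n"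
proof -
  have "2 ^ n * frac x < 2 ^ n" using frac_lt_1[of x] by simp
  then have "\<lfloor>2 ^ n * frac x\<rfloor> < 2 ^ n" by (simp add: floor_less_iff)
  then show ?thesis unfolding idx_def by (simp add: nat_less_iff)
qed

lemma real_idx: "real (idx n x) = of_int \<lfloor>2 ^ n * frac x\<rfloor>"
  by (simp add: idx_def)

lemma frac_mem_dint_iff: "frac x \<in> dint j n \<longleftrightarrow> idx n x = j"
proof -
  have "frac x \<in> dint j n \<longleftrightarrow> real j \<le> 2 ^ n * frac x \<and> 2 ^ n * frac x < real j + 1"
    by (auto simp: dint_def field_simps)
  also have "\<dots> \<longleftrightarrow> \<lfloor>2 ^ n * frac x\<rfloor> = int j"
    by (simp add: floor_eq_iff)
  also have "\<dots> \<longleftrightarrow> idx n x = j"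
    by (auto simp: idx_def)
  finally show ?thesis .
qed

lemma idx_cong_frac: "frac x = frac y \<Longrightarrow> idx n x = idx n y"
  by (simp add: idx_def)

lemma idx_Suc_div2: "idx (Suc n) x div 2 = idx n x"
proof -
  have "real (idx (Suc n) x) \<le> 2 * (2 ^ n * frac x)" "2 * (2 ^ n * frac x) < real (idx (Suc n) x) + 1"
    using frac_mem_dint_iff[of x "idx (Suc n) x" "Suc n"] by (auto simp: dint_def field_simps)
  moreover have "real (idx n x) \<le> 2 ^ n * frac x" "2 ^ n * frac x < real (idx n x) + 1"
    using frac_mem_dint_iff[of x "idx n x" n] by (auto simp: dint_def field_simps)
  ultimately have "2 * real (idx n x) < real (idx (Suc n) x) + 1" "real (idx (Suc n) x) < 2 * real (idx n x) + 2"
    by linarith+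
  then show ?thesis by linarith
qed

lemma idx_measurable [measurable]: "idx n \<in> borel \<rightarrow>\<^sub>M count_space UNIV"
  unfolding idx_def by measurable

lemma idx_eq_measurable [measurable (raw)]:
  assumes [measurable]: "f \<in> borel_measurable M" "g \<in> borel_measurable M"
  shows "Measurable.pred M (\<lambda>x. idx i (f x) = idx i (g x))"
proof -
  have [measurable]: "(\<lambda>x. real (idx i (f x))) \<in> borel_measurable M" "(\<lambda>x. real (idx i (g x))) \<in> borel_measurable M"
    unfolding real_idx by measurable
  have "{x \<in> space M. real (idx i (f x)) = real (idx i (g x))} \<in> sets M"
    by (intro measurable_equality_set) measurable
  then show ?thesis by (simp add: pred_def)
qed

lemma dint_borel [measurable, simp]: "dint j n \<in> sets borel"
  by (simp add: dint_def)

lemma drect_borel [measurable, simp]: "drect n m j k \<in> sets borel"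
  by (simp add: drect_def borel_Times)

lemma dint_subset_unit:
  assumes "j < 2 ^ n" shows "dint j n \<subseteq> {0..<1}"
proof -
  have "real j + 1 \<le> 2 ^ n"
    using assms by (metis Suc_leI of_nat_Suc of_nat_le_iff of_nat_numeral of_nat_power add.commute)
  then have "(real j + 1) / 2 ^ n \<le> 1" by simp
  then show ?thesis unfolding dint_def by (auto intro: order_trans less_le_trans)
qed

lemma drect_subset_T2: "j < 2 ^ n \<Longrightarrow> k < 2 ^ m \<Longrightarrow> drect n m j k \<subseteq> T2"
  using dint_subset_unit by (auto simp: drect_def T2_def torus_def dest: subsetD)

lemma dint_subset_parent: "dint j (Suc n) \<subseteq> dint (j div 2) n"
proof -
  have 1: "2 * real (j div 2) \<le> real j" "real j + 1 \<le> 2 * real (j div 2) + 2" by linarith+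
  show ?thesis
  proof
    fix x assume "x \<in> dint j (Suc n)"
    then have "real j \<le> 2 * (2 ^ n * x)" "2 * (2 ^ n * x) < real j + 1"
      by (auto simp: dint_def field_simps)
    with 1 have "real (j div 2) \<le> 2 ^ n * x" "2 ^ n * x < real (j div 2) + 1" by linarith+
    then show "x \<in> dint (j div 2) n" by (auto simp: dint_def field_simps)
  qed
qed

lemma drect_mono: "dint j n \<subseteq> dint j' n' \<Longrightarrow> dint k m \<subseteq> dint k' m' \<Longrightarrow> drect n m j k \<subseteq> drect n' m' j' k'"
  unfolding drect_def by blast

lemma emeasure_circ_dint: "j < 2 ^ n \<Longrightarrow> emeasure circ (dint j n) = ennreal (1 / 2 ^ n)"
  by (subst emeasure_circ[OF _ dint_subset_unit]) (auto simp: dint_def divide_simps diff_divide_distrib[symmetric])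

lemma emeasure_drect:
  assumes "j < 2 ^ n" "k < 2 ^ m"
  shows "emeasure tor (drect n m j k) = ennreal (1 / 2 ^ n * (1 / 2 ^ m))"
  unfolding tor_def drect_def using assms
  by (subst circ.emeasure_pair_measure_Times) (auto simp: emeasure_circ_dint ennreal_mult[symmetric])

lemma measure_drect:
  assumes "j < 2 ^ n" "k < 2 ^ m"
  shows "measure tor (drect n m j k) = 1 / 2 ^ n * (1 / 2 ^ m)"
  using emeasure_drect[OF assms] by (simp add: measure_def)

lemma drects_iff: "R \<in> drects \<longleftrightarrow> (\<exists>n m j k. j < 2 ^ n \<and> k < 2 ^ m \<and> R = drect n m j k)"
  by (auto simp: drects_def drect_def)

lemma drectsI: "j < 2 ^ n \<Longrightarrow> k < 2 ^ m \<Longrightarrow> drect n m j k \<in> drects"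
  by (auto simp: drects_iff)

section \<open>Separation of two points by the translated dyadic grid\<close>

lemma nn_integral_idx_neq:
  assumes "0 \<le> u"
  shows "(\<integral>\<^sup>+y. of_bool (idx i y \<noteq> idx i (y + u)) \<partial>circ) \<le> ennreal (2 ^ i * u)"
proof -
  \<comment> \<open>A boundary is crossed between \<open>y\<close> and \<open>y + u\<close> only if
    \<open>y\<close> lies within \<open>u\<close> to the left of the right endpoint of its cell. The
    last endpoint is 1, which accounts for crossing the seam of the circle.\<close>
  define B where "B = (\<Union>j<(2::nat)^i. {(real j + 1) / 2 ^ i - u ..< (real j + 1) / 2 ^ i})"
  have [measurable]: "B \<in> sets borel" unfolding B_def by measurable
  have sub: "y \<in> B" if y: "y \<in> {0..<1}" and ne: "idx i y \<noteq> idx i (y + u)" for y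
  proof (rule ccontr)
    assume nB: "y \<notin> B"
    define j where "j = idx i y"
    have fy: "frac y = y" using y by (simp add: frac_eq)
    have j: "j < 2 ^ i" unfolding j_def by (rule idx_less)
    have yj: "y \<in> dint j i" using frac_mem_dint_iff[of y j i] fy j_def by simp
    with nB j have *: "y + u < (real j + 1) / 2 ^ i"
      by (force simp: B_def dint_def)
    moreover have "(real j + 1) / 2 ^ i \<le> 1"
      using j by (simp add: field_simps) (metis Suc_leI of_nat_Suc of_nat_le_iff of_nat_numeral of_nat_power add.commute)
    ultimately have "y + u < 1" by (rule less_le_trans)
    then have "frac (y + u) = y + u" using y assms by (simp add: frac_eq)
    moreover have "y + u \<in> dint j i" using * yj assms by (auto simp: dint_def)
    ultimately have "idx i (y + u) = j" using frac_mem_dint_iff by metis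
    then show False using ne j_def by simp
  qed
  have "(\<integral>\<^sup>+y. of_bool (idx i y \<noteq> idx i (y + u)) \<partial>circ)
      = (\<integral>\<^sup>+y. indicator {0..<1} y * of_bool (idx i y \<noteq> idx i (y + u)) \<partial>lborel)"
    unfolding circ_def of_bool_def by (subst nn_integral_density) measurable
  also have "\<dots> \<le> (\<integral>\<^sup>+y. indicator B y \<partial>lborel)"
    using sub by (intro nn_integral_mono) (auto simp: indicator_def)
  also have "\<dots> = emeasure lborel B" by simp
  also have "\<dots> \<le> (\<Sum>j<(2::nat)^i. emeasure lborel {(real j + 1) / 2 ^ i - u ..< (real j + 1) / 2 ^ i})"
    unfolding B_def by (rule emeasure_subadditive_finite) auto
  also have "\<dots> = ennreal (2 ^ i * u)"
    using assms by (simp add: ennreal_mult' ennreal_power[symmetric] ennreal_numeral)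
  finally show ?thesis .
qed

text \<open>Generation 0 is the whole circle and never separates two points. Separation persists at
  finer scales, so this counts the generations, up to \<open>n\<close>, below the smallest common
  dyadic interval.\<close>

definition splits :: "nat \<Rightarrow> real \<Rightarrow> real \<Rightarrow> real" where
  "splits n x y = (\<Sum>i\<in>{1..n}. of_bool (idx i x \<noteq> idx i y))"

lemma splits_nonneg: "0 \<le> splits n x y"
  by (simp add: splits_def sum_nonneg)

lemma splits_measurable [measurable (raw)]:
  assumes [measurable]: "f \<in> borel_measurable M" "g \<in> borel_measurable M"
  shows "(\<lambda>x. splits n (f x) (g x)) \<in> borel_measurable M"
  unfolding splits_def of_bool_def by measurable

text \<open>The probabilities \<open>2 ^ i * u\<close> form a geometric series dominated by its last
  term, which is at most 1, so the sum stays below 2 whatever \<open>n\<close> is. A single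
  translate may separate two close points already at generation 1; only the average over
  \<open>s\<close> is bounded.\<close>

lemma nn_integral_splits:
  assumes "frac (x - a) \<le> 1 / 2 ^ n"
  shows "(\<integral>\<^sup>+s. ennreal (splits n (x + s) (a + s)) \<partial>circ) \<le> 2"
proof -
  define u where "u = frac (x - a)"
  have u: "0 \<le> u" "u \<le> 1 / 2 ^ n" using assms by (auto simp: u_def)
  have idx_a: "idx i (a + s) = idx i (frac (s + a))" for i s
    by (rule idx_cong_frac) (simp add: add.commute)
  \<comment> \<open>Both points are expressed through \<open>frac (s + a)\<close>, which is
    uniformly distributed when \<open>s\<close> is, and the forward gap \<open>u\<close>.\<close>
  have idx_x: "idx i (x + s) = idx i (frac (s + a) + u)" for i s
  proof (rule idx_cong_frac)
    have "frac (s + a) + u = x + s - of_int (\<lfloor>x - a\<rfloor> + \<lfloor>s + a\<rfloor>)"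
      by (simp add: u_def frac_def)
    then show "frac (x + s) = frac (frac (s + a) + u)"
      by (simp only: frac_def floor_diff_of_int of_int_diff)
  qed
  have one: "(\<integral>\<^sup>+s. of_bool (idx i (x + s) \<noteq> idx i (a + s)) \<partial>circ) \<le> ennreal (2 ^ i * u)" for i
  proof -
    have "(\<integral>\<^sup>+s. of_bool (idx i (x + s) \<noteq> idx i (a + s)) \<partial>circ)
      = (\<integral>\<^sup>+s. of_bool (idx i (frac (s + a)) \<noteq> idx i (frac (s + a) + u)) \<partial>circ)"
      by (intro nn_integral_cong arg_cong[where f = of_bool] arg_cong[where f = Not])
        (simp only: idx_x idx_a, rule eq_commute)
    also have "\<dots> = (\<integral>\<^sup>+y. of_bool (idx i y \<noteq> idx i (y + u)) \<partial>circ)"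
      unfolding of_bool_def by (rule nn_integral_circ_frac) measurable
    also have "\<dots> \<le> ennreal (2 ^ i * u)" by (rule nn_integral_idx_neq[OF u(1)])
    finally show ?thesis .
  qed
  have "(\<integral>\<^sup>+s. ennreal (splits n (x + s) (a + s)) \<partial>circ)
     = (\<integral>\<^sup>+s. (\<Sum>i\<in>{1..n}. of_bool (idx i (x + s) \<noteq> idx i (a + s))) \<partial>circ)"
    unfolding splits_def
    by (intro nn_integral_cong trans[OF sum_ennreal[symmetric]] sum.cong) (auto simp: of_bool_def)
  also have "\<dots> = (\<Sum>i\<in>{1..n}. \<integral>\<^sup>+s. of_bool (idx i (x + s) \<noteq> idx i (a + s)) \<partial>circ)"
    unfolding of_bool_def by (intro nn_integral_sum) measurable
  also have "\<dots> \<le> (\<Sum>i\<in>{1..n}. ennreal (2 ^ i * u))"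
    by (intro sum_mono one)
  also have "\<dots> = ennreal (\<Sum>i\<in>{1..n}. 2 ^ i * u)"
    using u by (intro sum_ennreal) auto
  also have "(\<Sum>i\<in>{1..n}. 2 ^ i * u) \<le> 2"
  proof -
    have "(\<Sum>i\<in>{1..n}. 2 ^ i :: real) = 2 ^ Suc n - 2"
      by (induction n) auto
    then have "(\<Sum>i\<in>{1..n}. 2 ^ i * u) = (2 ^ Suc n - 2) * u"
      by (simp add: sum_distrib_right[symmetric])
    also have "\<dots> \<le> 2 ^ Suc n * u" using u by (simp add: algebra_simps)
    also have "\<dots> \<le> 2" using u by (simp add: field_simps)
    finally show ?thesis .
  qed
  finally show ?thesis by (simp add: ennreal_leI order_trans)
qed

section \<open>Means over dyadic rectangles\<close>

definition mean :: "(real \<times> real \<Rightarrow> real) \<Rightarrow> (real \<times> real) set \<Rightarrow> real" where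
  "mean f R = (\<integral>z. f z * indicator R z \<partial>tor) / measure tor R"

text \<open>The test function \<open>\<psi>\<close> is left open: exponentials with either sign of
  the exponent, the absolute value, and the indicator of an excess over a level all occur, so that
  integral and essential bounds pass through one and the same estimate.\<close>

definition dyadic_bound :: "(real \<Rightarrow> ennreal) \<Rightarrow> ennreal \<Rightarrow> (real \<times> real \<Rightarrow> real) \<Rightarrow> bool" where
  "dyadic_bound \<psi> U f \<longleftrightarrow>
     (\<forall>R\<in>drects. (\<integral>\<^sup>+z. \<psi> (f z - mean f R) * indicator R z \<partial>tor) \<le> U * emeasure tor R)"

lemma integrable_indicator_tor:
  fixes f :: "real \<times> real \<Rightarrow> real"
  assumes "integrable tor f" "R \<in> sets borel"
  shows "integrable tor (\<lambda>z. f z * indicator R z)"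
  using integrable_mult_indicator[OF _ assms(1), of R] assms(2) by (simp add: mult.commute)

lemma integral_sub_mean:
  assumes "integrable tor f" "R \<in> sets borel" "0 < measure tor R"
  shows "(\<integral>z. (f z - mean f R) * indicator R z \<partial>tor) = 0"
proof -
  have "(\<integral>z. (f z - mean f R) * indicator R z \<partial>tor)
      = (\<integral>z. f z * indicator R z - mean f R * indicator R z \<partial>tor)"
    by (simp add: left_diff_distrib)
  also have "\<dots> = (\<integral>z. f z * indicator R z \<partial>tor) - (\<integral>z. mean f R * indicator R z \<partial>tor)"
    using assms by (intro Bochner_Integration.integral_diff integrable_indicator_tor) auto
  also have "\<dots> = 0"
    using assms by (simp add: mean_def)
  finally show ?thesis .
qed

text \<open>Since \<open>f - mean f R\<close> has integral zero over \<open>R\<close>, its \<open>L\<^sup>1\<close> norm is twice the integral of its positive part,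
  which is at most the integral of its exponential.\<close>

lemma mean_oscillation:
  assumes f: "integrable tor f" and R[measurable]: "R \<in> sets borel" and pos: "0 < measure tor R" and W: "0 \<le> W"
    and bd: "(\<integral>\<^sup>+z. ennreal (exp (f z - mean f R)) * indicator R z \<partial>tor) \<le> ennreal W * emeasure tor R"
  shows "(\<integral>z. \<bar>f z - mean f R\<bar> * indicator R z \<partial>tor) \<le> 2 * W * measure tor R"
proof -
  define h where "h z = (f z - mean f R) * indicator R z" for z
  have h: "integrable tor h"
    unfolding h_def using f by (intro integrable_indicator_tor) auto
  have hp: "integrable tor (\<lambda>z. max 0 (h z))" using h by auto
  have "ennreal (\<integral>z. max 0 (h z) \<partial>tor) = (\<integral>\<^sup>+z. ennreal (max 0 (h z)) \<partial>tor)"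
    by (intro nn_integral_eq_integral[symmetric] hp) auto
  also have "\<dots> \<le> (\<integral>\<^sup>+z. ennreal (exp (f z - mean f R)) * indicator R z \<partial>tor)"
  proof (intro nn_integral_mono)
    fix z
    have "max 0 (f z - mean f R) \<le> exp (f z - mean f R)"
      using exp_ge_add_one_self[of "f z - mean f R"] exp_ge_zero[of "f z - mean f R"] by linarith
    then show "ennreal (max 0 (h z)) \<le> ennreal (exp (f z - mean f R)) * indicator R z"
      by (auto simp: h_def indicator_def intro: ennreal_leI)
  qed
  also have "\<dots> \<le> ennreal W * emeasure tor R" by (rule bd)
  also have "\<dots> = ennreal (W * measure tor R)"
    using W by (simp add: tor.emeasure_eq_measure ennreal_mult')
  finally have 1: "(\<integral>z. max 0 (h z) \<partial>tor) \<le> W * measure tor R"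
    using W by simp
  have "(\<integral>z. \<bar>f z - mean f R\<bar> * indicator R z \<partial>tor) = (\<integral>z. 2 * max 0 (h z) - h z \<partial>tor)"
    by (intro Bochner_Integration.integral_cong) (auto simp: h_def indicator_def max_def)
  also have "\<dots> = 2 * (\<integral>z. max 0 (h z) \<partial>tor) - (\<integral>z. h z \<partial>tor)"
    using h hp by simp
  also have "(\<integral>z. h z \<partial>tor) = 0"
    unfolding h_def by (rule integral_sub_mean[OF f R pos])
  finally show ?thesis using 1 by simp
qed

text \<open>The child is half of the parent, so averaging \<open>\<bar>f - mean f R'\<bar>\<close>
  over the child instead of the parent costs at most a factor 2, which turns \<open>2 * W\<close>
  into \<open>4 * W\<close>.\<close>

lemma mean_diff_parent:
  assumes f: "integrable tor f" and R[measurable]: "R \<in> sets borel" "R' \<in> sets borel" "R \<subseteq> R'"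
    and pos: "0 < measure tor R" and double: "measure tor R' = 2 * measure tor R"
    and osc: "(\<integral>z. \<bar>f z - mean f R'\<bar> * indicator R' z \<partial>tor) \<le> 2 * W * measure tor R'"
  shows "\<bar>mean f R - mean f R'\<bar> \<le> 4 * W"
proof -
  have i: "integrable tor (\<lambda>z. (f z - mean f R') * indicator S z)" if "S \<in> sets borel" for S
    using f that by (intro integrable_indicator_tor) auto
  have ia: "integrable tor (\<lambda>z. \<bar>f z - mean f R'\<bar> * indicator S z)" if "S \<in> sets borel" for S
    using f that by (intro integrable_indicator_tor integrable_abs) auto
  have "(\<integral>z. (f z - mean f R') * indicator R z \<partial>tor)
      = (\<integral>z. f z * indicator R z - mean f R' * indicator R z \<partial>tor)"
    by (simp add: left_diff_distrib)
  also have "\<dots> = (\<integral>z. f z * indicator R z \<partial>tor) - (\<integral>z. mean f R' * indicator R z \<partial>tor)"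
    using f by (intro Bochner_Integration.integral_diff integrable_indicator_tor) auto
  also have "\<dots> = measure tor R * (mean f R - mean f R')"
    using pos by (simp add: mean_def field_simps)
  finally have "measure tor R * \<bar>mean f R - mean f R'\<bar> = \<bar>\<integral>z. (f z - mean f R') * indicator R z \<partial>tor\<bar>"
    using pos by (simp add: abs_mult)
  also have "\<dots> \<le> (\<integral>z. \<bar>(f z - mean f R') * indicator R z\<bar> \<partial>tor)"
    by (rule integral_abs_bound)
  also have "\<dots> \<le> (\<integral>z. \<bar>f z - mean f R'\<bar> * indicator R' z \<partial>tor)"
    using R by (intro integral_mono integrable_abs i ia) (auto simp: indicator_def)
  also have "\<dots> \<le> measure tor R * (4 * W)" using osc double by (simp add: mult.commute mult.left_commute)
  finally show ?thesis using pos by simp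
qed

lemma dyadic_bound_oscillation:
  assumes "integrable tor f" "0 \<le> W" "dyadic_bound (\<lambda>u. ennreal (exp u)) (ennreal W) f" "R \<in> drects"
  shows "(\<integral>z. \<bar>f z - mean f R\<bar> * indicator R z \<partial>tor) \<le> 2 * W * measure tor R"
  using assms by (intro mean_oscillation) (auto simp: dyadic_bound_def drects_iff measure_drect)

text \<open>Climb both branches up to the first common ancestor; each separated generation costs two parent steps.\<close>

lemma mean_diff_splits_fst:
  assumes f: "integrable tor f" "0 \<le> W" "dyadic_bound (\<lambda>u. ennreal (exp u)) (ennreal W) f" and k: "k < 2 ^ m"
  shows "\<bar>mean f (drect n m (idx n x) k) - mean f (drect n m (idx n y) k)\<bar> \<le> 8 * W * splits n x y"
proof (induction n)
  case 0
  then show ?case using idx_less[of 0 x] idx_less[of 0 y] by (simp add: splits_def)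
next
  case (Suc n)
  \<comment> \<open>Only the first side is halved while the second keeps its scale \<open>m\<close>,
    so the parent has exactly twice the measure.\<close>
  have step: "\<bar>mean f (drect (Suc n) m (idx (Suc n) v) k) - mean f (drect n m (idx n v) k)\<bar> \<le> 4 * W" for v
  proof (rule mean_diff_parent[OF f(1)])
    have *: "idx (Suc n) v < 2 ^ Suc n" "idx n v < 2 ^ n" by (rule idx_less)+
    show "drect (Suc n) m (idx (Suc n) v) k \<subseteq> drect n m (idx n v) k"
      using dint_subset_parent[of "idx (Suc n) v" n] by (intro drect_mono) (auto simp: idx_Suc_div2)
    show "0 < measure tor (drect (Suc n) m (idx (Suc n) v) k)" "measure tor (drect n m (idx n v) k) = 2 * measure tor (drect (Suc n) m (idx (Suc n) v) k)"
      using * k by (simp_all add: measure_drect)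
    show "(\<integral>z. \<bar>f z - mean f (drect n m (idx n v) k)\<bar> * indicator (drect n m (idx n v) k) z \<partial>tor) \<le> 2 * W * measure tor (drect n m (idx n v) k)"
      by (intro dyadic_bound_oscillation f drectsI * k)
  qed simp_all
  show ?case
  proof (cases "idx (Suc n) x = idx (Suc n) y")
    case True
    then show ?thesis using splits_nonneg f by simp
  next
    case False
    then have "splits (Suc n) x y = splits n x y + 1" by (simp add: splits_def)
    then show ?thesis using Suc step[of x] step[of y] by (simp add: algebra_simps)
  qed
qed

lemma mean_diff_splits_snd:
  assumes f: "integrable tor f" "0 \<le> W" "dyadic_bound (\<lambda>u. ennreal (exp u)) (ennreal W) f" and k: "k < 2 ^ m"
  shows "\<bar>mean f (drect m n k (idx n x)) - mean f (drect m n k (idx n y))\<bar> \<le> 8 * W * splits n x y"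
proof (induction n)
  case 0
  then show ?case using idx_less[of 0 x] idx_less[of 0 y] by (simp add: splits_def)
next
  case (Suc n)
  have step: "\<bar>mean f (drect m (Suc n) k (idx (Suc n) v)) - mean f (drect m n k (idx n v))\<bar> \<le> 4 * W" for v
  proof (rule mean_diff_parent[OF f(1)])
    have *: "idx (Suc n) v < 2 ^ Suc n" "idx n v < 2 ^ n" by (rule idx_less)+
    show "drect m (Suc n) k (idx (Suc n) v) \<subseteq> drect m n k (idx n v)"
      using dint_subset_parent[of "idx (Suc n) v" n] by (intro drect_mono) (auto simp: idx_Suc_div2)
    show "0 < measure tor (drect m (Suc n) k (idx (Suc n) v))" "measure tor (drect m n k (idx n v)) = 2 * measure tor (drect m (Suc n) k (idx (Suc n) v))"
      using * k by (simp_all add: measure_drect)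
    show "(\<integral>z. \<bar>f z - mean f (drect m n k (idx n v))\<bar> * indicator (drect m n k (idx n v)) z \<partial>tor) \<le> 2 * W * measure tor (drect m n k (idx n v))"
      by (intro dyadic_bound_oscillation f drectsI * k)
  qed simp_all
  show ?case
  proof (cases "idx (Suc n) x = idx (Suc n) y")
    case True
    then show ?thesis using splits_nonneg f by simp
  next
    case False
    then have "splits (Suc n) x y = splits n x y + 1" by (simp add: splits_def)
    then show ?thesis using Suc step[of x] step[of y] by (simp add: algebra_simps)
  qed
qed

definition cell :: "nat \<Rightarrow> nat \<Rightarrow> real \<times> real \<Rightarrow> (real \<times> real) set" where
  "cell n m z = drect n m (idx n (fst z)) (idx m (snd z))"

lemma cell_drects: "cell n m z \<in> drects"
  unfolding cell_def by (intro drectsI idx_less)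

text \<open>The coordinates are changed one at a time, by way of the cell that takes its first side
  from \<open>z'\<close> and its second from \<open>z\<close>. Each climb takes place in one
  variable, with the other side fixed at its final scale.\<close>

lemma mean_diff_cell:
  assumes f: "integrable tor f" "0 \<le> W" "dyadic_bound (\<lambda>u. ennreal (exp u)) (ennreal W) f"
  shows "\<bar>mean f (cell n m z) - mean f (cell n m z')\<bar>
    \<le> 8 * W * (splits n (fst z) (fst z') + splits m (snd z) (snd z'))"
  using mean_diff_splits_fst[OF f idx_less[of m "snd z"], of n "fst z" "fst z'"]
    mean_diff_splits_snd[OF f idx_less[of n "fst z'"], of m "snd z" "snd z'"]
  unfolding cell_def by (simp add: algebra_simps)

section \<open>Averages over translations\<close>

text \<open>\<open>ennreal\<close> sends negative values to 0, so the right-hand side integrates the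
  positive part.\<close>

lemma ennreal_integral_le_nn_integral:
  fixes f :: "'a \<Rightarrow> real"
  assumes "integrable M f"
  shows "ennreal (\<integral>x. f x \<partial>M) \<le> (\<integral>\<^sup>+x. ennreal (f x) \<partial>M)"
proof -
  have i: "integrable M (\<lambda>x. max 0 (f x))" using assms by auto
  have "(\<integral>x. f x \<partial>M) \<le> (\<integral>x. max 0 (f x) \<partial>M)"
    by (intro integral_mono assms i) auto
  then have "ennreal (\<integral>x. f x \<partial>M) \<le> ennreal (\<integral>x. max 0 (f x) \<partial>M)"
    by (rule ennreal_leI)
  also have "\<dots> = (\<integral>\<^sup>+x. ennreal (max 0 (f x)) \<partial>M)"
    by (intro nn_integral_eq_integral[symmetric] i) auto
  also have "\<dots> = (\<integral>\<^sup>+x. ennreal (f x) \<partial>M)"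
    by (intro nn_integral_cong) (auto simp: max_def ennreal_neg)
  finally show ?thesis .
qed

text \<open>Jensen, by integrating the tangent line of \<open>exp\<close> at the mean. The
  right-hand side may be infinite, so \<open>exp f\<close> need not be known to be integrable; this
  matters when the inequality is applied to powers of a weight.\<close>

lemma exp_mean_le:
  assumes f: "integrable tor f" and R[measurable]: "R \<in> sets borel" and pos: "0 < measure tor R"
  shows "ennreal (exp (mean f R)) * emeasure tor R \<le> (\<integral>\<^sup>+z. ennreal (exp (f z)) * indicator R z \<partial>tor)"
proof -
  define c where "c = mean f R"
  define v where "v z = exp c * (f z - c) * indicator R z + exp c * indicator R z" for z
  have i1: "integrable tor (\<lambda>z. exp c * (f z - c) * indicator R z)"
    using f by (intro integrable_indicator_tor) auto
  have i2: "integrable tor (\<lambda>z. exp c * indicator R z :: real)"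
    by (intro integrable_indicator_tor) auto
  have "(\<integral>z. v z \<partial>tor) = (\<integral>z. exp c * (f z - c) * indicator R z \<partial>tor) + (\<integral>z. exp c * indicator R z \<partial>tor)"
    unfolding v_def by (intro Bochner_Integration.integral_add i1 i2)
  also have "(\<integral>z. exp c * (f z - c) * indicator R z \<partial>tor) = 0"
    using integral_sub_mean[OF f R pos] by (simp add: mult.assoc c_def)
  finally have "ennreal (exp c) * emeasure tor R = ennreal (\<integral>z. v z \<partial>tor)"
    by (simp add: tor.emeasure_eq_measure ennreal_mult')
  also have "\<dots> \<le> (\<integral>\<^sup>+z. ennreal (v z) \<partial>tor)"
    unfolding v_def by (intro ennreal_integral_le_nn_integral Bochner_Integration.integrable_add i1 i2)
  also have "\<dots> \<le> (\<integral>\<^sup>+z. ennreal (exp (f z)) * indicator R z \<partial>tor)"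
  proof (intro nn_integral_mono)
    fix z
    have "exp c * (f z - c + 1) \<le> exp c * exp (f z - c)"
      using exp_ge_add_one_self[of "f z - c"] by (intro mult_left_mono) (simp_all add: add.commute)
    also have "\<dots> = exp (f z)" by (simp add: exp_add[symmetric])
    finally show "ennreal (v z) \<le> ennreal (exp (f z)) * indicator R z"
      by (auto simp: v_def indicator_def algebra_simps intro!: ennreal_leI)
  qed
  finally show ?thesis by (simp add: c_def)
qed

lemma exp_integral_le:
  assumes f: "integrable tor f"
  shows "ennreal (exp (\<integral>z. f z \<partial>tor)) \<le> (\<integral>\<^sup>+z. ennreal (exp (f z)) \<partial>tor)"
  using exp_mean_le[OF f, of UNIV] by (simp add: mean_def emeasure_tor_space)

section \<open>Cells met by a translated rectangle\<close>

lemma idx_eq_mod: "idx n x = nat (\<lfloor>2 ^ n * x\<rfloor> mod 2 ^ n)"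
proof -
  have "2 ^ n * frac x = 2 ^ n * x - of_int (2 ^ n * \<lfloor>x\<rfloor>)"
    by (simp add: frac_def algebra_simps)
  then have "\<lfloor>2 ^ n * frac x\<rfloor> = \<lfloor>2 ^ n * x\<rfloor> - 2 ^ n * \<lfloor>x\<rfloor>"
    by (simp only: floor_diff_of_int)
  moreover have "0 \<le> \<lfloor>2 ^ n * frac x\<rfloor>" "\<lfloor>2 ^ n * frac x\<rfloor> < 2 ^ n"
    using frac_lt_1[of x] by (simp_all add: floor_less_iff)
  ultimately have "\<lfloor>2 ^ n * frac x\<rfloor> = \<lfloor>2 ^ n * x\<rfloor> mod 2 ^ n"
    by (metis mod_pos_pos_trivial mod_diff_right_eq mod_mult_self1_is_0 diff_zero)
  then show ?thesis by (simp add: idx_def)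
qed

text \<open>An arc no longer than one cell meets at most the cell of its starting point and the
  cyclically next one. The arithmetic modulo \<open>2 ^ n\<close> lets the last cell be followed by
  the first.\<close>

lemma idx_near:
  assumes "frac (x - a) < 1 / 2 ^ n"
  shows "idx n x = idx n a \<or> idx n x = idx n (a + 1 / 2 ^ n)"
proof -
  define u where "u = 2 ^ n * frac (x - a)"
  have u: "0 \<le> u" "u < 1" using assms by (auto simp: u_def field_simps)
  have "2 ^ n * x = 2 ^ n * a + u + of_int (2 ^ n * \<lfloor>x - a\<rfloor>)"
    by (simp add: u_def frac_def algebra_simps)
  then have x: "\<lfloor>2 ^ n * x\<rfloor> = \<lfloor>2 ^ n * a + u\<rfloor> + 2 ^ n * \<lfloor>x - a\<rfloor>"
    by (simp only: floor_add_int)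
  have "2 ^ n * (a + 1 / 2 ^ n) = 2 ^ n * a + 1" by (simp add: field_simps)
  then have y: "\<lfloor>2 ^ n * (a + 1 / 2 ^ n)\<rfloor> = \<lfloor>2 ^ n * a\<rfloor> + 1" by simp
  have "\<lfloor>2 ^ n * a + u\<rfloor> = \<lfloor>2 ^ n * a\<rfloor> \<or> \<lfloor>2 ^ n * a + u\<rfloor> = \<lfloor>2 ^ n * a\<rfloor> + 1"
    using u by linarith
  then show ?thesis unfolding idx_eq_mod x y by (auto simp: mod_mult_self2)
qed

text \<open>Membership becomes an equality of cells, so that in the mean part the cell of
  \<open>z + st\<close> can be replaced by that of any point known to share it. It rests on a dyadic
  rectangle of given scale determining its indices.\<close>

lemma rot_mem_cell_iff: "rot st z \<in> cell n m y \<longleftrightarrow> cell n m (z + st) = cell n m y"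
proof -
  have "dint j n = dint k n \<longleftrightarrow> j = k" for j k n
  proof
    assume *: "dint j n = dint k n"
    have "real j / 2 ^ n \<in> dint j n" "real k / 2 ^ n \<in> dint k n" by (auto simp: dint_def divide_simps)
    with * have "real k \<le> real j" "real j < real k + 1" "real j \<le> real k"
      by (auto simp: dint_def divide_simps)
    then show "j = k" by linarith
  qed simp
  moreover have "dint j n \<noteq> {}" for j n
  proof -
    have "real j / 2 ^ n \<in> dint j n" by (auto simp: dint_def divide_simps)
    then show ?thesis by blast
  qed
  ultimately have "drect n m j k = drect n m j' k' \<longleftrightarrow> j = j' \<and> k = k'" for j k j' k'
    by (simp add: drect_def times_eq_iff)
  then show ?thesis
    by (simp add: cell_def rot_def) (simp add: drect_def frac_mem_dint_iff)
qed

lemma cell_borel [measurable, simp]: "cell n m z \<in> sets borel"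
  by (simp add: cell_def)

lemma emeasure_cell: "emeasure tor (cell n m z) = ennreal (1 / 2 ^ n * (1 / 2 ^ m))"
  unfolding cell_def by (intro emeasure_drect idx_less)

lemma sets_tor_tor [measurable_cong, simp]: "sets (tor \<Otimes>\<^sub>M tor) = sets (borel \<Otimes>\<^sub>M borel)"
  by (intro sets_pair_measure_cong) simp_all

text \<open>For fixed \<open>st\<close> the rotation preserves the measure. Exchanging the order of
  integration and rotating the inner integral shows that \<open>(z, st)\<close> to
  \<open>(st, rot st z)\<close> preserves the product measure.\<close>

lemma integrable_rot:
  fixes g :: "(real \<times> real) \<times> (real \<times> real) \<Rightarrow> real"
  assumes g: "integrable (tor \<Otimes>\<^sub>M tor) g"
  shows "integrable (tor \<Otimes>\<^sub>M tor) (\<lambda>(z, st). g (st, rot st z))"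
proof (rule integrableI_bounded)
  have [measurable]: "g \<in> borel_measurable (borel \<Otimes>\<^sub>M borel)"
    using borel_measurable_integrable[OF g] by measurable
  show "(\<lambda>(z, st). g (st, rot st z)) \<in> borel_measurable (tor \<Otimes>\<^sub>M tor)" by measurable
  have "(\<integral>\<^sup>+q. ennreal (norm (case q of (z, st) \<Rightarrow> g (st, rot st z))) \<partial>(tor \<Otimes>\<^sub>M tor))
      = (\<integral>\<^sup>+z. \<integral>\<^sup>+st. ennreal (norm (g (st, rot st z))) \<partial>tor \<partial>tor)"
    by (subst tor.nn_integral_fst[symmetric]) (auto simp: case_prod_beta)
  also have "\<dots> = (\<integral>\<^sup>+st. \<integral>\<^sup>+z. ennreal (norm (g (st, rot st z))) \<partial>tor \<partial>tor)"
    by (rule tor2.Fubini'[symmetric]) measurable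
  also have "\<dots> = (\<integral>\<^sup>+st. \<integral>\<^sup>+z. ennreal (norm (g (st, z))) \<partial>tor \<partial>tor)"
    by (intro nn_integral_cong nn_integral_tor_rot) measurable
  also have "\<dots> = (\<integral>\<^sup>+q. ennreal (norm (g q)) \<partial>(tor \<Otimes>\<^sub>M tor))"
    by (rule tor.nn_integral_fst) measurable
  also have "\<dots> < \<infinity>" using g by (simp add: integrable_iff_bounded)
  finally show "(\<integral>\<^sup>+q. ennreal (norm (case q of (z, st) \<Rightarrow> g (st, rot st z))) \<partial>(tor \<Otimes>\<^sub>M tor)) < \<infinity>" .
qed

section \<open>The translation average of a family of logarithms\<close>

locale averaging =
  fixes g :: "(real \<times> real) \<times> (real \<times> real) \<Rightarrow> real" and W :: real
  assumes g: "integrable (tor \<Otimes>\<^sub>M tor) g"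
    and W: "0 \<le> W"
    and Ainf: "AE st in tor. dyadic_bound (\<lambda>u. ennreal (exp u)) (ennreal W) (\<lambda>z. g (st, z))"
begin

lemma g_measurable [measurable]: "g \<in> borel_measurable (borel \<Otimes>\<^sub>M borel)"
  using borel_measurable_integrable[OF g] by measurable

definition lam :: "real \<times> real \<Rightarrow> real" where
  "lam z = (\<integral>st. g (st, rot st z) \<partial>tor)"

text \<open>The part of the logarithm that is constant on dyadic rectangles of scale (n, m), seen
  from \<open>z\<close> after translation by \<open>st\<close>.\<close>

definition cm :: "nat \<Rightarrow> nat \<Rightarrow> real \<times> real \<Rightarrow> real \<times> real \<Rightarrow> real" where
  "cm n m st z = mean (\<lambda>z. g (st, z)) (cell n m (z + st))"

lemma AE_integrable_rot: "AE z in tor. integrable tor (\<lambda>st. g (st, rot st z))"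
  using tor2.AE_integrable_fst'[OF integrable_rot[OF g]] by simp

lemma integrable_lam: "integrable tor lam"
  using tor2.integrable_fst'[OF integrable_rot[OF g]] by (simp add: lam_def[abs_def])

lemma lam_measurable [measurable]: "lam \<in> borel_measurable borel"
  using borel_measurable_integrable[OF integrable_lam] by measurable

lemma AE_good: "AE st in tor. integrable tor (\<lambda>z. g (st, z)) \<and>
    dyadic_bound (\<lambda>u. ennreal (exp u)) (ennreal W) (\<lambda>z. g (st, z))"
  using tor2.AE_integrable_fst'[OF g] Ainf by eventually_elim simp

lemma mean_measurable [measurable]:
  assumes [measurable]: "R \<in> sets borel"
  shows "(\<lambda>st. mean (\<lambda>z. g (st, z)) R) \<in> borel_measurable borel"
  unfolding mean_def by measurable

lemma integrable_mean:
  assumes [measurable]: "R \<in> sets borel"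
  shows "integrable tor (\<lambda>st. mean (\<lambda>z. g (st, z)) R)"
proof -
  have "integrable (tor \<Otimes>\<^sub>M tor) (\<lambda>q. g q * indicator (UNIV \<times> R) q)"
    using integrable_mult_indicator[OF _ g, of "UNIV \<times> R"] by (simp add: mult.commute)
  then have "integrable (tor \<Otimes>\<^sub>M tor) (\<lambda>q. g q * indicator R (snd q))"
    by (simp add: indicator_def mem_Times_iff)
  from tor2.integrable_fst'[OF this] show ?thesis
    unfolding mean_def by simp
qed

text \<open>For fixed indices the mean is a measurable function of \<open>st\<close>, and the
  indices of the cell take only countably many values.\<close>

lemma cm_measurable [measurable]: "(\<lambda>(z, st). cm n m st z) \<in> borel_measurable (borel \<Otimes>\<^sub>M borel)"
proof -
  let ?i = "\<lambda>q :: (real \<times> real) \<times> (real \<times> real). idx n (fst (fst q) + fst (snd q))" and ?j = "\<lambda>q :: (real \<times> real) \<times> (real \<times> real). idx m (snd (fst q) + snd (snd q))"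
  have i: "?i \<in> borel \<Otimes>\<^sub>M borel \<rightarrow>\<^sub>M count_space UNIV" and j: "?j \<in> borel \<Otimes>\<^sub>M borel \<rightarrow>\<^sub>M count_space UNIV"
    by measurable
  have "(\<lambda>q. mean (\<lambda>z. g (snd q, z)) (drect n m (?i q) (?j q))) \<in> borel_measurable (borel \<Otimes>\<^sub>M borel)"
    by (rule measurable_compose_countable[OF _ i, where f = "\<lambda>i q. mean (\<lambda>z. g (snd q, z)) (drect n m i (?j q))"],
        rule measurable_compose_countable[OF _ j, where f = "\<lambda>j q. mean (\<lambda>z. g (snd q, z)) (drect n m _ j)"])
      measurable
  then show ?thesis
    by (simp add: cm_def cell_def case_prod_beta)
qed

text \<open>There are finitely many cells of each scale, so the sum of the absolute means over all
  of them dominates. Integrability then holds for every \<open>z\<close>, not just almost every one,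
  which allows the evaluation at a chosen corner.\<close>

lemma integrable_cm: "integrable tor (\<lambda>st. cm n m st z)"
proof (rule Bochner_Integration.integrable_bound)
  let ?S = "\<lambda>st. \<Sum>j<2^n. \<Sum>k<2^m. \<bar>mean (\<lambda>z. g (st, z)) (drect n m j k)\<bar>"
  show "integrable tor ?S"
    by (intro Bochner_Integration.integrable_sum integrable_abs integrable_mean) auto
  have "(\<lambda>st. (\<lambda>(z, st). cm n m st z) (z, st)) \<in> borel_measurable borel" by measurable
  then show "(\<lambda>st. cm n m st z) \<in> borel_measurable tor" by (simp add: measurable_cong_sets[OF sets_tor refl])
  show "AE st in tor. norm (cm n m st z) \<le> norm (?S st)"
  proof (rule AE_I2)
    fix st
    let ?j = "idx n (fst z + fst st)" and ?k = "idx m (snd z + snd st)"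
    have "\<bar>cm n m st z\<bar> = \<bar>mean (\<lambda>z. g (st, z)) (drect n m ?j ?k)\<bar>"
      by (simp add: cm_def cell_def)
    also have "\<dots> \<le> (\<Sum>k<2^m. \<bar>mean (\<lambda>z. g (st, z)) (drect n m ?j k)\<bar>)"
      by (rule member_le_sum[where f = "\<lambda>k. \<bar>mean (\<lambda>z. g (st, z)) (drect n m ?j k)\<bar>"]) (auto simp: idx_less)
    also have "\<dots> \<le> ?S st"
      by (rule member_le_sum[where f = "\<lambda>j. \<Sum>k<2^m. \<bar>mean (\<lambda>z. g (st, z)) (drect n m j k)\<bar>"])
        (auto simp: idx_less sum_nonneg)
    finally show "norm (cm n m st z) \<le> norm (?S st)" by simp
  qed
qed

text \<open>Each separated generation costs \<open>8 * W\<close>, and the expected number of these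
  is at most 2 in each variable: \<open>8 * W * (2 + 2)\<close>.\<close>

lemma integral_cm_near:
  assumes "frac (fst z - fst a) \<le> 1 / 2 ^ n" "frac (snd z - snd a) \<le> 1 / 2 ^ m"
  shows "\<bar>(\<integral>st. cm n m st z \<partial>tor) - (\<integral>st. cm n m st a \<partial>tor)\<bar> \<le> 32 * W"
proof -
  let ?D = "\<lambda>st. \<bar>cm n m st z - cm n m st a\<bar>"
  let ?s = "\<lambda>st. splits n (fst z + fst st) (fst a + fst st)"
  let ?t = "\<lambda>st. splits m (snd z + snd st) (snd a + snd st)"
  have D: "integrable tor ?D"
    by (intro integrable_abs Bochner_Integration.integrable_diff integrable_cm)
  have s: "(\<integral>\<^sup>+st. ennreal (?s st) \<partial>tor) \<le> 2"
    by (subst nn_integral_tor) (auto simp: emeasure_circ_space nn_integral_splits[OF assms(1)])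
  have t: "(\<integral>\<^sup>+st. ennreal (?t st) \<partial>tor) \<le> 2"
    by (subst nn_integral_tor) (auto simp: emeasure_circ_space nn_integral_splits[OF assms(2)])
  have "ennreal (\<integral>st. ?D st \<partial>tor) \<le> (\<integral>\<^sup>+st. ennreal (?D st) \<partial>tor)"
    by (rule ennreal_integral_le_nn_integral[OF D])
  also have "\<dots> \<le> (\<integral>\<^sup>+st. ennreal (8 * W) * (ennreal (?s st) + ennreal (?t st)) \<partial>tor)"
    using AE_good
  proof (intro nn_integral_mono_AE, eventually_elim)
    case (elim st)
    then have "?D st \<le> 8 * W * (?s st + ?t st)"
      using mean_diff_cell[of "\<lambda>z. g (st, z)" W n m "z + st" "a + st"] W by (simp add: cm_def)
    then show ?case
      using W splits_nonneg by (simp add: ennreal_mult[symmetric] ennreal_plus[symmetric] ennreal_leI del: ennreal_plus)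
  qed
  also have "\<dots> = ennreal (8 * W) * ((\<integral>\<^sup>+st. ennreal (?s st) \<partial>tor) + (\<integral>\<^sup>+st. ennreal (?t st) \<partial>tor))"
    by (subst nn_integral_cmult) (auto simp: nn_integral_add)
  also have "\<dots> \<le> ennreal (8 * W) * (2 + 2)"
    by (intro mult_left_mono add_mono s t) simp
  also have "\<dots> = ennreal (32 * W)"
    using W ennreal_mult[of "8 * W" 4] by simp
  finally have "(\<integral>st. ?D st \<partial>tor) \<le> 32 * W" using W by simp
  moreover have "\<bar>(\<integral>st. cm n m st z \<partial>tor) - (\<integral>st. cm n m st a \<partial>tor)\<bar> \<le> (\<integral>st. ?D st \<partial>tor)"
    using integral_abs_bound[of tor "\<lambda>st. cm n m st z - cm n m st a"]
    by (simp add: Bochner_Integration.integral_diff[OF integrable_cm integrable_cm])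
  ultimately show ?thesis by simp
qed

text \<open>For fixed \<open>st\<close> the translate of \<open>Q\<close> is covered by four cells,
  and each contributes at most \<open>U\<close> times its measure, which is at most four times that
  of \<open>Q\<close>; hence the 16. Integrating over \<open>st\<close> by Fubini then gives the
  bound for the average.\<close>

lemma nn_integral_fluctuation:
  assumes [measurable]: "Q \<in> sets borel" "\<psi> \<in> borel_measurable borel"
    and Q: "\<And>z. z \<in> Q \<Longrightarrow> frac (fst z - fst a) < 1 / 2 ^ n \<and> frac (snd z - snd a) < 1 / 2 ^ m"
    and size: "1 / 2 ^ n * (1 / 2 ^ m) \<le> 4 * measure tor Q"
    and bd: "AE st in tor. dyadic_bound \<psi> U (\<lambda>z. g (st, z))"
  shows "(\<integral>\<^sup>+z. (\<integral>\<^sup>+st. \<psi> (g (st, rot st z) - cm n m st z) \<partial>tor) * indicator Q z \<partial>tor)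
    \<le> 16 * U * emeasure tor Q"
proof -
  \<comment> \<open>The four covering cells move with \<open>st\<close>, but they are always the
    cells of \<open>c + st\<close> for these four points \<open>c\<close>, so the sum over
    \<open>K\<close> has a fixed index set.\<close>
  define K where "K = {fst a, fst a + 1 / 2 ^ n} \<times> {snd a, snd a + 1 / 2 ^ m}"
  have K: "finite K" "card K \<le> 4"
    unfolding K_def card_cartesian_product by (auto simp: card_insert_if)
  have cover: "\<exists>c\<in>K. cell n m (z + st) = cell n m (c + st)" if "z \<in> Q" for z st
  proof -
    have "frac ((fst z + fst st) - (fst a + fst st)) < 1 / 2 ^ n" "frac ((snd z + snd st) - (snd a + snd st)) < 1 / 2 ^ m"
      using Q[OF that] by auto
    from this[THEN idx_near]
    have "idx n (fst z + fst st) = idx n (fst a + fst st) \<or> idx n (fst z + fst st) = idx n ((fst a + 1 / 2 ^ n) + fst st)"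
      "idx m (snd z + snd st) = idx m (snd a + snd st) \<or> idx m (snd z + snd st) = idx m ((snd a + 1 / 2 ^ m) + snd st)"
      by (simp_all only: add_ac)
    then obtain x y where "x \<in> {fst a, fst a + 1 / 2 ^ n}" "y \<in> {snd a, snd a + 1 / 2 ^ m}"
      "idx n (fst z + fst st) = idx n (x + fst st)" "idx m (snd z + snd st) = idx m (y + snd st)"
      by blast
    then show ?thesis
      unfolding K_def by (intro bexI[of _ "(x, y)"]) (auto simp: cell_def)
  qed
  have 1: "(\<integral>\<^sup>+z. \<psi> (g (st, rot st z) - cm n m st z) * indicator Q z \<partial>tor)
      \<le> 16 * U * emeasure tor Q" if st: "dyadic_bound \<psi> U (\<lambda>z. g (st, z))" for st
  proof -
    let ?F = "\<lambda>c z. \<psi> (g (st, z) - mean (\<lambda>z. g (st, z)) (cell n m (c + st))) * indicator (cell n m (c + st)) z"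
    have "(\<integral>\<^sup>+z. \<psi> (g (st, rot st z) - cm n m st z) * indicator Q z \<partial>tor)
        \<le> (\<integral>\<^sup>+z. (\<Sum>c\<in>K. ?F c (rot st z)) \<partial>tor)"
    proof (intro nn_integral_mono)
      fix z
      show "\<psi> (g (st, rot st z) - cm n m st z) * indicator Q z \<le> (\<Sum>c\<in>K. ?F c (rot st z))"
      proof (cases "z \<in> Q")
        case True
        then obtain c where c: "c \<in> K" "cell n m (z + st) = cell n m (c + st)" using cover by blast
        then have "\<psi> (g (st, rot st z) - cm n m st z) * indicator Q z = ?F c (rot st z)"
          using True by (simp add: cm_def rot_mem_cell_iff)
        also have "\<dots> \<le> (\<Sum>c\<in>K. ?F c (rot st z))"
          by (rule member_le_sum[where f = "\<lambda>c. ?F c (rot st z)"]) (use c K in auto)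
        finally show ?thesis .
      qed simp
    qed
    also have "\<dots> = (\<Sum>c\<in>K. \<integral>\<^sup>+z. ?F c (rot st z) \<partial>tor)"
      by (intro nn_integral_sum) measurable
    also have "\<dots> = (\<Sum>c\<in>K. \<integral>\<^sup>+z. ?F c z \<partial>tor)"
      by (intro sum.cong refl nn_integral_tor_rot) measurable
    also have "\<dots> \<le> (\<Sum>c\<in>K. U * ennreal (1 / 2 ^ n * (1 / 2 ^ m)))"
    proof (rule sum_mono)
      fix c
      show "(\<integral>\<^sup>+z. ?F c z \<partial>tor) \<le> U * ennreal (1 / 2 ^ n * (1 / 2 ^ m))"
        using bspec[OF st[unfolded dyadic_bound_def] cell_drects[of n m "c + st"]] by (simp only: emeasure_cell)
    qed
    also have "\<dots> = of_nat (card K) * (U * ennreal (1 / 2 ^ n * (1 / 2 ^ m)))"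
      by simp
    also have "\<dots> \<le> 4 * (U * ennreal (4 * measure tor Q))"
      using of_nat_mono[OF K(2), where 'a = ennreal]
      by (intro mult_mono ennreal_leI size) auto
    also have "\<dots> = 16 * U * emeasure tor Q"
    proof -
      have "ennreal (4 * measure tor Q) = 4 * emeasure tor Q"
        by (simp add: tor.emeasure_eq_measure ennreal_mult)
      moreover have "4 * (U * (4 * emeasure tor Q)) = (4 * 4) * U * emeasure tor Q"
        by (simp only: mult_ac)
      ultimately show ?thesis by simp
    qed
    finally show ?thesis .
  qed
  have [measurable]: "(\<lambda>q. \<psi> (g (snd q, rot (snd q) (fst q)) - cm n m (snd q) (fst q))) \<in> borel_measurable (borel \<Otimes>\<^sub>M borel)"
  proof -
    have [measurable]: "(\<lambda>q. cm n m (snd q) (fst q)) \<in> borel_measurable (borel \<Otimes>\<^sub>M borel)"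
      using cm_measurable by (simp add: case_prod_beta)
    show ?thesis by measurable
  qed
  have "(\<integral>\<^sup>+z. (\<integral>\<^sup>+st. \<psi> (g (st, rot st z) - cm n m st z) \<partial>tor) * indicator Q z \<partial>tor)
     = (\<integral>\<^sup>+z. \<integral>\<^sup>+st. \<psi> (g (st, rot st z) - cm n m st z) * indicator Q z \<partial>tor \<partial>tor)"
    by (intro nn_integral_cong nn_integral_multc[symmetric]) measurable
  also have "\<dots> = (\<integral>\<^sup>+st. \<integral>\<^sup>+z. \<psi> (g (st, rot st z) - cm n m st z) * indicator Q z \<partial>tor \<partial>tor)"
    by (rule tor2.Fubini'[symmetric]) measurable
  also have "\<dots> \<le> (\<integral>\<^sup>+st. 16 * U * emeasure tor Q \<partial>tor)"
    using bd by (intro nn_integral_mono_AE, eventually_elim) (rule 1)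
  also have "\<dots> = 16 * U * emeasure tor Q"
    by (simp add: emeasure_tor_space)
  finally show ?thesis .
qed

lemma AE_lam_decomposition:
  "AE z in tor. integrable tor (\<lambda>st. g (st, rot st z) - cm n m st z) \<and>
     lam z = (\<integral>st. g (st, rot st z) - cm n m st z \<partial>tor) + (\<integral>st. cm n m st z \<partial>tor)"
  using AE_integrable_rot
proof eventually_elim
  case (elim z)
  then show ?case
    unfolding lam_def using integrable_cm[of n m z] by simp
qed

section \<open>Estimates on a single rectangle\<close>

context
  fixes Q :: "(real \<times> real) set" and a :: "real \<times> real" and n m :: nat
  assumes Q_borel [measurable]: "Q \<in> sets borel"
    and Q_near: "\<And>z. z \<in> Q \<Longrightarrow> frac (fst z - fst a) < 1 / 2 ^ n \<and> frac (snd z - snd a) < 1 / 2 ^ m"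
    and Q_size: "1 / 2 ^ n * (1 / 2 ^ m) \<le> 4 * measure tor Q"
begin

lemma integral_cm_Q: "z \<in> Q \<Longrightarrow> \<bar>(\<integral>st. cm n m st z \<partial>tor) - (\<integral>st. cm n m st a \<partial>tor)\<bar> \<le> 32 * W"
  using Q_near[of z] by (intro integral_cm_near) auto

text \<open>The exponent splits into \<open>r\<close> times the change of the averaged mean part, at
  most \<open>32 * \<bar>r\<bar> * W\<close>, and \<open>r\<close> times an average of fluctuations
  over \<open>st\<close>. Jensen in \<open>st\<close> moves the exponential inside that average,
  where the fluctuation bound applies.\<close>

lemma nn_integral_exp_lam:
  assumes bd: "AE st in tor. dyadic_bound (\<lambda>u. ennreal (exp (r * u))) U (\<lambda>z. g (st, z))"
  shows "(\<integral>\<^sup>+z. ennreal (exp (r * (lam z - (\<integral>st. cm n m st a \<partial>tor)))) * indicator Q z \<partial>tor)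
    \<le> ennreal (exp (32 * \<bar>r\<bar> * W)) * (16 * U * emeasure tor Q)"
proof -
  let ?k = "\<integral>st. cm n m st a \<partial>tor"
  let ?I = "\<lambda>z. \<integral>\<^sup>+st. ennreal (exp (r * (g (st, rot st z) - cm n m st z))) \<partial>tor"
  have [measurable]: "(\<lambda>q. cm n m (snd q) (fst q)) \<in> borel_measurable (borel \<Otimes>\<^sub>M borel)"
    using cm_measurable by (simp add: case_prod_beta)
  have "(\<integral>\<^sup>+z. ennreal (exp (r * (lam z - ?k))) * indicator Q z \<partial>tor)
     \<le> (\<integral>\<^sup>+z. ennreal (exp (32 * \<bar>r\<bar> * W)) * (?I z * indicator Q z) \<partial>tor)"
    using AE_lam_decomposition[of n m]
  proof (intro nn_integral_mono_AE, eventually_elim)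
    case (elim z)
    show ?case
    proof (cases "z \<in> Q")
      case True
      let ?F = "\<integral>st. g (st, rot st z) - cm n m st z \<partial>tor"
      let ?e = "(\<integral>st. cm n m st z \<partial>tor) - ?k"
      have "r * ?e \<le> \<bar>r\<bar> * \<bar>?e\<bar>" by (simp add: abs_mult[symmetric])
      also have "\<dots> \<le> \<bar>r\<bar> * (32 * W)"
        using integral_cm_Q[OF True] by (intro mult_left_mono) auto
      finally have "r * (lam z - ?k) \<le> 32 * \<bar>r\<bar> * W + r * ?F"
        using elim by (simp add: algebra_simps)
      then have "ennreal (exp (r * (lam z - ?k))) \<le> ennreal (exp (32 * \<bar>r\<bar> * W) * exp (r * ?F))"
        by (intro ennreal_leI) (simp add: exp_add[symmetric])
      also have "\<dots> = ennreal (exp (32 * \<bar>r\<bar> * W)) * ennreal (exp (\<integral>st. r * (g (st, rot st z) - cm n m st z) \<partial>tor))"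
        by (simp add: ennreal_mult)
      also have "\<dots> \<le> ennreal (exp (32 * \<bar>r\<bar> * W)) * ?I z"
        using elim by (intro mult_left_mono exp_integral_le) auto
      finally show ?thesis using True by simp
    qed simp
  qed
  also have "\<dots> = ennreal (exp (32 * \<bar>r\<bar> * W)) * (\<integral>\<^sup>+z. ?I z * indicator Q z \<partial>tor)"
    by (intro nn_integral_cmult) measurable
  also have "\<dots> \<le> ennreal (exp (32 * \<bar>r\<bar> * W)) * (16 * U * emeasure tor Q)"
    using nn_integral_fluctuation[OF Q_borel _ Q_near Q_size bd] by (intro mult_left_mono) auto
  finally show ?thesis .
qed

text \<open>This ties the centring constant to the actual mean of \<open>lam\<close> over
  \<open>Q\<close>, which enters the definition for exponent infinity and the lower bounds for
  averages. The constant is \<open>16 * (2 * W)\<close> from the fluctuations plus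
  \<open>32 * W\<close> from the mean part.\<close>

lemma nn_integral_abs_lam:
  "(\<integral>\<^sup>+z. ennreal \<bar>lam z - (\<integral>st. cm n m st a \<partial>tor)\<bar> * indicator Q z \<partial>tor)
    \<le> ennreal (64 * W) * emeasure tor Q"
proof -
  let ?k = "\<integral>st. cm n m st a \<partial>tor"
  let ?I = "\<lambda>z. \<integral>\<^sup>+st. ennreal \<bar>g (st, rot st z) - cm n m st z\<bar> \<partial>tor"
  have [measurable]: "(\<lambda>q. cm n m (snd q) (fst q)) \<in> borel_measurable (borel \<Otimes>\<^sub>M borel)"
    using cm_measurable by (simp add: case_prod_beta)
  have bd: "AE st in tor. dyadic_bound (\<lambda>u. ennreal \<bar>u\<bar>) (ennreal (2 * W)) (\<lambda>z. g (st, z))"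
    using AE_good
  proof eventually_elim
    case (elim st)
    show ?case unfolding dyadic_bound_def
    proof
      fix R assume R: "R \<in> drects"
      let ?f = "\<lambda>z. g (st, z)"
      have Rb: "R \<in> sets borel" using R by (auto simp: drects_iff)
      have i: "integrable tor (\<lambda>z. \<bar>?f z - mean ?f R\<bar> * indicator R z)"
        using elim Rb by (intro integrable_indicator_tor integrable_abs) auto
      have "(\<integral>\<^sup>+z. ennreal \<bar>?f z - mean ?f R\<bar> * indicator R z \<partial>tor)
         = (\<integral>\<^sup>+z. ennreal (\<bar>?f z - mean ?f R\<bar> * indicator R z) \<partial>tor)"
        by (intro nn_integral_cong) (simp add: indicator_def)
      also have "\<dots> = ennreal (\<integral>z. \<bar>?f z - mean ?f R\<bar> * indicator R z \<partial>tor)"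
        by (intro nn_integral_eq_integral i) auto
      also have "\<dots> \<le> ennreal (2 * W * measure tor R)"
        using elim W R by (intro ennreal_leI dyadic_bound_oscillation) auto
      also have "\<dots> = ennreal (2 * W) * emeasure tor R"
        using W by (simp add: tor.emeasure_eq_measure ennreal_mult)
      finally show "(\<integral>\<^sup>+z. ennreal \<bar>?f z - mean ?f R\<bar> * indicator R z \<partial>tor) \<le> ennreal (2 * W) * emeasure tor R" .
    qed
  qed
  have "(\<integral>\<^sup>+z. ennreal \<bar>lam z - ?k\<bar> * indicator Q z \<partial>tor)
     \<le> (\<integral>\<^sup>+z. ?I z * indicator Q z + ennreal (32 * W) * indicator Q z \<partial>tor)"
    using AE_lam_decomposition[of n m]
  proof (intro nn_integral_mono_AE, eventually_elim)
    case (elim z)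
    show ?case
    proof (cases "z \<in> Q")
      case True
      let ?D = "\<integral>st. \<bar>g (st, rot st z) - cm n m st z\<bar> \<partial>tor"
      have "\<bar>lam z - ?k\<bar> \<le> ?D + 32 * W"
        using elim integral_cm_Q[OF True] integral_abs_bound[of tor "\<lambda>st. g (st, rot st z) - cm n m st z"]
        by linarith
      then have "ennreal \<bar>lam z - ?k\<bar> \<le> ennreal ?D + ennreal (32 * W)"
        using W by (subst ennreal_plus[symmetric]) (auto intro!: ennreal_leI simp del: ennreal_plus)
      also have "ennreal ?D \<le> ?I z"
        using elim by (intro ennreal_integral_le_nn_integral) auto
      finally show ?thesis using True by simp
    qed simp
  qed
  also have "\<dots> = (\<integral>\<^sup>+z. ?I z * indicator Q z \<partial>tor) + ennreal (32 * W) * emeasure tor Q"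
    by (subst nn_integral_add) (auto simp: nn_integral_cmult_indicator)
  also have "\<dots> \<le> 16 * ennreal (2 * W) * emeasure tor Q + ennreal (32 * W) * emeasure tor Q"
    using nn_integral_fluctuation[OF Q_borel _ Q_near Q_size bd] by (intro add_mono) auto
  also have "\<dots> = (16 * ennreal (2 * W) + ennreal (32 * W)) * emeasure tor Q"
    by (simp add: distrib_right)
  also have "16 * ennreal (2 * W) + ennreal (32 * W) = ennreal (64 * W)"
  proof -
    have "16 * ennreal (2 * W) = ennreal (32 * W)"
      using W ennreal_mult[of 16 "2 * W"] by simp
    then show ?thesis using W by (simp add: ennreal_plus[symmetric] del: ennreal_plus)
  qed
  finally show ?thesis .
qed

text \<open>The endpoint case of the fluctuation bound: \<open>\<psi>\<close> is the indicator of
  the forbidden values and the bound is 0. A vanishing integral says that for almost every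
  \<open>z\<close> in \<open>Q\<close> almost every translate obeys the bound, and averaging over
  \<open>st\<close> preserves it.\<close>

lemma AE_lam_le:
  assumes bd: "AE st in tor. \<forall>R\<in>drects. AE z in tor. z \<in> R \<longrightarrow> r * (g (st, z) - mean (\<lambda>z. g (st, z)) R) \<le> U"
  shows "AE z in tor. z \<in> Q \<longrightarrow> r * (lam z - (\<integral>st. cm n m st a \<partial>tor)) \<le> U + 32 * \<bar>r\<bar> * W"
proof -
  let ?k = "\<integral>st. cm n m st a \<partial>tor"
  define \<psi> :: "real \<Rightarrow> ennreal" where "\<psi> = (\<lambda>u. indicator {u. U < r * u} u)"
  have [measurable]: "\<psi> \<in> borel_measurable borel" unfolding \<psi>_def by measurable
  have [measurable]: "(\<lambda>q. cm n m (snd q) (fst q)) \<in> borel_measurable (borel \<Otimes>\<^sub>M borel)"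
    using cm_measurable by (simp add: case_prod_beta)
  have "AE st in tor. dyadic_bound \<psi> 0 (\<lambda>z. g (st, z))"
    using bd
  proof eventually_elim
    case (elim st)
    show ?case unfolding dyadic_bound_def
    proof
      fix R assume R: "R \<in> drects"
      from bspec[OF elim this]
      have "(\<integral>\<^sup>+z. \<psi> (g (st, z) - mean (\<lambda>z. g (st, z)) R) * indicator R z \<partial>tor) = (\<integral>\<^sup>+z. 0 \<partial>tor)"
        by (intro nn_integral_cong_AE, eventually_elim) (auto simp: \<psi>_def indicator_def)
      then show "(\<integral>\<^sup>+z. \<psi> (g (st, z) - mean (\<lambda>z. g (st, z)) R) * indicator R z \<partial>tor) \<le> 0 * emeasure tor R"
        by simp
    qed
  qed
  from nn_integral_fluctuation[OF Q_borel _ Q_near Q_size this]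
  have "(\<integral>\<^sup>+z. (\<integral>\<^sup>+st. \<psi> (g (st, rot st z) - cm n m st z) \<partial>tor) * indicator Q z \<partial>tor) = 0"
    by simp
  then have "AE z in tor. (\<integral>\<^sup>+st. \<psi> (g (st, rot st z) - cm n m st z) \<partial>tor) * indicator Q z = 0"
    by (subst (asm) nn_integral_0_iff_AE) auto
  with AE_lam_decomposition[of n m] show ?thesis
  proof eventually_elim
    case (elim z)
    show ?case
    proof
      assume z: "z \<in> Q"
      let ?d = "\<lambda>st. g (st, rot st z) - cm n m st z"
      have i: "integrable tor ?d" using elim by simp
      then have [measurable]: "?d \<in> borel_measurable tor" by (rule borel_measurable_integrable)
      have "(\<integral>\<^sup>+st. \<psi> (?d st) \<partial>tor) = 0" using elim z by simp
      then have "AE st in tor. \<psi> (?d st) = 0"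
        by (subst (asm) nn_integral_0_iff_AE) auto
      then have "AE st in tor. r * ?d st \<le> U"
        by eventually_elim (auto simp: \<psi>_def indicator_def split: if_splits)
      then have "(\<integral>st. r * ?d st \<partial>tor) \<le> (\<integral>st. U \<partial>tor)"
        using i by (intro integral_mono_AE) auto
      then have 1: "r * (\<integral>st. ?d st \<partial>tor) \<le> U" by simp
      let ?e = "(\<integral>st. cm n m st z \<partial>tor) - ?k"
      have "r * ?e \<le> \<bar>r\<bar> * \<bar>?e\<bar>" by (simp add: abs_mult[symmetric])
      also have "\<dots> \<le> \<bar>r\<bar> * (32 * W)"
        using integral_cm_Q[OF z] by (intro mult_left_mono) auto
      finally show "r * (lam z - ?k) \<le> U + 32 * \<bar>r\<bar> * W"
        using elim 1 by (simp add: algebra_simps)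
    qed
  qed
qed

end

end

section \<open>Reverse Hoelder weights with doubling\<close>

text \<open>Both sides vanish to second order at 1 and are compared through the sign of the
  derivative of their difference on each side of 1. Near 0 the logarithm is unbounded while the
  power is not, so the lower bound on \<open>u\<close>, which will come from doubling, determines
  the constant.\<close>

lemma powr_minus_tangent_ge:
  fixes u s V :: real
  assumes s: "1 < s" "s \<le> 2" and V: "1 \<le> V" and u: "1 / V \<le> u"
  shows "(s - 1) / V * (u - 1 - ln u) \<le> u powr s - 1 - s * (u - 1)"
proof -
  define c where "c = (s - 1) / V"
  define f where "f u = u powr s - 1 - s * (u - 1) - c * (u - 1 - ln u)" for u
  have V0: "0 < 1 / V" using V by simp
  have c: "0 \<le> c" "c \<le> s - 1" using s V divide_left_mono[of 1 V "s - 1"] by (auto simp: c_def)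
  have deriv: "(f has_real_derivative (s * (x powr (s - 1) - 1) - c * (1 - 1 / x))) (at x)" if "0 < x" for x
    unfolding f_def using that by (auto intro!: derivative_eq_intros simp: algebra_simps)
  have f1: "f 1 = 0" by (simp add: f_def)
  have right: "0 \<le> s * (x powr (s - 1) - 1) - c * (1 - 1 / x)" if x: "1 \<le> x" for x
  proof -
    have "(s - 1) * (1 - 1 / x) \<le> (s - 1) * ln x"
      using ln_le_minus_one[of "1 / x"] x s by (intro mult_left_mono) (auto simp: ln_div)
    also have "\<dots> \<le> x powr (s - 1) - 1"
    proof -
      have "1 + (s - 1) * ln x \<le> exp ((s - 1) * ln x)" by (rule exp_ge_add_one_self)
      moreover have "x powr (s - 1) = exp ((s - 1) * ln x)" using x by (simp add: powr_def)
      ultimately show ?thesis by linarith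
    qed
    also have "\<dots> \<le> s * (x powr (s - 1) - 1)"
      using s x ge_one_powr_ge_zero[of x "s - 1"] by (simp add: mult_le_cancel_right1)
    finally have "(s - 1) * (1 - 1 / x) \<le> s * (x powr (s - 1) - 1)" .
    moreover have "c * (1 - 1 / x) \<le> (s - 1) * (1 - 1 / x)"
      using c x by (intro mult_right_mono) auto
    ultimately show ?thesis by linarith
  qed
  have left: "s * (x powr (s - 1) - 1) - c * (1 - 1 / x) \<le> 0" if x: "1 / V \<le> x" "x \<le> 1" for x
  proof -
    have x0: "0 < x" using x V0 by linarith
    \<comment> \<open>Concavity of the power \<open>s - 1 \<le> 1\<close>, as the weighted mean
      inequality for \<open>x\<close> and 1 with weights \<open>s - 1\<close> and
      \<open>2 - s\<close>.\<close>
    have "x powr (s - 1) \<le> 1 + (s - 1) * (x - 1)"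
    proof -
      let ?l = "ln x"
      define d where "d = (1 - s) * ?l"
      have "1 = (s - 1) * (1 + (2 - s) * ?l) + (2 - s) * (1 + d)"
        by (simp add: d_def algebra_simps)
      also have "\<dots> \<le> (s - 1) * exp ((2 - s) * ?l) + (2 - s) * exp d"
        using s exp_ge_add_one_self[of "(2 - s) * ?l"] exp_ge_add_one_self[of d]
        by (intro add_mono mult_left_mono) auto
      finally have "exp ((s - 1) * ?l) * 1 \<le> exp ((s - 1) * ?l) * ((s - 1) * exp ((2 - s) * ?l) + (2 - s) * exp d)"
        by (intro mult_left_mono) auto
      also have "\<dots> = (s - 1) * exp ((s - 1) * ?l + (2 - s) * ?l) + (2 - s) * exp ((s - 1) * ?l + d)"
        unfolding exp_add by (simp add: algebra_simps)
      also have "(s - 1) * ?l + (2 - s) * ?l = ?l" by (simp add: algebra_simps)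
      also have "(s - 1) * ?l + d = 0" by (simp add: d_def algebra_simps)
      finally show ?thesis using x0 by (simp add: powr_def algebra_simps)
    qed
    then have "s * (x powr (s - 1) - 1) \<le> s * ((s - 1) * (x - 1))"
      using s by (intro mult_left_mono) auto
    also have "\<dots> \<le> 1 * ((s - 1) * (x - 1))"
      using s x by (intro mult_right_mono_neg) (auto intro: mult_nonneg_nonpos)
    finally have 1: "s * (x powr (s - 1) - 1) \<le> (s - 1) * (x - 1)" by simp
    have "(1 - x) / x \<le> V * (1 - x)"
    proof -
      have "1 / x \<le> V" using x V x0 by (simp add: field_simps)
      then have "(1 - x) * (1 / x) \<le> (1 - x) * V" using x by (intro mult_left_mono) auto
      then show ?thesis by (simp add: mult.commute)
    qed
    then have "c * ((1 - x) / x) \<le> c * (V * (1 - x))" using c by (intro mult_left_mono) auto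
    also have "\<dots> = (s - 1) * (1 - x)" using V by (simp add: c_def)
    finally have "- c * (1 - 1 / x) \<le> (s - 1) * (1 - x)"
      using x0 by (simp add: field_simps)
    with 1 show ?thesis by (simp add: algebra_simps)
  qed
  have "f u \<ge> 0"
  proof (cases "1 \<le> u")
    case True
    have "f 1 \<le> f u"
    proof (rule DERIV_nonneg_imp_nondecreasing[OF True])
      fix x :: real assume "1 \<le> x"
      then show "\<exists>y. (f has_real_derivative y) (at x) \<and> 0 \<le> y"
        using deriv[of x] right[of x] by (intro exI[of _ "s * (x powr (s - 1) - 1) - c * (1 - 1 / x)"]) simp
    qed
    then show ?thesis using f1 by simp
  next
    case False
    have "f 1 \<le> f u"
    proof (rule DERIV_nonpos_imp_nonincreasing[of u 1])
      fix x :: real assume "u \<le> x" "x \<le> 1"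
      then show "\<exists>y. (f has_real_derivative y) (at x) \<and> y \<le> 0"
        using deriv[of x] left[of x] u V0 by (intro exI[of _ "s * (x powr (s - 1) - 1) - c * (1 - 1 / x)"]) simp
    qed (use False in simp)
    then show ?thesis using f1 by simp
  qed
  then show ?thesis by (simp add: f_def c_def)
qed

text \<open>Young's inequality: \<open>u powr s\<close> is the weighted geometric mean of the two
  terms on the right without their coefficients, with weights proportional to 1 and
  \<open>b\<close>. It makes the dependence on \<open>v\<close> linear, so that only a one-variable
  inequality in \<open>u\<close> remains for the Bellman function.\<close>

lemma weighted_am_gm_powr:
  fixes u v b s :: real
  assumes "0 < u" "0 < v" "0 < b"
  shows "(1 + b) * u powr s \<le> u powr (s * (1 + b)) * v powr (- b) + b * v"
proof -
  let ?l = "ln u" and ?m = "ln v"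
  have "exp (s * ?l) * (1 + b) \<le> exp (s * ?l) * (exp (b * (s * ?l - ?m)) + b * exp (?m - s * ?l))"
  proof (rule mult_left_mono)
    have "1 + b = (1 + b * (s * ?l - ?m)) + b * (1 + (?m - s * ?l))" by (simp add: algebra_simps)
    also have "\<dots> \<le> exp (b * (s * ?l - ?m)) + b * exp (?m - s * ?l)"
      using assms exp_ge_add_one_self[of "b * (s * ?l - ?m)"] exp_ge_add_one_self[of "?m - s * ?l"]
      by (intro add_mono mult_left_mono) auto
    finally show "1 + b \<le> exp (b * (s * ?l - ?m)) + b * exp (?m - s * ?l)" .
  qed simp
  also have "\<dots> = exp (s * ?l + b * (s * ?l - ?m)) + b * exp (s * ?l + (?m - s * ?l))"
    unfolding exp_add by (simp add: algebra_simps)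
  also have "s * ?l + b * (s * ?l - ?m) = s * (1 + b) * ?l + - b * ?m" by (simp add: algebra_simps)
  also have "exp (s * (1 + b) * ?l + - b * ?m) = u powr (s * (1 + b)) * v powr (- b)"
    using assms by (simp only: exp_add powr_def) simp
  finally show ?thesis using assms by (simp add: powr_def mult.commute)
qed

lemma dint_indicator_split:
  "indicator (dint j n) x = (indicator (dint (2 * j) (Suc n)) x + indicator (dint (2 * j + 1) (Suc n)) x :: real)"
  by (auto simp: dint_def indicator_def field_simps)

lemma mean_children:
  fixes f :: "real \<times> real \<Rightarrow> real"
  assumes f: "integrable tor f" and jk: "j < 2 ^ n" "k < 2 ^ m"
  shows "mean f (drect n m j k) =
    (mean f (drect (Suc n) (Suc m) (2 * j) (2 * k)) + mean f (drect (Suc n) (Suc m) (2 * j) (2 * k + 1)) +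
     mean f (drect (Suc n) (Suc m) (2 * j + 1) (2 * k)) + mean f (drect (Suc n) (Suc m) (2 * j + 1) (2 * k + 1))) / 4"
proof -
  let ?D = "drect (Suc n) (Suc m)"
  have i: "integrable tor (\<lambda>z. f z * indicator (?D a b) z)" for a b
    by (intro integrable_indicator_tor f) auto
  have "(\<integral>z. f z * indicator (drect n m j k) z \<partial>tor) =
    (\<integral>z. f z * indicator (?D (2 * j) (2 * k)) z + f z * indicator (?D (2 * j) (2 * k + 1)) z
       + f z * indicator (?D (2 * j + 1) (2 * k)) z + f z * indicator (?D (2 * j + 1) (2 * k + 1)) z \<partial>tor)"
  proof (intro Bochner_Integration.integral_cong refl)
    fix z :: "real \<times> real"
    have "indicator (drect n m j k) z = (indicator (dint j n) (fst z) * indicator (dint k m) (snd z) :: real)"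
      by (simp add: drect_def indicator_def mem_Times_iff)
    also have "\<dots> = indicator (?D (2 * j) (2 * k)) z + indicator (?D (2 * j) (2 * k + 1)) z
       + indicator (?D (2 * j + 1) (2 * k)) z + indicator (?D (2 * j + 1) (2 * k + 1)) z"
      unfolding dint_indicator_split[of j] dint_indicator_split[of k]
      by (simp add: drect_def indicator_def mem_Times_iff)
    finally show "f z * indicator (drect n m j k) z = f z * indicator (?D (2 * j) (2 * k)) z + f z * indicator (?D (2 * j) (2 * k + 1)) z
       + f z * indicator (?D (2 * j + 1) (2 * k)) z + f z * indicator (?D (2 * j + 1) (2 * k + 1)) z"
      by (simp add: algebra_simps)
  qed
  also have "\<dots> = (\<integral>z. f z * indicator (?D (2 * j) (2 * k)) z \<partial>tor) + (\<integral>z. f z * indicator (?D (2 * j) (2 * k + 1)) z \<partial>tor)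
     + (\<integral>z. f z * indicator (?D (2 * j + 1) (2 * k)) z \<partial>tor) + (\<integral>z. f z * indicator (?D (2 * j + 1) (2 * k + 1)) z \<partial>tor)"
    using i by simp
  finally show ?thesis
    unfolding mean_def using jk by (simp add: measure_drect field_simps)
qed

lemma integrable_test_function:
  fixes u h :: "real \<times> real \<Rightarrow> real"
  assumes [measurable]: "u \<in> borel_measurable borel" and u: "\<And>z. \<bar>u z\<bar> \<le> L"
    and w: "integrable tor (\<lambda>z. exp (h z))"
  shows "integrable tor (\<lambda>z. 1 - exp (- u z) * exp (h z) - u z - \<epsilon> * (1 + exp L * exp (h z)))"
proof -
  have [measurable]: "(\<lambda>z. exp (h z)) \<in> borel_measurable tor"
    using w by (rule borel_measurable_integrable)
  have i1: "integrable tor (\<lambda>z. exp (- u z) * exp (h z))"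
  proof (rule Bochner_Integration.integrable_bound)
    show "integrable tor (\<lambda>z. exp L * exp (h z))" using w by simp
    have "- u z \<le> L" for z using u[of z] by linarith
    then show "AE z in tor. norm (exp (- u z) * exp (h z)) \<le> norm (exp L * exp (h z))"
      by (intro AE_I2) (simp add: mult_right_mono)
  qed measurable
  have i2: "integrable tor u"
  proof (rule Bochner_Integration.integrable_bound)
    show "integrable tor (\<lambda>_. L)" by simp
    show "AE z in tor. norm (u z) \<le> norm L"
      using order_trans[OF u abs_ge_self] by (intro AE_I2) simp
  qed measurable
  have i3: "integrable tor (\<lambda>z. 1 - exp (- u z) * exp (h z) - u z)"
    by (rule Bochner_Integration.integrable_diff[OF Bochner_Integration.integrable_diff[OF _ i1] i2]) simp
  have i4: "integrable tor (\<lambda>z. \<epsilon> * (1 + exp L * exp (h z)))"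
    by (rule integrable_mult_right, rule Bochner_Integration.integrable_add[OF _ integrable_mult_right[OF w]]) simp
  show ?thesis by (rule Bochner_Integration.integrable_diff[OF i3 i4])
qed

section \<open>The Bellman function on the tree of rectangles\<close>

locale reverse_holder =
  fixes h :: "real \<times> real \<Rightarrow> real" and q K V :: real
  assumes h: "integrable tor h"
    and w: "integrable tor (\<lambda>z. exp (h z))"
    and wq: "integrable tor (\<lambda>z. exp (q * h z))"
    and q: "1 < q" and K: "1 \<le> K" and V: "1 \<le> V"
    and rh: "R \<in> drects \<Longrightarrow> mean (\<lambda>z. exp (q * h z)) R \<le> K * mean (\<lambda>z. exp (h z)) R powr q"
    and doubling: "j < 2 ^ Suc n \<Longrightarrow> k < 2 ^ Suc m \<Longrightarrow>
      mean (\<lambda>z. exp (h z)) (drect n m (j div 2) (k div 2)) \<le> V * mean (\<lambda>z. exp (h z)) (drect (Suc n) (Suc m) j k)"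
begin

definition x :: "(real \<times> real) set \<Rightarrow> real" where "x R = mean (\<lambda>z. exp (h z)) R"
definition y :: "(real \<times> real) set \<Rightarrow> real" where "y R = mean (\<lambda>z. exp (q * h z)) R"

text \<open>\<open>s\<close> is an exponent in (1, 2] below \<open>q\<close>. Then \<open>b\<close>
  solves \<open>q * b = s * (1 + b)\<close>, which gives the Bellman function the form required by
  the Young inequality above. Finally \<open>c\<close> is the least value of the Bellman function
  times the gain \<open>(s - 1) / V\<close>.\<close>

definition s :: real where "s = min 2 ((1 + q) / 2)"
definition b :: real where "b = s / (q - s)"
definition c :: real where "c = K powr (- b) * ((s - 1) / V)"

lemma s: "1 < s" "s \<le> 2" "s < q"
  using q by (auto simp: s_def min_less_iff_disj)

lemma b: "0 < b" "q * b = s * (1 + b)"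
  using s q by (auto simp: b_def field_simps)

lemma c: "0 < c"
  using s V K by (auto simp: c_def)

lemma mean_exp_pos:
  assumes "R \<in> drects" "integrable tor (\<lambda>z. exp (f z))" "integrable tor f"
  shows "0 < mean (\<lambda>z. exp (f z)) R"
proof -
  have R: "R \<in> sets borel" "0 < measure tor R" using assms by (auto simp: drects_iff measure_drect)
  have "ennreal (exp (mean f R)) * emeasure tor R \<le> (\<integral>\<^sup>+z. ennreal (exp (f z)) * indicator R z \<partial>tor)"
    by (intro exp_mean_le assms R)
  also have "\<dots> = (\<integral>\<^sup>+z. ennreal (exp (f z) * indicator R z) \<partial>tor)"
    by (intro nn_integral_cong) (simp add: indicator_def)
  also have "\<dots> = ennreal (\<integral>z. exp (f z) * indicator R z \<partial>tor)"
    using R by (intro nn_integral_eq_integral integrable_indicator_tor assms) auto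
  finally have "exp (mean f R) * measure tor R \<le> (\<integral>z. exp (f z) * indicator R z \<partial>tor)"
    using R by (simp add: tor.emeasure_eq_measure ennreal_mult[symmetric])
  moreover have "0 < exp (mean f R) * measure tor R" using R by simp
  ultimately show ?thesis using R unfolding mean_def by (intro divide_pos_pos) linarith+
qed

lemma x_pos: "R \<in> drects \<Longrightarrow> 0 < x R"
  unfolding x_def using h w by (intro mean_exp_pos)

lemma y_pos: "R \<in> drects \<Longrightarrow> 0 < y R"
  unfolding y_def using h wq by (intro mean_exp_pos) auto

text \<open>Jensen for the power \<open>q\<close>, by integrating its tangent at \<open>x R\<close>
  over \<open>R\<close>; the linear term has mean zero. The tangent inequality itself comes from two
  tangents of \<open>exp\<close>.\<close>

lemma x_powr_le_y:
  assumes R: "R \<in> drects"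
  shows "x R powr q \<le> y R"
proof -
  have Rb: "R \<in> sets borel" "0 < measure tor R" using R by (auto simp: drects_iff measure_drect)
  have x: "0 < x R" by (rule x_pos[OF R])
  have pt: "x R powr q + q * x R powr (q - 1) * (exp (h z) - x R) \<le> exp (q * h z)" for z
  proof -
    define l where "l = h z - ln (x R)"
    have "1 + q * (exp l - 1) \<le> exp (q * l)"
    proof -
      have "q = (1 + (q - 1) * l) + (q - 1) * (1 + - l)" by (simp add: algebra_simps)
      also have "\<dots> \<le> exp ((q - 1) * l) + (q - 1) * exp (- l)"
        using q exp_ge_add_one_self[of "(q - 1) * l"] exp_ge_add_one_self[of "- l"]
        by (intro add_mono mult_left_mono) auto
      finally have "exp l * q \<le> exp l * (exp ((q - 1) * l) + (q - 1) * exp (- l))"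
        by (intro mult_left_mono) auto
      also have "\<dots> = exp (l + (q - 1) * l) + (q - 1) * exp (l + - l)"
        unfolding exp_add by (simp add: algebra_simps)
      also have "l + (q - 1) * l = q * l" by (simp add: algebra_simps)
      finally show ?thesis by (simp add: algebra_simps)
    qed
    then have "x R powr q * (1 + q * (exp l - 1)) \<le> x R powr q * exp (q * l)"
      by (intro mult_left_mono) auto
    moreover have "x R powr q * exp (q * l) = exp (q * h z)"
      using x by (simp add: l_def powr_def exp_add[symmetric] algebra_simps)
    moreover have "exp l = exp (h z) / x R" using x by (simp add: l_def exp_diff)
    moreover have "x R powr q = x R powr (q - 1) * x R" using x by (simp add: powr_diff)
    moreover have "x R powr (q - 1) * x R * (1 + q * (exp (h z) / x R - 1))
        = x R powr (q - 1) * x R + q * x R powr (q - 1) * (exp (h z) - x R)"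
      using x by (simp add: field_simps)
    ultimately show ?thesis by simp
  qed
  let ?k = "q * x R powr (q - 1)"
  have i: "integrable tor (\<lambda>z. (exp (h z) - x R) * indicator R z)"
    using w Rb by (intro integrable_indicator_tor) auto
  have i1: "integrable tor (\<lambda>z. x R powr q * indicator R z :: real)"
    using Rb by (intro integrable_indicator_tor) auto
  have "(\<integral>z. x R powr q * indicator R z + ?k * ((exp (h z) - x R) * indicator R z) \<partial>tor)
     \<le> (\<integral>z. exp (q * h z) * indicator R z \<partial>tor)"
    using pt by (intro integral_mono Bochner_Integration.integrable_add i1 integrable_mult_right i integrable_indicator_tor wq Rb)
      (auto simp: indicator_def)
  moreover have "(\<integral>z. x R powr q * indicator R z + ?k * ((exp (h z) - x R) * indicator R z) \<partial>tor)
     = x R powr q * measure tor R + ?k * (\<integral>z. (exp (h z) - x R) * indicator R z \<partial>tor)"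
    using i i1 Rb by simp
  moreover have "(\<integral>z. (exp (h z) - x R) * indicator R z \<partial>tor) = 0"
    unfolding x_def by (intro integral_sub_mean w Rb)
  ultimately show ?thesis using Rb by (simp add: y_def mean_def field_simps)
qed

text \<open>\<open>B + c ln x\<close> is the Bellman function: a bounded perturbation of \<open>c ln x\<close> whose value at a rectangle is
  at most the average of its values at the four children.\<close>

definition B :: "(real \<times> real) set \<Rightarrow> real" where "B R = (x R powr q / y R) powr b"

lemma B_bounds:
  assumes R: "R \<in> drects"
  shows "K powr (- b) \<le> B R" "B R \<le> 1"
proof -
  have p: "0 < x R powr q" "0 < y R" using x_pos[OF R] y_pos[OF R] by auto
  have "1 / K \<le> x R powr q / y R"
    using rh[OF R] K p by (simp add: x_def y_def field_simps)
  then have "(1 / K) powr b \<le> B R"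
    unfolding B_def using K b by (intro powr_mono2) auto
  then show "K powr (- b) \<le> B R"
    using K by (simp add: powr_divide powr_minus_divide)
  have "x R powr q / y R \<le> 1" using x_powr_le_y[OF R] p by simp
  then show "B R \<le> 1"
    unfolding B_def using p b by (metis divide_nonneg_nonneg less_imp_le powr_mono2 powr_one_eq_one)
qed

text \<open>The terms in \<open>x R' / x R - 1\<close> and \<open>y R' / y R - 1\<close> are linear
  and cancel when summed over the children of \<open>R\<close>. Beyond its tangent plane the Bellman
  function gains a multiple of \<open>u - 1 - ln u\<close> with \<open>u = x R' / x R\<close>, just
  what the logarithm loses.\<close>

lemma B_step:
  assumes R: "R \<in> drects" "R' \<in> drects" and d: "x R \<le> V * x R'"
  shows "B R + c * ln (x R) + B R * (q * b * (x R' / x R - 1) - b * (y R' / y R - 1)) + c * (x R' / x R - 1)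
    \<le> B R' + c * ln (x R')"
proof -
  define u where "u = x R' / x R"
  define v where "v = y R' / y R"
  have p: "0 < x R" "0 < y R" "0 < x R'" "0 < y R'" using x_pos y_pos R by auto
  then have uv: "0 < u" "0 < v" by (auto simp: u_def v_def)
  have uV: "1 / V \<le> u" using d p V by (simp add: u_def field_simps)
  have "B R' = B R * (u powr (q * b) * v powr (- b))"
    using p by (simp add: B_def u_def v_def powr_divide powr_powr powr_minus field_simps)
  also have "\<dots> \<ge> B R * (1 + q * b * (u - 1) - b * (v - 1) + (s - 1) / V * (u - 1 - ln u))"
  proof (rule mult_left_mono)
    have "(1 + b) * u powr s - b * v \<le> u powr (q * b) * v powr (- b)"
      using weighted_am_gm_powr[OF uv b(1), of s] b(2) by simp
    moreover have "(s - 1) / V * (u - 1 - ln u) \<le> (1 + b) * (u powr s - 1 - s * (u - 1))"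
    proof -
      have t: "(s - 1) / V * (u - 1 - ln u) \<le> u powr s - 1 - s * (u - 1)"
        by (rule powr_minus_tangent_ge[OF s(1,2) V uV])
      have "0 \<le> (s - 1) / V * (u - 1 - ln u)"
        using s V ln_le_minus_one[OF uv(1)] by simp
      then have "1 * (u powr s - 1 - s * (u - 1)) \<le> (1 + b) * (u powr s - 1 - s * (u - 1))"
        using t b by (intro mult_right_mono) auto
      with t show ?thesis by (simp only: mult_1)
    qed
    moreover have "(1 + b) * (u powr s - 1 - s * (u - 1)) = (1 + b) * u powr s - (1 + b) - q * b * (u - 1)"
      by (simp add: b(2) algebra_simps)
    ultimately show "1 + q * b * (u - 1) - b * (v - 1) + (s - 1) / V * (u - 1 - ln u) \<le> u powr (q * b) * v powr (- b)"
      by (simp add: algebra_simps)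
  qed (simp add: B_def)
  finally have 1: "B R + B R * (q * b * (u - 1) - b * (v - 1)) + B R * ((s - 1) / V * (u - 1 - ln u)) \<le> B R'"
    by (simp add: algebra_simps)
  \<comment> \<open>\<open>B R\<close> is at least \<open>K powr (- b)\<close> and
    \<open>u - 1 - ln u\<close> is nonnegative, so the gain covers the loss with the factor
    \<open>c\<close>.\<close>
  have "c * (u - 1 - ln u) \<le> B R * ((s - 1) / V * (u - 1 - ln u))"
    unfolding c_def mult.assoc using B_bounds[OF R(1)] s V ln_le_minus_one[OF uv(1)]
    by (intro mult_right_mono) auto
  with 1 have "B R + B R * (q * b * (u - 1) - b * (v - 1)) + c * (u - 1) - c * ln u \<le> B R'"
    by (simp add: algebra_simps)
  moreover have "ln u = ln (x R') - ln (x R)" using p by (simp add: u_def ln_div)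
  ultimately show ?thesis unfolding u_def v_def by (simp add: algebra_simps)
qed

text \<open>The average of \<open>ln x\<close> over the \<open>4 ^ N\<close> descendants
  \<open>N\<close> generations below, built from the top so that one step of the recursion is one
  Bellman step.\<close>

fun S :: "nat \<Rightarrow> nat \<Rightarrow> nat \<Rightarrow> nat \<Rightarrow> nat \<Rightarrow> real" where
  "S 0 n m j k = ln (x (drect n m j k))"
| "S (Suc N) n m j k = (S N (Suc n) (Suc m) (2 * j) (2 * k) + S N (Suc n) (Suc m) (2 * j) (2 * k + 1) +
     S N (Suc n) (Suc m) (2 * j + 1) (2 * k) + S N (Suc n) (Suc m) (2 * j + 1) (2 * k + 1)) / 4"

text \<open>Summing the Bellman steps over the tree leaves no error that depends on
  \<open>N\<close>: at the leaves the Bellman function is at most 1, and this 1 is the total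
  loss.\<close>

lemma B_le_S:
  assumes "j < 2 ^ n" "k < 2 ^ m"
  shows "B (drect n m j k) + c * ln (x (drect n m j k)) \<le> 1 + c * S N n m j k"
  using assms
proof (induction N arbitrary: n m j k)
  case 0
  then show ?case using B_bounds(2)[OF drectsI, of j n k m] by simp
next
  case (Suc N)
  let ?R = "drect n m j k" and ?D = "drect (Suc n) (Suc m)"
  let ?P = "\<lambda>i l. q * b * (x (?D i l) / x ?R - 1) - b * (y (?D i l) / y ?R - 1)"
  have step: "B ?R + c * ln (x ?R) + B ?R * ?P i l + c * (x (?D i l) / x ?R - 1) \<le> 1 + c * S N (Suc n) (Suc m) i l"
    if "i div 2 = j" "l div 2 = k" for i l
  proof -
    have il: "i < 2 ^ Suc n" "l < 2 ^ Suc m" using that Suc.prems by auto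
    have "B ?R + c * ln (x ?R) + B ?R * ?P i l + c * (x (?D i l) / x ?R - 1) \<le> B (?D i l) + c * ln (x (?D i l))"
      using doubling[OF il] Suc.prems il that by (intro B_step drectsI) (auto simp: x_def)
    also have "\<dots> \<le> 1 + c * S N (Suc n) (Suc m) i l"
      by (rule Suc.IH[OF il])
    finally show ?thesis .
  qed
  have p: "0 < x ?R" "0 < y ?R" using x_pos y_pos drectsI[OF Suc.prems] by auto
  have xs: "x (?D (2 * j) (2 * k)) + x (?D (2 * j) (2 * k + 1)) + x (?D (2 * j + 1) (2 * k)) + x (?D (2 * j + 1) (2 * k + 1)) = 4 * x ?R"
    unfolding x_def mean_children[OF w Suc.prems] by simp
  have ys: "y (?D (2 * j) (2 * k)) + y (?D (2 * j) (2 * k + 1)) + y (?D (2 * j + 1) (2 * k)) + y (?D (2 * j + 1) (2 * k + 1)) = 4 * y ?R"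
    unfolding y_def mean_children[OF wq Suc.prems] by simp
  have xs': "x (?D (2 * j) (2 * k)) / x ?R + x (?D (2 * j) (2 * k + 1)) / x ?R + x (?D (2 * j + 1) (2 * k)) / x ?R + x (?D (2 * j + 1) (2 * k + 1)) / x ?R = 4"
    using xs p by (simp add: add_divide_distrib[symmetric])
  have ys': "y (?D (2 * j) (2 * k)) / y ?R + y (?D (2 * j) (2 * k + 1)) / y ?R + y (?D (2 * j + 1) (2 * k)) / y ?R + y (?D (2 * j + 1) (2 * k + 1)) / y ?R = 4"
    using ys p by (simp add: add_divide_distrib[symmetric])
  \<comment> \<open>\<open>x\<close> and \<open>y\<close> of a rectangle are the averages over its
    four children, so each group of ratios sums to 4.\<close>
  have P0: "?P (2 * j) (2 * k) + ?P (2 * j) (2 * k + 1) + ?P (2 * j + 1) (2 * k) + ?P (2 * j + 1) (2 * k + 1) = 0"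
  proof -
    have "?P (2 * j) (2 * k) + ?P (2 * j) (2 * k + 1) + ?P (2 * j + 1) (2 * k) + ?P (2 * j + 1) (2 * k + 1)
      = q * b * (x (?D (2 * j) (2 * k)) / x ?R + x (?D (2 * j) (2 * k + 1)) / x ?R + x (?D (2 * j + 1) (2 * k)) / x ?R + x (?D (2 * j + 1) (2 * k + 1)) / x ?R - 4)
      - b * (y (?D (2 * j) (2 * k)) / y ?R + y (?D (2 * j) (2 * k + 1)) / y ?R + y (?D (2 * j + 1) (2 * k)) / y ?R + y (?D (2 * j + 1) (2 * k + 1)) / y ?R - 4)"
      by (simp add: algebra_simps)
    also have "\<dots> = 0" unfolding xs' ys' by simp
    finally show ?thesis .
  qed
  have sum: "4 * (B ?R + c * ln (x ?R)) + B ?R * (?P (2 * j) (2 * k) + ?P (2 * j) (2 * k + 1) + ?P (2 * j + 1) (2 * k) + ?P (2 * j + 1) (2 * k + 1))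
     + c * (x (?D (2 * j) (2 * k)) / x ?R + x (?D (2 * j) (2 * k + 1)) / x ?R + x (?D (2 * j + 1) (2 * k)) / x ?R + x (?D (2 * j + 1) (2 * k + 1)) / x ?R - 4)
     \<le> 4 + c * (S N (Suc n) (Suc m) (2 * j) (2 * k) + S N (Suc n) (Suc m) (2 * j) (2 * k + 1) +
     S N (Suc n) (Suc m) (2 * j + 1) (2 * k) + S N (Suc n) (Suc m) (2 * j + 1) (2 * k + 1))"
    using add_mono[OF add_mono[OF step[of "2 * j" "2 * k"] step[of "2 * j" "2 * k + 1"]]
      add_mono[OF step[of "2 * j + 1" "2 * k"] step[of "2 * j + 1" "2 * k + 1"]]]
    by (simp only: distrib_left right_diff_distrib) simp
  show ?case using sum unfolding P0 xs' by simp
qed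

text \<open>Testing against continuous \<open>u\<close> replaces martingale convergence: by the convexity of \<open>exp\<close>,
  \<open>1 - exp (- u) * exp h - u \<le> - h\<close> with equality for \<open>u = h\<close>, and for nearly constant \<open>u\<close> the mean of
  the left-hand side is at most about \<open>- ln (x R)\<close>.\<close>

lemma test_function_S:
  assumes u: "continuous_on UNIV u" "\<And>z. \<bar>u z\<bar> \<le> L" and \<epsilon>: "0 < \<epsilon>"
    and unif: "\<And>z z'. z \<in> T2 \<Longrightarrow> z' \<in> T2 \<Longrightarrow> dist z z' < \<delta> \<Longrightarrow> \<bar>u z - u z'\<bar> < \<epsilon>"
    and jk: "j < 2 ^ n" "k < 2 ^ m" and small: "1 / 2 ^ (n + N) + 1 / 2 ^ (m + N) < \<delta>"
  shows "mean (\<lambda>z. 1 - exp (- u z) * exp (h z) - u z - \<epsilon> * (1 + exp L * exp (h z))) (drect n m j k) \<le> - S N n m j k"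
  using jk small
proof (induction N arbitrary: n m j k)
  case 0
  let ?R = "drect n m j k"
  have R: "?R \<in> drects" using 0 by (intro drectsI)
  have pos: "0 < measure tor ?R" using 0 by (simp add: measure_drect)
  have [measurable]: "u \<in> borel_measurable borel"
    using u(1) by (rule borel_measurable_continuous_onI)
  define z0 where "z0 = (real j / 2 ^ n, real k / 2 ^ m)"
  have z0: "z0 \<in> ?R" by (auto simp: z0_def drect_def dint_def divide_simps)
  have near: "\<bar>u z - u z0\<bar> < \<epsilon>" if "z \<in> ?R" for z
  proof (rule unif)
    show "z \<in> T2" "z0 \<in> T2" using that z0 drect_subset_T2[OF 0(1,2)] by auto
    have d1: "\<bar>fst z - fst z0\<bar> \<le> 1 / 2 ^ n" and d2: "\<bar>snd z - snd z0\<bar> \<le> 1 / 2 ^ m"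
      using that by (auto simp: z0_def drect_def dint_def mem_Times_iff add_divide_distrib)
    have "dist z z0 \<le> \<bar>fst z - fst z0\<bar> + \<bar>snd z - snd z0\<bar>"
      using sqrt_sum_squares_le_sum_abs[of "fst z - fst z0" "snd z - snd z0"]
      by (simp add: dist_prod_def dist_real_def)
    then show "dist z z0 < \<delta>" using d1 d2 0(3) by simp
  qed
  \<comment> \<open>\<open>u\<close> is frozen at the corner \<open>z0\<close>, and the part
    containing \<open>exp (h z) - x ?R\<close> has integral zero. The price of freezing is covered
    by the subtracted term \<open>\<epsilon> * (1 + exp L * exp (h z))\<close>.\<close>
  define v where "v z = (1 - exp (- u z0) * x ?R - u z0) * indicator ?R z
     - exp (- u z0) * ((exp (h z) - x ?R) * indicator ?R z)" for z
  have i0: "integrable tor (\<lambda>z. (exp (h z) - x ?R) * indicator ?R z)"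
    using w by (intro integrable_indicator_tor) auto
  have i1: "integrable tor (\<lambda>z. (1 - exp (- u z0) * x ?R - u z0) * indicator ?R z)"
    by (intro integrable_indicator_tor) auto
  have iv: "integrable tor v"
    unfolding v_def by (rule Bochner_Integration.integrable_diff[OF i1 integrable_mult_right[OF i0]])
  have Iv: "(\<integral>z. v z \<partial>tor) = (1 - exp (- u z0) * x ?R - u z0) * measure tor ?R"
  proof -
    have "(\<integral>z. v z \<partial>tor) = (\<integral>z. (1 - exp (- u z0) * x ?R - u z0) * indicator ?R z \<partial>tor)
        - (\<integral>z. exp (- u z0) * ((exp (h z) - x ?R) * indicator ?R z) \<partial>tor)"
      unfolding v_def by (rule Bochner_Integration.integral_diff[OF i1 integrable_mult_right[OF i0]])
    also have "(\<integral>z. exp (- u z0) * ((exp (h z) - x ?R) * indicator ?R z) \<partial>tor) = 0"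
      using integral_sub_mean[OF w drect_borel pos] by (simp add: x_def)
    finally show ?thesis by simp
  qed
  have "(\<integral>z. (1 - exp (- u z) * exp (h z) - u z - \<epsilon> * (1 + exp L * exp (h z))) * indicator ?R z \<partial>tor) \<le> (\<integral>z. v z \<partial>tor)"
  proof (intro integral_mono iv integrable_indicator_tor drect_borel)
    show "integrable tor (\<lambda>z. 1 - exp (- u z) * exp (h z) - u z - \<epsilon> * (1 + exp L * exp (h z)))"
      using u(2) by (intro integrable_test_function w) auto
    fix z
    show "(1 - exp (- u z) * exp (h z) - u z - \<epsilon> * (1 + exp L * exp (h z))) * indicator ?R z \<le> v z"
    proof (cases "z \<in> ?R")
      case True
      have n: "u z \<le> u z0 + \<epsilon>" "u z0 \<le> u z + \<epsilon>" using near[OF True] by auto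
      have "exp (- u z0) * (1 - \<epsilon>) \<le> exp (- u z0) * exp (- \<epsilon>)"
        using exp_ge_add_one_self[of "- \<epsilon>"] by (intro mult_left_mono) auto
      also have "\<dots> \<le> exp (- u z)" using n by (simp add: exp_add[symmetric])
      finally have 1: "exp (- u z0) * (1 - \<epsilon>) * exp (h z) \<le> exp (- u z) * exp (h z)"
        by (intro mult_right_mono) auto
      have "exp (- u z0) \<le> exp L" using u(2)[of z0] by simp
      then have "\<epsilon> * (exp (- u z0) * exp (h z)) \<le> \<epsilon> * (exp L * exp (h z))"
        using \<epsilon> by (intro mult_left_mono mult_right_mono) auto
      with 1 n show ?thesis using True by (simp add: v_def algebra_simps)
    qed (simp add: v_def)
  qed
  then have "mean (\<lambda>z. 1 - exp (- u z) * exp (h z) - u z - \<epsilon> * (1 + exp L * exp (h z))) ?R \<le> 1 - exp (- u z0) * x ?R - u z0"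
    unfolding Iv using pos by (simp add: mean_def field_simps)
  also have "\<dots> \<le> - ln (x ?R)"
  proof -
    have "1 + (ln (x ?R) - u z0) \<le> exp (ln (x ?R) - u z0)" by (rule exp_ge_add_one_self)
    moreover have "exp (ln (x ?R) - u z0) = exp (- u z0) * x ?R"
      using x_pos[OF R] by (simp add: exp_diff exp_minus field_simps)
    ultimately show ?thesis by linarith
  qed
  finally show ?case by simp
next
  case (Suc N)
  have [measurable]: "u \<in> borel_measurable borel"
    using u(1) by (rule borel_measurable_continuous_onI)
  have i: "integrable tor (\<lambda>z. 1 - exp (- u z) * exp (h z) - u z - \<epsilon> * (1 + exp L * exp (h z)))"
    using u(2) by (intro integrable_test_function w) auto
  have *: "2 * j < 2 ^ Suc n" "2 * j + 1 < 2 ^ Suc n" "2 * k < 2 ^ Suc m" "2 * k + 1 < 2 ^ Suc m"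
    using Suc.prems by auto
  have sm: "1 / 2 ^ (Suc n + N) + 1 / 2 ^ (Suc m + N) < \<delta>" using Suc.prems by simp
  note IH = Suc.IH[OF _ _ sm]
  have avg4: "(a + b + c + d) / 4 \<le> - ((a' + b' + c' + d') / 4)"
    if "a \<le> - a'" "b \<le> - b'" "c \<le> - c'" "d \<le> - d'" for a b c d a' b' c' d' :: real
  proof -
    have "a + b + c + d \<le> - (a' + b' + c' + d')" using that by linarith
    then show ?thesis unfolding minus_divide_left by (rule divide_right_mono) simp
  qed
  show ?case
    unfolding mean_children[OF i Suc.prems(1,2)] S.simps
    by (rule avg4[OF IH[OF *(1,3)] IH[OF *(1,4)] IH[OF *(2,3)] IH[OF *(2,4)]])
qed

text \<open>For cells so small that \<open>u\<close> is nearly constant on them, the mean is at most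
  \<open>- S\<close>, and the Bellman induction bounds \<open>- S\<close> by
  \<open>1 / c - ln (x R)\<close> for every depth. The depth, which depends on \<open>u\<close>,
  then disappears.\<close>

lemma test_function_bound:
  assumes u: "continuous_on UNIV u" "\<And>z. \<bar>u z\<bar> \<le> L" and R: "R \<in> drects"
  shows "mean (\<lambda>z. 1 - exp (- u z) * exp (h z) - u z) R \<le> 1 / c - ln (x R)"
proof (rule field_le_epsilon)
  fix e :: real assume e: "0 < e"
  obtain n m j k where R_eq: "R = drect n m j k" and jk: "j < 2 ^ n" "k < 2 ^ m"
    using R by (auto simp: drects_iff)
  have Rb: "R \<in> sets borel" and pos: "0 < measure tor R" using R by (auto simp: drects_iff measure_drect)
  have [measurable]: "u \<in> borel_measurable borel"
    using u(1) by (rule borel_measurable_continuous_onI)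
  \<comment> \<open>Chosen so that the subtracted error term has mean exactly \<open>e\<close> over
    \<open>R\<close>.\<close>
  define \<epsilon> where "\<epsilon> = e / (1 + exp L * x R)"
  have D: "0 < 1 + exp L * x R" using x_pos[OF R] by (simp add: add_pos_pos)
  then have \<epsilon>: "0 < \<epsilon>" using e by (simp add: \<epsilon>_def)
  have "compact (cbox (0, 0) (1, 1) :: (real \<times> real) set)" by simp
  then have "uniformly_continuous_on (cbox (0, 0) (1, 1)) u"
    by (intro compact_uniformly_continuous continuous_on_subset[OF u(1)]) auto
  then obtain \<delta> where \<delta>: "0 < \<delta>"
    "\<And>z z'. z \<in> cbox (0, 0) (1, 1) \<Longrightarrow> z' \<in> cbox (0, 0) (1, 1) \<Longrightarrow> dist z' z < \<delta> \<Longrightarrow> dist (u z') (u z) < \<epsilon>"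
    using \<epsilon> unfolding uniformly_continuous_on_def by metis
  have sub: "T2 \<subseteq> cbox (0, 0) (1, 1)" by (auto simp: T2_def torus_def cbox_Pair_eq)
  obtain N where N: "(1 / 2 :: real) ^ N < \<delta> / 2"
    using real_arch_pow_inv[of "\<delta> / 2" "1 / 2"] \<delta> by auto
  have small: "1 / 2 ^ (n + N) + 1 / 2 ^ (m + N) < \<delta>"
  proof -
    have "1 / 2 ^ (i + N) \<le> (1 / 2 :: real) ^ N" for i
      by (simp add: power_add power_one_over divide_simps)
    from this[of n] this[of m] N show ?thesis by linarith
  qed
  have "mean (\<lambda>z. 1 - exp (- u z) * exp (h z) - u z - \<epsilon> * (1 + exp L * exp (h z))) R \<le> - S N n m j k"
    unfolding R_eq
  proof (rule test_function_S[OF u \<epsilon> _ jk small])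
    fix z z' assume "z \<in> T2" "z' \<in> T2" "dist z z' < \<delta>"
    then show "\<bar>u z - u z'\<bar> < \<epsilon>" using \<delta>(2)[of z' z] sub by (auto simp only: dist_real_def)
  qed
  also have "\<dots> \<le> 1 / c - ln (x R)"
  proof -
    have "0 \<le> B R" by (simp add: B_def)
    then have "c * (ln (x R) - S N n m j k) \<le> 1"
      using B_le_S[OF jk, of N] unfolding R_eq by (simp add: algebra_simps)
    then have "ln (x R) - S N n m j k \<le> 1 / c" using c by (simp add: field_simps)
    then show ?thesis by simp
  qed
  also have "mean (\<lambda>z. 1 - exp (- u z) * exp (h z) - u z - \<epsilon> * (1 + exp L * exp (h z))) R
     = mean (\<lambda>z. 1 - exp (- u z) * exp (h z) - u z) R - e"
  proof -
    have i1: "integrable tor (\<lambda>z. (1 - exp (- u z) * exp (h z) - u z) * indicator R z)"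
      using integrable_test_function[where u = u and h = h and L = L and \<epsilon> = 0] u(2) w Rb by (intro integrable_indicator_tor) auto
    have i2: "integrable tor (\<lambda>z. exp (h z) * indicator R z)"
      using w Rb by (intro integrable_indicator_tor) auto
    have i3: "integrable tor (\<lambda>z. \<epsilon> * indicator R z :: real)"
      using Rb by (intro integrable_indicator_tor) auto
    have "(\<integral>z. (1 - exp (- u z) * exp (h z) - u z - \<epsilon> * (1 + exp L * exp (h z))) * indicator R z \<partial>tor)
       = (\<integral>z. (1 - exp (- u z) * exp (h z) - u z) * indicator R z - \<epsilon> * indicator R z - \<epsilon> * exp L * (exp (h z) * indicator R z) \<partial>tor)"
      by (intro Bochner_Integration.integral_cong refl) (simp add: algebra_simps)
    also have "\<dots> = (\<integral>z. (1 - exp (- u z) * exp (h z) - u z) * indicator R z \<partial>tor) - \<epsilon> * measure tor R - \<epsilon> * exp L * (\<integral>z. exp (h z) * indicator R z \<partial>tor)"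
      by (subst Bochner_Integration.integral_diff[OF Bochner_Integration.integrable_diff[OF i1 i3] integrable_mult_right[OF i2]],
          subst Bochner_Integration.integral_diff[OF i1 i3]) (use Rb in simp)
    finally have "mean (\<lambda>z. 1 - exp (- u z) * exp (h z) - u z - \<epsilon> * (1 + exp L * exp (h z))) R
      = mean (\<lambda>z. 1 - exp (- u z) * exp (h z) - u z) R - \<epsilon> * (1 + exp L * x R)"
      using pos by (simp add: mean_def x_def field_simps)
    then show ?thesis using D by (simp add: \<epsilon>_def)
  qed
  finally show "mean (\<lambda>z. 1 - exp (- u z) * exp (h z) - u z) R \<le> 1 / c - ln (x R) + e" by simp
qed

section \<open>From test functions to the logarithm\<close>

lemma AE_tor_negligible:
  assumes "negligible N" shows "AE z in tor. z \<notin> N"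
  unfolding AE_tor_iff using assms by (intro AE_I'[of N]) (auto simp: negligible_iff_null_sets)

text \<open>The best test function is \<open>h\<close> itself, which is neither continuous nor
  bounded. It is reached in two limits: continuous functions converging almost everywhere, truncated
  at a fixed height, and then a growing height.\<close>

lemma log_mean_le:
  assumes R: "R \<in> drects"
  shows "ln (x R) \<le> mean h R + 1 / c"
proof -
  have Rb[measurable]: "R \<in> sets borel" and pos: "0 < measure tor R" using R by (auto simp: drects_iff measure_drect)
  have [measurable]: "h \<in> borel_measurable borel"
    using borel_measurable_integrable[OF h] by measurable
  define clamp where "clamp L t = max (- L) (min L t)" for L t :: real
  have clamp_bound: "\<bar>clamp L t\<bar> \<le> L" if "0 \<le> L" for L t
    using that by (auto simp: clamp_def)
  have clamp_cont: "continuous_on UNIV (clamp L)" for L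
    unfolding clamp_def by (intro continuous_intros)
  have [measurable]: "clamp L \<in> borel_measurable borel" for L
    by (intro borel_measurable_continuous_onI clamp_cont)
  have "h measurable_on UNIV"
    by (rule lebesgue_measurable_imp_measurable_on) (auto simp: measurable_completion intro!: sets_completionI_sets)
  then obtain N g where N: "negligible N" and g: "\<And>i. continuous_on UNIV (g i)"
    and lim: "\<And>z. z \<notin> N \<Longrightarrow> (\<lambda>i. g i z) \<longlonglongrightarrow> h z"
    unfolding measurable_on_def by auto
  have [measurable]: "g i \<in> borel_measurable borel" for i
    by (intro borel_measurable_continuous_onI g)
  let ?T = "\<lambda>u z. (1 - exp (- u z) * exp (h z) - u z) * indicator R z"
  \<comment> \<open>With the height fixed, all test functions stay in [-L, L], which provides the
    dominating function.\<close>
  have stage1: "(\<integral>z. ?T (\<lambda>z. clamp L (h z)) z \<partial>tor) \<le> (1 / c - ln (x R)) * measure tor R" if L: "0 \<le> L" for L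
  proof (rule LIMSEQ_le_const2)
    show "(\<lambda>i. \<integral>z. ?T (\<lambda>z. clamp L (g i z)) z \<partial>tor) \<longlonglongrightarrow> (\<integral>z. ?T (\<lambda>z. clamp L (h z)) z \<partial>tor)"
    proof (rule integral_dominated_convergence[where w = "\<lambda>z. 1 + exp L * exp (h z) + L"])
      show "integrable tor (\<lambda>z. 1 + exp L * exp (h z) + L)" using w by auto
      show "AE z in tor. (\<lambda>i. ?T (\<lambda>z. clamp L (g i z)) z) \<longlonglongrightarrow> ?T (\<lambda>z. clamp L (h z)) z"
        using AE_tor_negligible[OF N]
      proof eventually_elim
        case (elim z)
        have "(\<lambda>i. clamp L (g i z)) \<longlonglongrightarrow> clamp L (h z)"
          unfolding clamp_def by (intro tendsto_intros lim elim)
        then show ?case by (intro tendsto_intros)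
      qed
      show "AE z in tor. norm (?T (\<lambda>z. clamp L (g i z)) z) \<le> 1 + exp L * exp (h z) + L" for i
      proof (rule AE_I2)
        fix z
        let ?u = "clamp L (g i z)"
        have u: "\<bar>?u\<bar> \<le> L" by (rule clamp_bound[OF L])
        have "exp (- ?u) * exp (h z) \<le> exp L * exp (h z)" using u by (intro mult_right_mono) auto
        moreover have "0 \<le> exp (- ?u) * exp (h z)" by simp
        ultimately have "\<bar>1 - exp (- ?u) * exp (h z) - ?u\<bar> \<le> 1 + exp L * exp (h z) + L"
          using u by linarith
        moreover have "0 \<le> 1 + exp L * exp (h z) + L" using L by (simp add: add_nonneg_nonneg)
        ultimately show "norm (?T (\<lambda>z. clamp L (g i z)) z) \<le> 1 + exp L * exp (h z) + L"
          by (simp add: indicator_def)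
      qed
    qed measurable
    show "\<exists>n. \<forall>i\<ge>n. (\<integral>z. ?T (\<lambda>z. clamp L (g i z)) z \<partial>tor) \<le> (1 / c - ln (x R)) * measure tor R"
    proof (intro exI allI impI)
      fix i
      have "mean (\<lambda>z. 1 - exp (- clamp L (g i z)) * exp (h z) - clamp L (g i z)) R \<le> 1 / c - ln (x R)"
        by (rule test_function_bound[OF _ clamp_bound[OF L] R])
          (rule continuous_on_compose2[OF clamp_cont g], simp)
      then show "(\<integral>z. ?T (\<lambda>z. clamp L (g i z)) z \<partial>tor) \<le> (1 / c - ln (x R)) * measure tor R"
        using pos by (simp add: mean_def pos_divide_le_eq)
    qed
  qed
  have "(\<integral>z. - h z * indicator R z \<partial>tor) \<le> (1 / c - ln (x R)) * measure tor R"
  proof (rule LIMSEQ_le_const2)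
    show "(\<lambda>i. \<integral>z. ?T (\<lambda>z. clamp (real i) (h z)) z \<partial>tor) \<longlonglongrightarrow> (\<integral>z. - h z * indicator R z \<partial>tor)"
    proof (rule integral_dominated_convergence[where w = "\<lambda>z. 2 + exp (h z) + \<bar>h z\<bar>"])
      show "integrable tor (\<lambda>z. 2 + exp (h z) + \<bar>h z\<bar>)" using w h by auto
      show "AE z in tor. (\<lambda>i. ?T (\<lambda>z. clamp (real i) (h z)) z) \<longlonglongrightarrow> - h z * indicator R z"
      proof (rule AE_I2, rule tendsto_eventually)
        fix z
        obtain n where n: "\<bar>h z\<bar> \<le> real n" using real_arch_simple by blast
        have "?T (\<lambda>z. clamp (real i) (h z)) z = - h z * indicator R z" if "n \<le> i" for i
        proof -
          have "\<bar>h z\<bar> \<le> real i" using n that by linarith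
          then have "clamp (real i) (h z) = h z" unfolding clamp_def by linarith
          then show ?thesis by (simp add: exp_add[symmetric])
        qed
        then show "\<forall>\<^sub>F i in sequentially. ?T (\<lambda>z. clamp (real i) (h z)) z = - h z * indicator R z"
          unfolding eventually_sequentially by blast
      qed
      show "AE z in tor. norm (?T (\<lambda>z. clamp (real i) (h z)) z) \<le> 2 + exp (h z) + \<bar>h z\<bar>" for i
      proof (rule AE_I2)
        fix z
        let ?u = "clamp (real i) (h z)"
        \<comment> \<open>The domination must not depend on the height: truncation leaves at most
          the positive part of \<open>h\<close> in the exponent, hence the bound
          \<open>1 + exp (h z)\<close>.\<close>
        have "h z - ?u \<le> max 0 (h z)" "\<bar>?u\<bar> \<le> \<bar>h z\<bar>" by (auto simp: clamp_def)
        then have "exp (h z - ?u) \<le> exp (max 0 (h z))" by simp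
        also have "\<dots> \<le> 1 + exp (h z)" by (simp add: max_def)
        finally have "exp (- ?u) * exp (h z) \<le> 1 + exp (h z)" by (simp add: exp_add[symmetric])
        moreover have "0 \<le> exp (- ?u) * exp (h z)" by simp
        ultimately have "\<bar>1 - exp (- ?u) * exp (h z) - ?u\<bar> \<le> 2 + exp (h z) + \<bar>h z\<bar>"
          using \<open>\<bar>?u\<bar> \<le> \<bar>h z\<bar>\<close> by linarith
        moreover have "0 \<le> 2 + exp (h z) + \<bar>h z\<bar>" by (simp add: add_nonneg_nonneg)
        ultimately show "norm (?T (\<lambda>z. clamp (real i) (h z)) z) \<le> 2 + exp (h z) + \<bar>h z\<bar>"
          by (simp add: indicator_def)
      qed
    qed measurable
    show "\<exists>n. \<forall>i\<ge>n. (\<integral>z. ?T (\<lambda>z. clamp (real i) (h z)) z \<partial>tor) \<le> (1 / c - ln (x R)) * measure tor R"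
      using stage1 by auto
  qed
  then have "- mean h R \<le> 1 / c - ln (x R)"
    using pos by (simp add: mean_def field_simps)
  then show ?thesis by simp
qed

text \<open>The dyadic condition for exponent infinity in the form required by
  \<open>averaging\<close>, with a constant determined by \<open>q\<close>, \<open>K\<close> and
  \<open>V\<close> alone.\<close>

lemma dyadic_bound_exp: "dyadic_bound (\<lambda>u. ennreal (exp u)) (ennreal (exp (1 / c))) h"
  unfolding dyadic_bound_def
proof
  fix R assume R: "R \<in> drects"
  have Rb[measurable]: "R \<in> sets borel" and pos: "0 < measure tor R" using R by (auto simp: drects_iff measure_drect)
  have i: "integrable tor (\<lambda>z. exp (h z) * indicator R z)"
    using w Rb by (intro integrable_indicator_tor)
  have "(\<integral>\<^sup>+z. ennreal (exp (h z - mean h R)) * indicator R z \<partial>tor)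
     = (\<integral>\<^sup>+z. ennreal (exp (- mean h R) * (exp (h z) * indicator R z)) \<partial>tor)"
    by (intro nn_integral_cong) (simp add: indicator_def exp_add[symmetric])
  also have "\<dots> = ennreal (exp (- mean h R) * (x R * measure tor R))"
    using i pos by (subst nn_integral_eq_integral) (auto simp: x_def mean_def)
  also have "exp (- mean h R) * (x R * measure tor R) \<le> exp (1 / c) * measure tor R"
  proof -
    have "x R = exp (ln (x R))" using x_pos[OF R] by simp
    also have "\<dots> \<le> exp (mean h R + 1 / c)" using log_mean_le[OF R] by simp
    finally have "exp (- mean h R) * x R \<le> exp (- mean h R) * exp (mean h R + 1 / c)"
      by (intro mult_left_mono) auto
    then have "exp (- mean h R) * x R \<le> exp (1 / c)" by (simp add: exp_add[symmetric])
    then show ?thesis using pos by (simp add: mult.assoc[symmetric])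
  qed
  finally show "(\<integral>\<^sup>+z. ennreal (exp (h z - mean h R)) * indicator R z \<partial>tor) \<le> ennreal (exp (1 / c)) * emeasure tor R"
    by (simp add: tor.emeasure_eq_measure ennreal_mult[symmetric] ennreal_leI)
qed

end

section \<open>Weights and their logarithms\<close>

lemma measurable_completion_cong_AE:
  fixes f g :: "'a \<Rightarrow> 'b::topological_space"
  assumes f: "f \<in> borel_measurable (completion M)" and ae: "AE x in completion M. f x = g x"
  shows "g \<in> borel_measurable (completion M)"
proof (rule measurableI)
  fix A :: "'b set" assume A: "A \<in> sets borel"
  have "complete_measure (completion M)" ..
  then show "g -` A \<inter> space (completion M) \<in> sets (completion M)"
  proof (rule complete_measure.in_sets_AE)
    show "AE x in completion M. x \<in> f -` A \<inter> space (completion M) \<longleftrightarrow> x \<in> g -` A \<inter> space (completion M)"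
      using ae by eventually_elim auto
    show "f -` A \<inter> space (completion M) \<in> sets (completion M)"
      using f A by (rule measurable_sets)
  qed auto
qed simp

text \<open>A function given only up to null sets inherits integrability and integral from its Borel
  representative, by completeness of Lebesgue measure.\<close>

lemma set_integral_lebesgue_tor:
  fixes \<phi> f :: "real \<times> real \<Rightarrow> real"
  assumes ae: "AE z in tor. \<phi> z = f z" and f: "integrable tor f" and R[measurable]: "R \<in> sets borel" and sub: "R \<subseteq> T2"
  shows "set_integrable lebesgue R \<phi>"
    and "set_lebesgue_integral lebesgue R \<phi> = (\<integral>z. f z * indicator R z \<partial>tor)"
proof -
  have [measurable]: "f \<in> borel_measurable borel"
    using borel_measurable_integrable[OF f] by measurable
  have ae': "AE z in lebesgue. indicator R z *\<^sub>R f z = indicator R z *\<^sub>R \<phi> z"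
    using ae unfolding AE_tor_iff by eventually_elim (use sub in \<open>auto simp: indicator_def\<close>)
  have m1: "(\<lambda>z. indicator R z *\<^sub>R f z) \<in> borel_measurable lebesgue"
    by (intro measurable_completion) measurable
  have m2: "(\<lambda>z. indicator R z *\<^sub>R \<phi> z) \<in> borel_measurable lebesgue"
    by (rule measurable_completion_cong_AE[OF m1 ae'])
  have eq: "indicator R z *\<^sub>R f z = indicator T2 z *\<^sub>R (f z * indicator R z)" for z
    using sub by (auto simp: indicator_def)
  have i: "integrable tor (\<lambda>z. f z * indicator R z)" by (rule integrable_indicator_tor[OF f R])
  have dens: "tor = density lborel (\<lambda>z. ennreal (indicator T2 z))"
    by (simp add: tor_eq_density ennreal_indicator)
  have i': "integrable lborel (\<lambda>z. indicator R z *\<^sub>R f z)"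
    unfolding eq using i unfolding dens
    by (subst (asm) integrable_density) auto
  then have "integrable lebesgue (\<lambda>z. indicator R z *\<^sub>R f z)"
    by (subst integrable_completion) auto
  then show "set_integrable lebesgue R \<phi>"
    unfolding set_integrable_def using integrable_cong_AE[OF m1 m2 ae'] by blast
  have "set_lebesgue_integral lebesgue R \<phi> = (\<integral>z. indicator R z *\<^sub>R f z \<partial>lebesgue)"
    unfolding set_lebesgue_integral_def by (rule integral_cong_AE[OF m1 m2 ae', symmetric])
  also have "\<dots> = (\<integral>z. indicator R z *\<^sub>R f z \<partial>lborel)"
    by (intro integral_completion) measurable
  also have "\<dots> = (\<integral>z. f z * indicator R z \<partial>tor)"
    unfolding eq dens by (subst integral_density) auto
  finally show "set_lebesgue_integral lebesgue R \<phi> = (\<integral>z. f z * indicator R z \<partial>tor)" .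
qed

definition eavg :: "(real \<times> real \<Rightarrow> real) \<Rightarrow> real \<Rightarrow> (real \<times> real) set \<Rightarrow> ennreal" where
  "eavg h r R = (\<integral>\<^sup>+z. ennreal (exp (r * h z)) * indicator R z \<partial>tor) / emeasure tor R"

lemma nn_integral_weight_eq:
  assumes ae: "AE z in tor. \<phi> z = f z" and [measurable]: "f \<in> borel_measurable borel" "R \<in> sets borel" and sub: "R \<subseteq> T2"
  shows "(\<integral>\<^sup>+z. ennreal (\<phi> z) * indicator R z \<partial>lebesgue) = (\<integral>\<^sup>+z. ennreal (f z) * indicator R z \<partial>tor)"
proof -
  have "(\<integral>\<^sup>+z. ennreal (\<phi> z) * indicator R z \<partial>lebesgue) = (\<integral>\<^sup>+z. ennreal (f z) * indicator R z \<partial>lebesgue)"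
    using ae unfolding AE_tor_iff
    by (intro nn_integral_cong_AE, eventually_elim) (use sub in \<open>auto simp: indicator_def\<close>)
  also have "\<dots> = (\<integral>\<^sup>+z. ennreal (f z) * indicator R z \<partial>tor)"
    using sub by (intro nn_integral_lebesgue_tor) auto
  finally show ?thesis .
qed

lemma avg_eq_eavg:
  assumes ae: "AE z in tor. \<phi> z = exp (r * h z)" and h[measurable]: "h \<in> borel_measurable borel"
    and R: "R \<in> sets borel" and sub: "R \<subseteq> T2"
  shows "avg R \<phi> = eavg h r R"
  unfolding avg_def eavg_def
  using nn_integral_weight_eq[OF ae _ R sub] emeasure_lebesgue_tor[OF R sub] by simp

lemma exp_mean_le_eavg:
  assumes h: "integrable tor h" and R: "R \<in> sets borel" and pos: "0 < measure tor R"
  shows "ennreal (exp (r * mean h R)) \<le> eavg h r R"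
proof -
  have "mean (\<lambda>z. r * h z) R = r * mean h R"
    by (simp add: mean_def mult.assoc)
  then have "ennreal (exp (r * mean h R)) * emeasure tor R \<le> (\<integral>\<^sup>+z. ennreal (exp (r * h z)) * indicator R z \<partial>tor)"
    using exp_mean_le[of "\<lambda>z. r * h z" R] h R pos by simp
  from divide_right_mono_ennreal[OF this, of "emeasure tor R"] show ?thesis
    unfolding eavg_def using pos by (simp add: mult_divide_eq_ennreal tor.emeasure_eq_measure)
qed

text \<open>Passes between the centred exponentials of \<open>dyadic_bound\<close> and the averages
  of powers of a weight in the definitions of the classes. Values stay in \<open>ennreal\<close>
  because such an average may be infinite.\<close>

lemma nn_integral_exp_shift:
  assumes [measurable]: "h \<in> borel_measurable borel" "R \<in> sets borel" and pos: "0 < measure tor R"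
  shows "(\<integral>\<^sup>+z. ennreal (exp (r * (h z - c))) * indicator R z \<partial>tor) = ennreal (exp (- r * c)) * (eavg h r R * emeasure tor R)"
proof -
  have "(\<integral>\<^sup>+z. ennreal (exp (r * (h z - c))) * indicator R z \<partial>tor)
      = (\<integral>\<^sup>+z. ennreal (exp (- r * c)) * (ennreal (exp (r * h z)) * indicator R z) \<partial>tor)"
    by (intro nn_integral_cong) (auto simp: indicator_def ennreal_mult[symmetric] exp_add[symmetric] algebra_simps)
  also have "\<dots> = ennreal (exp (- r * c)) * (\<integral>\<^sup>+z. ennreal (exp (r * h z)) * indicator R z \<partial>tor)"
    by (intro nn_integral_cmult) measurable
  also have "(\<integral>\<^sup>+z. ennreal (exp (r * h z)) * indicator R z \<partial>tor) = eavg h r R * emeasure tor R"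
    unfolding eavg_def using pos
    by (simp add: ennreal_divide_times ennreal_divide_self tor.emeasure_eq_measure)
  finally show ?thesis .
qed

lemma nn_integral_exp_shift_leI:
  assumes h: "h \<in> borel_measurable borel" "R \<in> sets borel" and pos: "0 < measure tor R" and "0 \<le> U"
    and bd: "eavg h r R \<le> ennreal (U * exp (r * c))"
  shows "(\<integral>\<^sup>+z. ennreal (exp (r * (h z - c))) * indicator R z \<partial>tor) \<le> ennreal U * emeasure tor R"
proof -
  have "ennreal (exp (- r * c)) * (eavg h r R * emeasure tor R)
      \<le> ennreal (exp (- r * c)) * (ennreal (U * exp (r * c)) * emeasure tor R)"
    by (intro mult_left_mono mult_right_mono bd) auto
  also have "\<dots> = ennreal (exp (- r * c) * (U * exp (r * c))) * emeasure tor R"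
    using \<open>0 \<le> U\<close> by (simp add: ennreal_mult mult.assoc)
  also have "exp (- r * c) * (U * exp (r * c)) = U"
    by (simp add: exp_minus field_simps)
  finally show ?thesis unfolding nn_integral_exp_shift[OF h pos] .
qed

lemma eavg_leI:
  assumes h: "h \<in> borel_measurable borel" "R \<in> sets borel" and pos: "0 < measure tor R" and "0 \<le> U"
    and bd: "(\<integral>\<^sup>+z. ennreal (exp (r * (h z - c))) * indicator R z \<partial>tor) \<le> ennreal U * emeasure tor R"
  shows "eavg h r R \<le> ennreal (U * exp (r * c))"
proof -
  have "ennreal (exp (- r * c)) * (eavg h r R * emeasure tor R) \<le> ennreal U * emeasure tor R"
    using bd unfolding nn_integral_exp_shift[OF h pos] .
  then have "ennreal (exp (r * c)) * (ennreal (exp (- r * c)) * (eavg h r R * emeasure tor R))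
     \<le> ennreal (exp (r * c)) * (ennreal U * emeasure tor R)"
    by (intro mult_left_mono) auto
  moreover have "ennreal (exp (r * c)) * (ennreal (exp (- r * c)) * (eavg h r R * emeasure tor R)) = eavg h r R * emeasure tor R"
    unfolding mult.assoc[symmetric] by (simp add: ennreal_mult[symmetric] exp_add[symmetric])
  moreover have "ennreal (exp (r * c)) * (ennreal U * emeasure tor R) = ennreal (U * exp (r * c)) * emeasure tor R"
    using \<open>0 \<le> U\<close> by (simp add: ennreal_mult mult_ac)
  ultimately have "emeasure tor R * eavg h r R \<le> emeasure tor R * ennreal (U * exp (r * c))"
    by (simp add: mult.commute)
  then show ?thesis
    using pos by (subst (asm) ennreal_mult_le_mult_iff) (auto simp: tor.emeasure_eq_measure)
qed

lemma epow_leD: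
  assumes "epow E a \<le> ennreal B" "0 < a" "0 \<le> B"
  shows "E \<le> ennreal (B powr (1 / a))"
proof (cases E)
  case (real e)
  then have "e powr a \<le> B" using assms by (simp add: epow_def)
  then have "(e powr a) powr (1 / a) \<le> B powr (1 / a)" using assms by (intro powr_mono2) auto
  then show ?thesis using real assms by (simp add: powr_powr ennreal_leI)
next
  case top
  then show ?thesis using assms by (simp add: epow_def top_unique)
qed

lemma epow_mono:
  assumes "E \<le> F" "0 < a" shows "epow E a \<le> epow F a"
proof (cases F)
  case (real f)
  with assms obtain e where "E = ennreal e" "0 \<le> e" "e \<le> f"
    by (metis le_ennreal_iff)
  then show ?thesis using real assms by (auto simp: epow_def intro!: ennreal_leI powr_mono2)
qed (simp add: epow_def)

lemma epow_ennreal: "0 \<le> e \<Longrightarrow> epow (ennreal e) a = ennreal (e powr a)"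
  by (simp add: epow_def)

section \<open>Arcs and their dyadic scale\<close>

lemma borel_arc: "arc a l \<in> sets borel"
proof -
  have "{x \<in> space borel. x \<in> torus \<and> frac (x - a) < l} \<in> sets borel"
    unfolding torus_def by measurable
  then show ?thesis by (simp add: arc_def)
qed

lemma emeasure_arc:
  assumes "0 < l" "l \<le> 1"
  shows "emeasure circ (arc a l) = ennreal l"
proof -
  have "emeasure circ (arc a l) = (\<integral>\<^sup>+x. indicator (arc a l) x \<partial>circ)"
    using borel_arc by simp
  also have "\<dots> = (\<integral>\<^sup>+x. indicator {..<l} (frac (x + - a)) \<partial>circ)"
  proof (rule nn_integral_cong_AE)
    have "AE x in circ. x \<in> torus"
      unfolding circ_def torus_def by (subst AE_density) (auto simp: indicator_def)
    then show "AE x in circ. indicator (arc a l) x = (indicator {..<l} (frac (x + - a)) :: ennreal)"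
      by eventually_elim (simp add: arc_def indicator_def)
  qed
  also have "\<dots> = (\<integral>\<^sup>+x. indicator {..<l} x \<partial>circ)"
    by (rule nn_integral_circ_frac) measurable
  also have "\<dots> = (\<integral>\<^sup>+x. indicator {0..<1} x * indicator {..<l} x \<partial>lborel)"
    unfolding circ_def by (subst nn_integral_density) auto
  also have "\<dots> = (\<integral>\<^sup>+x. indicator {0..<l} x \<partial>lborel)"
    using assms by (intro nn_integral_cong) (auto simp: indicator_def)
  also have "\<dots> = ennreal l" using assms by simp
  finally show ?thesis .
qed

text \<open>The predecessor of the first generation whose cells are shorter than \<open>l\<close>;
  since \<open>l \<le> 1\<close>, that generation is not 0.\<close>

lemma dyadic_scale:
  assumes "0 < l" "l \<le> (1::real)"
  obtains n where "l \<le> 1 / 2 ^ n" "1 / 2 ^ n \<le> 2 * l"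
proof -
  obtain N where N: "(1 / 2 :: real) ^ N < l" using real_arch_pow_inv[of l "1 / 2"] assms by auto
  define P where "P n \<longleftrightarrow> 1 / 2 ^ n < l" for n :: nat
  have PN: "P N" using N by (simp add: P_def power_one_over)
  define k where "k = (LEAST n. P n)"
  have k: "P k" unfolding k_def using PN by (rule LeastI)
  have "k \<noteq> 0" using k assms by (auto simp: P_def intro: ccontr)
  then obtain n where n: "k = Suc n" by (cases k) auto
  have "\<not> P n" using not_less_Least[of n P] n by (simp add: k_def)
  then show ?thesis using that[of n] k n by (simp add: P_def field_simps)
qed

text \<open>The corner \<open>a\<close> consists of the starting points of the two arcs. Each side
  loses at most a factor 2 in rounding up to a power of 2, hence the 4.\<close>

lemma rects_scale:
  assumes "Q \<in> rects"
  obtains a n m where "Q \<in> sets borel" "Q \<subseteq> T2"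
    "\<forall>z\<in>Q. frac (fst z - fst a) < 1 / 2 ^ n \<and> frac (snd z - snd a) < 1 / 2 ^ m"
    "1 / 2 ^ n * (1 / 2 ^ m) \<le> 4 * measure tor Q"
proof -
  obtain a l b l' where Q: "Q = arc a l \<times> arc b l'" and l: "0 < l" "l \<le> 1" "0 < l'" "l' \<le> 1"
    using assms by (auto simp: rects_def intervals_def)
  obtain n where n: "l \<le> 1 / 2 ^ n" "1 / 2 ^ n \<le> 2 * l" using dyadic_scale[OF l(1,2)] .
  obtain m where m: "l' \<le> 1 / 2 ^ m" "1 / 2 ^ m \<le> 2 * l'" using dyadic_scale[OF l(3,4)] .
  have "emeasure tor Q = ennreal l * ennreal l'"
    unfolding tor_def Q using borel_arc l by (subst circ.emeasure_pair_measure_Times) (auto simp: emeasure_arc)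
  then have meas: "measure tor Q = l * l'"
    using l by (simp add: measure_def ennreal_mult[symmetric])
  have size: "1 / 2 ^ n * (1 / 2 ^ m) \<le> 4 * measure tor Q"
    using mult_mono[OF n(2) m(2)] l by (simp add: meas)
  show ?thesis
  proof (rule that[of "(a, b)" n m])
    show "Q \<in> sets borel" unfolding Q using borel_arc by (intro borel_Times)
    show "Q \<subseteq> T2" by (auto simp: Q arc_def T2_def)
    show "1 / 2 ^ n * (1 / 2 ^ m) \<le> 4 * measure tor Q" by (rule size)
    show "\<forall>z\<in>Q. frac (fst z - fst (a, b)) < 1 / 2 ^ n \<and> frac (snd z - snd (a, b)) < 1 / 2 ^ m"
      using n(1) m(1) by (auto simp: Q arc_def)
  qed
qed

lemma T2_mem_rects: "T2 \<in> rects"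
proof -
  have "arc 0 1 = torus" by (auto simp: arc_def frac_lt_1)
  moreover have "arc 0 1 \<in> intervals"
    unfolding intervals_def mem_Collect_eq by (intro exI[of _ 0] exI[of _ 1]) (auto simp: torus_def)
  ultimately show ?thesis unfolding rects_def T2_def by blast
qed

lemma measure_tor_T2: "measure tor T2 = 1" "emeasure tor T2 = 1"
proof -
  have "emeasure tor T2 = emeasure tor UNIV"
    using AE_tor_T2 by (intro emeasure_eq_AE) auto
  then show "emeasure tor T2 = 1" "measure tor T2 = 1" by (simp_all add: emeasure_tor_space measure_def)
qed

section \<open>A Borel representative of the family\<close>

lemma tor_tor_eq_density: "tor \<Otimes>\<^sub>M tor = density lborel (indicator (T2 \<times> T2))"
proof -
  have "tor \<Otimes>\<^sub>M tor = density (lborel \<Otimes>\<^sub>M lborel) (\<lambda>(x, y). indicator T2 x * indicator T2 y)"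
    using tor.sigma_finite_measure_axioms unfolding tor_eq_density
    by (intro pair_measure_density) (auto simp: sigma_finite_lborel)
  also have "\<dots> = density lborel (indicator (T2 \<times> T2))"
    unfolding lborel_prod by (intro arg_cong[where f = "density lborel"]) (auto simp: indicator_def)
  finally show ?thesis .
qed

text \<open>The representative agrees with the logarithm off a null set of the four-dimensional
  space. Fubini is needed along two families of slices: \<open>st\<close> fixed, for the hypotheses
  on the weights, and \<open>z\<close> fixed with the point rotated by \<open>st\<close>, for
  \<open>Omega\<close>.\<close>

lemma family_representation:
  assumes fam: "family_cond w" and wt: "\<And>s t. s \<in> {0..1} \<Longrightarrow> t \<in> {0..1} \<Longrightarrow> weight (w s t)"
  obtains g where "integrable (tor \<Otimes>\<^sub>M tor) g"
    "AE st in tor. st \<in> T2 \<and> (AE z in tor. w (fst st) (snd st) z = exp (g (st, z)))"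
    "AE z in tor. Omega w z = exp (\<integral>st. g (st, rot st z) \<partial>tor)"
proof -
  define W where "W q = w (fst (fst q)) (snd (fst q)) (snd q)" for q
  have W: "(\<lambda>q. indicator S4 q *\<^sub>R W q) \<in> borel_measurable lebesgue"
    using fam by (simp add: family_cond_def set_borel_measurable_def W_def[abs_def] case_prod_beta)
  have fin: "(\<integral>\<^sup>+q. ennreal \<bar>ln (W q)\<bar> * indicator S4 q \<partial>lebesgue) < top"
    using fam by (simp add: family_cond_def W_def)
  have "(\<lambda>q. ln (indicator S4 q *\<^sub>R W q)) \<in> borel_measurable lebesgue"
    using W by measurable
  from completion_ex_borel_measurable_real[OF this] obtain g where
    g0: "g \<in> borel_measurable lborel" and g_ae: "AE q in lborel. ln (indicator S4 q *\<^sub>R W q) = g q" by auto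
  have g[measurable]: "g \<in> borel_measurable (borel \<Otimes>\<^sub>M borel)" using g0 by (simp add: borel_prod)
  have sub: "T2 \<times> T2 \<subseteq> S4" by (auto simp: S4_def T2_def torus_def)
  have TT: "T2 \<times> T2 \<in> sets borel" by (simp add: borel_Times)
  have ae4: "AE q in lborel. q \<in> T2 \<times> T2 \<longrightarrow> ln (W q) = g q"
    using g_ae by eventually_elim (use sub in \<open>auto simp: indicator_def split: if_splits\<close>)
  have ae: "AE q in tor \<Otimes>\<^sub>M tor. ln (W q) = g q"
    unfolding tor_tor_eq_density using ae4 TT by (subst AE_density) (auto simp: indicator_def)
  have g_int: "integrable (tor \<Otimes>\<^sub>M tor) g"
  proof (rule integrableI_bounded)
    show "g \<in> borel_measurable (tor \<Otimes>\<^sub>M tor)" by measurable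
    have "(\<integral>\<^sup>+q. ennreal (norm (g q)) \<partial>(tor \<Otimes>\<^sub>M tor)) = (\<integral>\<^sup>+q. indicator (T2 \<times> T2) q * ennreal (norm (g q)) \<partial>lborel)"
      unfolding tor_tor_eq_density using g0 TT by (subst nn_integral_density) auto
    also have "\<dots> \<le> (\<integral>\<^sup>+q. ennreal \<bar>ln (W q)\<bar> * indicator S4 q \<partial>lborel)"
      using ae4 by (intro nn_integral_mono_AE, eventually_elim) (use sub in \<open>auto simp: indicator_def\<close>)
    also have "\<dots> < \<infinity>" using fin by (simp add: nn_integral_completion)
    finally show "(\<integral>\<^sup>+q. ennreal (norm (g q)) \<partial>(tor \<Otimes>\<^sub>M tor)) < \<infinity>" .
  qed
  have "AE st in tor. AE z in tor. ln (W (st, z)) = g (st, z)"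
    by (rule tor2.AE_pair[OF ae])
  with AE_tor_T2 have rep: "AE st in tor. st \<in> T2 \<and> (AE z in tor. w (fst st) (snd st) z = exp (g (st, z)))"
  proof eventually_elim
    case (elim st)
    then have "weight (w (fst st) (snd st))" by (intro wt) (auto simp: T2_def torus_def)
    then have "AE z in tor. 0 < w (fst st) (snd st) z" unfolding AE_tor_iff weight_def by simp
    moreover have "AE z in tor. ln (W (st, z)) = g (st, z)" using elim by simp
    ultimately have "AE z in tor. w (fst st) (snd st) z = exp (g (st, z))"
    proof eventually_elim
      case (elim z)
      then show ?case using exp_ln[of "w (fst st) (snd st) z"] by (simp add: W_def)
    qed
    with elim show ?case by simp
  qed
  \<comment> \<open>A Borel null set covering the exceptional set, since its preimages under the
    rotations have to be measurable. They are again null because rotations preserve the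
    measure.\<close>
  obtain N where N: "{q \<in> space (tor \<Otimes>\<^sub>M tor). ln (W q) \<noteq> g q} \<subseteq> N" "N \<in> null_sets (tor \<Otimes>\<^sub>M tor)"
    using ae unfolding eventually_ae_filter by auto
  have Nm[measurable]: "N \<in> sets (borel \<Otimes>\<^sub>M borel)" using N(2) by auto
  have "(\<integral>\<^sup>+z. \<integral>\<^sup>+st. indicator N (st, rot st z) \<partial>tor \<partial>tor) = (\<integral>\<^sup>+st. \<integral>\<^sup>+z. indicator N (st, rot st z) \<partial>tor \<partial>tor)"
    by (rule tor2.Fubini'[symmetric]) measurable
  also have "\<dots> = (\<integral>\<^sup>+st. \<integral>\<^sup>+z. indicator N (st, z) \<partial>tor \<partial>tor)"
    by (intro nn_integral_cong nn_integral_tor_rot) measurable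
  also have "\<dots> = (\<integral>\<^sup>+q. indicator N q \<partial>(tor \<Otimes>\<^sub>M tor))"
    by (rule tor.nn_integral_fst) measurable
  also have "\<dots> = 0" using N(2) by auto
  finally have "(\<integral>\<^sup>+z. \<integral>\<^sup>+st. indicator N (st, rot st z) \<partial>tor \<partial>tor) = 0" .
  then have "AE z in tor. (\<integral>\<^sup>+st. indicator N (st, rot st z) \<partial>tor) = 0"
    by (subst (asm) nn_integral_0_iff_AE) auto
  then have ae_rot: "AE z in tor. AE st in tor. ln (W (st, rot st z)) = g (st, rot st z)"
  proof eventually_elim
    case (elim z)
    then have "AE st in tor. (indicator N (st, rot st z) :: ennreal) = 0"
      by (subst (asm) nn_integral_0_iff_AE) auto
    then show ?case
      by eventually_elim (use N(1) in \<open>auto simp: indicator_def space_pair_measure split: if_splits\<close>)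
  qed
  have "integrable (tor \<Otimes>\<^sub>M tor) (\<lambda>(z, st). g (st, rot st z))"
    by (rule integrable_rot[OF g_int])
  from tor2.AE_integrable_fst'[OF this]
  have ae_int: "AE z in tor. integrable tor (\<lambda>st. g (st, rot st z))" by simp
  \<comment> \<open>\<open>Omega\<close> integrates over the closed square, the measure
    \<open>tor\<close> lives on the half-open one; they differ by two null segments.\<close>
  have unit: "AE st in lebesgue. indicator ({0..1} \<times> {0..1}) st = (indicator T2 st :: real)"
  proof -
    have "AE st in lborel. fst st \<noteq> (1::real) \<and> snd st \<noteq> (1::real)"
    proof -
      have "{1} \<times> UNIV \<in> null_sets (lborel \<Otimes>\<^sub>M lborel :: (real \<times> real) measure)"
        "UNIV \<times> {1} \<in> null_sets (lborel \<Otimes>\<^sub>M lborel :: (real \<times> real) measure)"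
        by (auto simp: null_sets_def lborel.emeasure_pair_measure_Times)
      from this[THEN AE_not_in] show ?thesis unfolding lborel_prod
        by eventually_elim (auto simp: mem_Times_iff)
    qed
    then show ?thesis unfolding AE_completion_iff
      by eventually_elim (auto simp: indicator_def T2_def torus_def)
  qed
  have "AE z in tor. Omega w z = exp (\<integral>st. g (st, rot st z) \<partial>tor)"
    using ae_rot ae_int
  proof eventually_elim
    case (elim z)
    let ?f = "\<lambda>st. ln (w (fst st) (snd st) (frac (fst z + fst st), frac (snd z + snd st)))"
    have f_eq: "?f = (\<lambda>st. ln (W (st, rot st z)))" by (simp add: W_def rot_def)
    have "set_integrable lebesgue T2 ?f" and I: "set_lebesgue_integral lebesgue T2 ?f = (\<integral>st. g (st, rot st z) * indicator T2 st \<partial>tor)"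
      using elim unfolding f_eq by (auto intro!: set_integral_lebesgue_tor)
    then have m: "(\<lambda>st. indicator T2 st *\<^sub>R ?f st) \<in> borel_measurable lebesgue"
      unfolding set_integrable_def by auto
    have ae1: "AE st in lebesgue. indicator T2 st *\<^sub>R ?f st = indicator ({0..1} \<times> {0..1}) st *\<^sub>R ?f st"
      using unit by eventually_elim simp
    have "set_lebesgue_integral lebesgue ({0..1} \<times> {0..1}) ?f = set_lebesgue_integral lebesgue T2 ?f"
      unfolding set_lebesgue_integral_def
      by (rule integral_cong_AE[OF m measurable_completion_cong_AE[OF m ae1] ae1, symmetric])
    also have "\<dots> = (\<integral>st. g (st, rot st z) \<partial>tor)"
    proof -
      have i: "integrable tor (\<lambda>st. g (st, rot st z))" using elim by simp
      have "AE st in tor. g (st, rot st z) * indicator T2 st = g (st, rot st z)"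
        using AE_tor_T2 by eventually_elim simp
      then show ?thesis
        unfolding I using i by (intro integral_cong_AE borel_measurable_integrable integrable_indicator_tor) auto
    qed
    finally show ?case by (simp add: Omega_def)
  qed
  with that g_int rep show ?thesis by blast
qed

section \<open>Dyadic Muckenhoupt classes in terms of the logarithm\<close>

lemma log_weight_powr:
  fixes \<omega> h :: "real \<times> real \<Rightarrow> real"
  assumes "AE z in tor. \<omega> z = exp (h z)"
  shows "AE z in tor. \<omega> z powr r = exp (r * h z)"
  using assms by eventually_elim (simp add: powr_def)

lemma drects_borel_subset_pos:
  assumes "R \<in> drects"
  shows "R \<in> sets borel" "R \<subseteq> T2" "0 < measure tor R"
proof -
  obtain n m j k where R: "R = drect n m j k" "j < 2 ^ n" "k < 2 ^ m"
    using assms by (auto simp: drects_iff)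
  show "R \<in> sets borel" "0 < measure tor R" using R by (simp_all add: measure_drect)
  show "R \<subseteq> T2" unfolding R(1) by (rule drect_subset_T2[OF R(2,3)])
qed

lemma AE_on_subset_T2:
  assumes "R \<subseteq> T2"
  shows "(AE z in lebesgue. z \<in> R \<longrightarrow> P z) \<longleftrightarrow> (AE z in tor. z \<in> R \<longrightarrow> P z)"
  unfolding AE_tor_iff using assms by (intro iffI; elim eventually_mono) auto

context
  fixes \<omega> h :: "real \<times> real \<Rightarrow> real"
  assumes rep: "AE z in tor. \<omega> z = exp (h z)" and h: "integrable tor h"
begin

lemma h_measurable [measurable]: "h \<in> borel_measurable borel"
  using borel_measurable_integrable[OF h] by measurable

lemma avg_weight:
  assumes "R \<in> sets borel" "R \<subseteq> T2"
  shows "avg R \<omega> = eavg h 1 R" "avg R (\<lambda>z. \<omega> z powr r) = eavg h r R"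
  using assms rep log_weight_powr[OF rep, of r] by (intro avg_eq_eavg h_measurable; simp)+

lemma Ap_rect_infty:
  assumes "R \<in> sets borel" "R \<subseteq> T2"
  shows "Ap_rect \<infinity> \<omega> R = eavg h 1 R * ennreal (exp (- mean h R))"
proof -
  have ae: "AE z in tor. ln (1 / \<omega> z) = - h z"
    using rep by eventually_elim (simp add: ln_div)
  have "integrable tor (\<lambda>z. - h z)" using h by simp
  note set_integral_lebesgue_tor[OF ae this assms]
  moreover have "measure lebesgue R = measure tor R"
    using emeasure_lebesgue_tor[OF assms] by (simp add: measure_def)
  ultimately show ?thesis
    by (simp add: Ap_rect_def avg_weight(1)[OF assms] mean_def)
qed

lemma Ap_rect_real:
  assumes "R \<in> sets borel" "R \<subseteq> T2" "1 < p"
  shows "Ap_rect (ereal p) \<omega> R = eavg h 1 R * epow (eavg h (- 1 / (p - 1)) R) (p - 1)"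
  using assms avg_weight[of R] by (simp add: Ap_rect_def one_ereal_def)

lemma RH_rect_real:
  assumes "R \<in> sets borel" "R \<subseteq> T2"
  shows "RH_rect (ereal p) \<omega> R = epow (eavg h p R) (1 / p) / eavg h 1 R"
  using assms avg_weight[of R] by (simp add: RH_rect_def)

lemma AE_ge_ess_inf:
  assumes sub: "R \<subseteq> T2" and t: "0 < t" "ennreal t < ess_inf_on R \<omega>"
  shows "AE z in tor. z \<in> R \<longrightarrow> ln t \<le> h z"
proof -
  obtain c where c: "AE z in lebesgue. z \<in> R \<longrightarrow> c \<le> ennreal (\<omega> z)" "ennreal t < c"
    using t unfolding ess_inf_on_def less_Sup_iff by auto
  from c(1) have "AE z in tor. z \<in> R \<longrightarrow> c \<le> ennreal (\<omega> z)" by (simp add: AE_on_subset_T2[OF sub])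
  with rep show ?thesis
  proof eventually_elim
    case (elim z)
    show ?case
    proof
      assume "z \<in> R"
      with elim c(2) have "ennreal t < ennreal (exp (h z))" by auto
      then have "t \<le> exp (h z)" using t by (simp add: ennreal_less_iff)
      then show "ln t \<le> h z" using t by (simp add: ln_ge_iff ln_le_cancel_iff[symmetric, of t "exp (h z)"] del: ln_le_cancel_iff)
    qed
  qed
qed

lemma AE_le_ess_sup:
  assumes sub: "R \<subseteq> T2" and t: "0 < t" "ess_sup_on R \<omega> < ennreal t"
  shows "AE z in tor. z \<in> R \<longrightarrow> h z \<le> ln t"
proof -
  obtain c where c: "AE z in lebesgue. z \<in> R \<longrightarrow> ennreal (\<omega> z) \<le> c" "c < ennreal t"
    using t unfolding ess_sup_on_def Inf_less_iff by auto
  from c(1) have "AE z in tor. z \<in> R \<longrightarrow> ennreal (\<omega> z) \<le> c" by (simp add: AE_on_subset_T2[OF sub])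
  with rep show ?thesis
  proof eventually_elim
    case (elim z)
    show ?case
    proof
      assume "z \<in> R"
      with elim c(2) have "ennreal (exp (h z)) < ennreal t" by auto
      then have "exp (h z) \<le> t" by (simp add: ennreal_less_iff)
      then show "h z \<le> ln t" using t by (simp add: ln_ge_iff)
    qed
  qed
qed

lemma ess_inf_ge:
  assumes sub: "R \<subseteq> T2" and "AE z in tor. z \<in> R \<longrightarrow> t \<le> h z"
  shows "ennreal (exp t) \<le> ess_inf_on R \<omega>"
  unfolding ess_inf_on_def
proof (rule Sup_upper, unfold mem_Collect_eq AE_on_subset_T2[OF sub])
  show "AE z in tor. z \<in> R \<longrightarrow> ennreal (exp t) \<le> ennreal (\<omega> z)"
    using rep assms(2) by eventually_elim (auto intro!: ennreal_leI)
qed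

lemma ess_sup_le:
  assumes sub: "R \<subseteq> T2" and "AE z in tor. z \<in> R \<longrightarrow> h z \<le> t"
  shows "ess_sup_on R \<omega> \<le> ennreal (exp t)"
  unfolding ess_sup_on_def
proof (rule Inf_lower, unfold mem_Collect_eq AE_on_subset_T2[OF sub])
  show "AE z in tor. z \<in> R \<longrightarrow> ennreal (\<omega> z) \<le> ennreal (exp t)"
    using rep assms(2) by eventually_elim (auto intro!: ennreal_leI)
qed

lemma weight_imp_integrable_exp:
  assumes "weight \<omega>"
  shows "integrable tor (\<lambda>z. exp (h z))"
proof (rule integrableI_bounded)
  have T2: "T2 \<in> sets borel" "T2 \<subseteq> T2" by auto
  have "(\<integral>\<^sup>+z. ennreal (norm (exp (h z))) \<partial>tor) = (\<integral>\<^sup>+z. ennreal (exp (h z)) * indicator T2 z \<partial>tor)"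
    using AE_tor_T2 by (intro nn_integral_cong_AE, eventually_elim) simp
  also have "\<dots> = (\<integral>\<^sup>+z. ennreal (\<omega> z) * indicator T2 z \<partial>lebesgue)"
    by (rule nn_integral_weight_eq[OF rep _ T2, symmetric]) measurable
  also have "\<dots> \<le> (\<integral>\<^sup>+z. ennreal (norm (indicator T2 z *\<^sub>R \<omega> z)) \<partial>lebesgue)"
    by (intro nn_integral_mono) (auto simp: indicator_def intro!: ennreal_leI)
  also have "\<dots> < \<infinity>"
    using assms unfolding weight_def set_integrable_def integrable_iff_bounded by simp
  finally show "(\<integral>\<^sup>+z. ennreal (norm (exp (h z))) \<partial>tor) < \<infinity>" .
qed measurable

lemma integrable_exp_imp_weight:
  assumes i: "integrable tor (\<lambda>z. exp (h z))"
  shows "weight \<omega>"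
proof -
  have "set_integrable lebesgue T2 \<omega>"
    by (rule set_integral_lebesgue_tor(1)[OF rep i]) auto
  moreover have "set_borel_measurable lebesgue T2 \<omega>"
    using calculation unfolding set_integrable_def set_borel_measurable_def by auto
  moreover have "AE z in lebesgue. z \<in> T2 \<longrightarrow> 0 < \<omega> z"
    using rep unfolding AE_tor_iff by eventually_elim auto
  ultimately show ?thesis unfolding weight_def by simp
qed

lemma eavg_real:
  assumes R: "R \<in> sets borel" and pos: "0 < measure tor R" and i: "integrable tor (\<lambda>z. exp (r * h z))"
  shows "eavg h r R = ennreal (mean (\<lambda>z. exp (r * h z)) R)"
proof -
  have "(\<integral>\<^sup>+z. ennreal (exp (r * h z)) * indicator R z \<partial>tor) = (\<integral>\<^sup>+z. ennreal (exp (r * h z) * indicator R z) \<partial>tor)"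
    by (intro nn_integral_cong) (simp add: indicator_def)
  also have "\<dots> = ennreal (\<integral>z. exp (r * h z) * indicator R z \<partial>tor)"
    using R i by (intro nn_integral_eq_integral integrable_indicator_tor) auto
  finally show ?thesis
    unfolding eavg_def mean_def using pos by (simp add: tor.emeasure_eq_measure divide_ennreal)
qed

lemma dyadic_boundI:
  assumes "0 \<le> U" "\<And>R. R \<in> drects \<Longrightarrow> eavg h r R \<le> ennreal (U * exp (r * mean h R))"
  shows "dyadic_bound (\<lambda>u. ennreal (exp (r * u))) (ennreal U) h"
  unfolding dyadic_bound_def using assms drects_borel_subset_pos by (auto intro!: nn_integral_exp_shift_leI)

lemma Apd_infty_bounds:
  assumes V: "0 \<le> V" and A: "Apd_const \<infinity> \<omega> \<le> ennreal V"
  shows "dyadic_bound (\<lambda>u. ennreal (exp (1 * u))) (ennreal V) h"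
proof (rule dyadic_boundI[OF V])
  fix R assume R: "R \<in> drects"
  note f = drects_borel_subset_pos[OF R]
  have "Ap_rect \<infinity> \<omega> R \<le> ennreal V"
    using A R unfolding Apd_const_def by (meson SUP_upper order_trans)
  then have "eavg h 1 R * ennreal (exp (- mean h R)) \<le> ennreal V"
    by (simp add: Ap_rect_infty[OF f(1,2)])
  from mult_right_mono[OF this, of "ennreal (exp (mean h R))"]
  show "eavg h 1 R \<le> ennreal (V * exp (1 * mean h R))"
    using V by (simp add: mult.assoc ennreal_mult[symmetric] exp_add[symmetric])
qed

text \<open>By Jensen the two factors of the product are at least \<open>exp (mean h R)\<close> and
  \<open>exp (- mean h R)\<close>. Inserting the lower bound for one factor gives an upper bound for
  the other.\<close>

lemma Apd_real_bounds:
  assumes V: "0 \<le> V" and p: "1 < p" and A: "Apd_const (ereal p) \<omega> \<le> ennreal V"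
  shows "dyadic_bound (\<lambda>u. ennreal (exp (1 * u))) (ennreal V) h"
    and "dyadic_bound (\<lambda>u. ennreal (exp ((- 1 / (p - 1)) * u))) (ennreal (V powr (1 / (p - 1)))) h"
proof -
  let ?r = "- 1 / (p - 1)"
  have *: "eavg h 1 R * epow (eavg h ?r R) (p - 1) \<le> ennreal V" if R: "R \<in> drects" for R
  proof -
    have "Ap_rect (ereal p) \<omega> R \<le> ennreal V"
      using A R unfolding Apd_const_def by (meson SUP_upper order_trans)
    then show ?thesis using drects_borel_subset_pos[OF R] p by (simp add: Ap_rect_real)
  qed
  show "dyadic_bound (\<lambda>u. ennreal (exp (1 * u))) (ennreal V) h"
  proof (rule dyadic_boundI[OF V])
    fix R assume R: "R \<in> drects"
    note f = drects_borel_subset_pos[OF R]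
    have "epow (ennreal (exp (?r * mean h R))) (p - 1) \<le> epow (eavg h ?r R) (p - 1)"
      using p by (intro epow_mono exp_mean_le_eavg h f) auto
    moreover have "epow (ennreal (exp (?r * mean h R))) (p - 1) = ennreal (exp (- mean h R))"
      using p by (simp add: epow_ennreal powr_def)
    ultimately have "eavg h 1 R * ennreal (exp (- mean h R)) \<le> eavg h 1 R * epow (eavg h ?r R) (p - 1)"
      by (intro mult_left_mono) auto
    also have "\<dots> \<le> ennreal V" by (rule *[OF R])
    finally have "eavg h 1 R * ennreal (exp (- mean h R)) \<le> ennreal V" .
    from mult_right_mono[OF this, of "ennreal (exp (mean h R))"]
    show "eavg h 1 R \<le> ennreal (V * exp (1 * mean h R))"
      using V by (simp add: mult.assoc ennreal_mult[symmetric] exp_add[symmetric])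
  qed
  show "dyadic_bound (\<lambda>u. ennreal (exp (?r * u))) (ennreal (V powr (1 / (p - 1)))) h"
  proof (rule dyadic_boundI)
    fix R assume R: "R \<in> drects"
    note f = drects_borel_subset_pos[OF R]
    have "ennreal (exp (1 * mean h R)) * epow (eavg h ?r R) (p - 1) \<le> eavg h 1 R * epow (eavg h ?r R) (p - 1)"
      by (intro mult_right_mono exp_mean_le_eavg h f) auto
    also have "\<dots> \<le> ennreal V" by (rule *[OF R])
    finally have "ennreal (exp (- mean h R)) * (ennreal (exp (1 * mean h R)) * epow (eavg h ?r R) (p - 1)) \<le> ennreal (exp (- mean h R)) * ennreal V"
      by (intro mult_left_mono) auto
    then have "epow (eavg h ?r R) (p - 1) \<le> ennreal (exp (- mean h R) * V)"
      unfolding mult.assoc[symmetric] using V by (simp add: ennreal_mult[symmetric] exp_add[symmetric])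
    then have "eavg h ?r R \<le> ennreal ((exp (- mean h R) * V) powr (1 / (p - 1)))"
      using p V by (intro epow_leD) auto
    also have "(exp (- mean h R) * V) powr (1 / (p - 1)) = V powr (1 / (p - 1)) * exp (?r * mean h R)"
      using V by (simp add: powr_mult powr_def[of "exp _"])
    finally show "eavg h ?r R \<le> ennreal (V powr (1 / (p - 1)) * exp (?r * mean h R))" .
  qed simp
qed

text \<open>The essential lower bound for \<open>h\<close> is used twice. Integrated over
  \<open>R\<close>, it bounds the average of the weight by a multiple of
  \<open>exp (mean h R)\<close>; pointwise, together with Jensen's
  \<open>mean h R \<le> ln t\<close>, it bounds \<open>mean h R - h z\<close>.\<close>

lemma Apd_one_bounds:
  assumes V: "1 \<le> V" and A: "Apd_const 1 \<omega> \<le> ennreal V" and wt: "weight \<omega>"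
  shows "dyadic_bound (\<lambda>u. ennreal (exp (1 * u))) (ennreal (2 * V)) h"
    and "\<forall>R\<in>drects. AE z in tor. z \<in> R \<longrightarrow> (- 1) * (h z - mean h R) \<le> ln (2 * V)"
proof -
  have i: "integrable tor (\<lambda>z. exp (1 * h z))" using weight_imp_integrable_exp[OF wt] by simp
  have key: "eavg h 1 R \<le> ennreal (2 * V * exp (1 * mean h R)) \<and>
      (AE z in tor. z \<in> R \<longrightarrow> (- 1) * (h z - mean h R) \<le> ln (2 * V))" if R: "R \<in> drects" for R
  proof -
    note f = drects_borel_subset_pos[OF R]
    define t where "t = mean (\<lambda>z. exp (1 * h z)) R"
    have E: "eavg h 1 R = ennreal t" unfolding t_def by (rule eavg_real[OF f(1,3) i])
    have "ennreal (exp (1 * mean h R)) \<le> ennreal t"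
      unfolding E[symmetric] by (intro exp_mean_le_eavg h f)
    then have t: "exp (mean h R) \<le> t"
      by (cases "0 \<le> t") (auto simp: ennreal_neg)
    then have t0: "0 < t" using exp_gt_zero[of "mean h R"] by linarith
    have "Ap_rect 1 \<omega> R \<le> ennreal V"
      using A R unfolding Apd_const_def by (meson SUP_upper order_trans)
    then have div: "ennreal t / ess_inf_on R \<omega> \<le> ennreal V"
      by (simp add: Ap_rect_def avg_weight(1)[OF f(1,2)] E)
    \<comment> \<open>The factor 2 makes the inequality strict, so that a lower bound can be
      selected from the supremum defining \<open>ess_inf_on\<close>.\<close>
    have "ennreal (t / (2 * V)) < ess_inf_on R \<omega>"
    proof (rule ccontr)
      assume "\<not> ennreal (t / (2 * V)) < ess_inf_on R \<omega>"
      then have "ess_inf_on R \<omega> \<le> ennreal (t / (2 * V))" by simp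
      moreover have "0 \<le> t / (2 * V)" using t0 V by simp
      ultimately obtain e where e: "ess_inf_on R \<omega> = ennreal e" "0 \<le> e" "e \<le> t / (2 * V)"
        using le_ennreal_iff by blast
      have "e \<noteq> 0"
      proof
        assume "e = 0"
        then have "ennreal t / ess_inf_on R \<omega> = top" using e t0 by simp
        with div show False by (simp add: top_unique)
      qed
      then have "t / e \<le> V" using div e t0 V by (simp add: divide_ennreal)
      moreover have "2 * V \<le> t / e" using e \<open>e \<noteq> 0\<close> V t0 by (simp add: field_simps)
      ultimately show False using V by linarith
    qed
    from AE_ge_ess_inf[OF f(2) _ this]
    have low: "AE z in tor. z \<in> R \<longrightarrow> ln (t / (2 * V)) \<le> h z" using t0 V by simp
    have "(\<integral>z. ln (t / (2 * V)) * indicator R z \<partial>tor) \<le> (\<integral>z. h z * indicator R z \<partial>tor)"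
      by (intro integral_mono_AE integrable_indicator_tor h f) (use low in \<open>auto simp: indicator_def\<close>)
    then have "ln (t / (2 * V)) \<le> mean h R"
      using f by (simp add: mean_def field_simps)
    then have "exp (ln (t / (2 * V))) \<le> exp (mean h R)" by simp
    then have "t \<le> 2 * V * exp (mean h R)" using t0 V by (simp add: field_simps)
    then have "eavg h 1 R \<le> ennreal (2 * V * exp (1 * mean h R))" unfolding E by (simp add: ennreal_leI)
    moreover have "AE z in tor. z \<in> R \<longrightarrow> (- 1) * (h z - mean h R) \<le> ln (2 * V)"
      using low
    proof eventually_elim
      case (elim z)
      have "mean h R \<le> ln t" using t t0 by (simp add: ln_ge_iff)
      then show ?case using elim t0 V by (auto simp: ln_div)
    qed
    ultimately show ?thesis by blast
  qed
  show "dyadic_bound (\<lambda>u. ennreal (exp (1 * u))) (ennreal (2 * V)) h"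
    using V key by (intro dyadic_boundI) auto
  show "\<forall>R\<in>drects. AE z in tor. z \<in> R \<longrightarrow> (- 1) * (h z - mean h R) \<le> ln (2 * V)"
    using key by blast
qed

end

section \<open>Dyadic reverse Hoelder classes in terms of the logarithm\<close>

lemma ennreal_divide_leD:
  assumes "a / ennreal x \<le> ennreal V" "0 < x" "0 \<le> V"
  shows "a \<le> ennreal (V * x)"
proof (cases a)
  case (real b)
  then show ?thesis using assms by (simp add: divide_ennreal field_simps ennreal_leI)
next
  case top
  then show ?thesis using assms by (simp add: ennreal_top_divide top_unique)
qed

lemma ennreal_divide_le:
  assumes "a \<le> ennreal A" "ennreal B \<le> b" "0 < B" "0 \<le> A"
  shows "a / b \<le> ennreal (A / B)"
proof (rule divide_le_posI_ennreal)
  show "0 < b" using assms by (metis ennreal_less_zero_iff less_le_trans)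
  have "a \<le> ennreal B * ennreal (A / B)" using assms by (simp add: ennreal_mult[symmetric])
  also have "\<dots> \<le> b * ennreal (A / B)" using assms by (intro mult_right_mono) auto
  finally show "a \<le> b * ennreal (A / B)" .
qed

lemma T2_drect: "T2 = drect 0 0 0 0"
  by (auto simp: T2_def torus_def drect_def dint_def)

lemma T2_mem_drects: "T2 \<in> drects"
  unfolding T2_drect by (rule drectsI) auto

lemma integrable_exp_if_eavg_finite:
  fixes h :: "real \<times> real \<Rightarrow> real"
  assumes [measurable]: "h \<in> borel_measurable borel" and fin: "eavg h r T2 < top"
  shows "integrable tor (\<lambda>z. exp (r * h z))"
proof (rule integrableI_bounded)
  have "(\<integral>\<^sup>+z. ennreal (norm (exp (r * h z))) \<partial>tor) = (\<integral>\<^sup>+z. ennreal (exp (r * h z)) * indicator T2 z \<partial>tor)"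
    using AE_tor_T2 by (intro nn_integral_cong_AE, eventually_elim) simp
  also have "\<dots> = eavg h r T2" by (simp add: eavg_def measure_tor_T2 mult_divide_eq_ennreal[of 1, simplified])
  finally show "(\<integral>\<^sup>+z. ennreal (norm (exp (r * h z))) \<partial>tor) < \<infinity>" using fin by simp
qed measurable

context
  fixes \<omega> h :: "real \<times> real \<Rightarrow> real" and V :: real
  assumes rep: "AE z in tor. \<omega> z = exp (h z)" and h: "integrable tor h" and wt: "weight \<omega>" and V: "1 \<le> V"
begin

lemma integrable_exp_h: "integrable tor (\<lambda>z. exp (h z))"
  by (rule weight_imp_integrable_exp[OF rep h wt])

lemma exp_mean_le_mean_exp:
  assumes "R \<in> drects"
  shows "exp (mean h R) \<le> mean (\<lambda>z. exp (h z)) R" "eavg h 1 R = ennreal (mean (\<lambda>z. exp (h z)) R)"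
proof -
  note f = drects_borel_subset_pos[OF assms]
  show E: "eavg h 1 R = ennreal (mean (\<lambda>z. exp (h z)) R)"
    using eavg_real[OF rep h f(1,3), of 1] integrable_exp_h by simp
  have "ennreal (exp (1 * mean h R)) \<le> ennreal (mean (\<lambda>z. exp (h z)) R)"
    unfolding E[symmetric] by (intro exp_mean_le_eavg h f)
  then show "exp (mean h R) \<le> mean (\<lambda>z. exp (h z)) R"
    by (cases "0 \<le> mean (\<lambda>z. exp (h z)) R") (auto simp: ennreal_neg)
qed

lemma mean_exp_pos: "R \<in> drects \<Longrightarrow> 0 < mean (\<lambda>z. exp (h z)) R"
  using exp_mean_le_mean_exp(1)[of R] exp_gt_zero[of "mean h R"] by linarith

lemma doubling_mean:
  assumes D: "doubling_const \<omega> \<le> ennreal V" and jk: "j < 2 ^ Suc n" "k < 2 ^ Suc m"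
  shows "mean (\<lambda>z. exp (h z)) (drect n m (j div 2) (k div 2)) \<le> V * mean (\<lambda>z. exp (h z)) (drect (Suc n) (Suc m) j k)"
proof -
  let ?c = "drect (Suc n) (Suc m) j k" and ?p = "drect n m (j div 2) (k div 2)"
  have jk': "j div 2 < 2 ^ n" "k div 2 < 2 ^ m" using jk by auto
  have c: "?c \<in> drects" and p: "?p \<in> drects" using jk jk' by (auto intro!: drectsI)
  have int: "(\<integral>\<^sup>+z. ennreal (\<omega> z) * indicator R z \<partial>lebesgue) = ennreal (mean (\<lambda>z. exp (h z)) R * measure tor R)"
    if R: "R \<in> drects" for R
  proof -
    note f = drects_borel_subset_pos[OF R]
    have [measurable]: "h \<in> borel_measurable borel" using borel_measurable_integrable[OF h] by measurable
    have "(\<integral>\<^sup>+z. ennreal (\<omega> z) * indicator R z \<partial>lebesgue) = (\<integral>\<^sup>+z. ennreal (exp (h z)) * indicator R z \<partial>tor)"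
      by (rule nn_integral_weight_eq[OF rep _ f(1,2)]) measurable
    also have "\<dots> = (\<integral>\<^sup>+z. ennreal (exp (h z) * indicator R z) \<partial>tor)"
      by (intro nn_integral_cong) (simp add: indicator_def)
    also have "\<dots> = ennreal (\<integral>z. exp (h z) * indicator R z \<partial>tor)"
      using f by (intro nn_integral_eq_integral integrable_indicator_tor integrable_exp_h) auto
    finally show ?thesis using f by (simp add: mean_def)
  qed
  have "(\<integral>\<^sup>+z. ennreal (\<omega> z) * indicator ?p z \<partial>lebesgue) / (\<integral>\<^sup>+z. ennreal (\<omega> z) * indicator ?c z \<partial>lebesgue) \<le> doubling_const \<omega>"
    unfolding doubling_const_def using jk
    by (intro SUP_upper2[of "(j, Suc n, k, Suc m)"]) (auto simp: drect_def dparent_def)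
  also have "\<dots> \<le> ennreal V" by (rule D)
  finally have "ennreal (mean (\<lambda>z. exp (h z)) ?p * measure tor ?p) \<le> ennreal (V * (mean (\<lambda>z. exp (h z)) ?c * measure tor ?c))"
    unfolding int[OF p] int[OF c] using V mean_exp_pos[OF c] drects_borel_subset_pos(3)[OF c]
    by (intro ennreal_divide_leD) auto
  then have le: "mean (\<lambda>z. exp (h z)) ?p * measure tor ?p \<le> V * (mean (\<lambda>z. exp (h z)) ?c * measure tor ?c)"
    using V mean_exp_pos[OF c] drects_borel_subset_pos(3)[OF c] by (subst (asm) ennreal_le_iff) auto
  have mp: "measure tor ?p = 4 * measure tor ?c" using jk jk' by (simp add: measure_drect)
  have "measure tor ?c * (4 * mean (\<lambda>z. exp (h z)) ?p) \<le> measure tor ?c * (V * mean (\<lambda>z. exp (h z)) ?c)"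
    using le unfolding mp by (simp add: mult_ac)
  then have "4 * mean (\<lambda>z. exp (h z)) ?p \<le> V * mean (\<lambda>z. exp (h z)) ?c"
    using drects_borel_subset_pos(3)[OF c] by (simp add: mult_le_cancel_left)
  then show ?thesis using mean_exp_pos[OF p] by linarith
qed

lemma mean_exp_le:
  assumes "0 \<le> W" "dyadic_bound (\<lambda>u. ennreal (exp (1 * u))) (ennreal W) h" "R \<in> drects"
  shows "mean (\<lambda>z. exp (h z)) R \<le> W * exp (mean h R)"
proof -
  note f = drects_borel_subset_pos[OF assms(3)]
  have "eavg h 1 R \<le> ennreal (W * exp (1 * mean h R))"
    using assms borel_measurable_integrable[OF h] f
    by (intro eavg_leI) (auto simp: dyadic_bound_def measurable_cong_sets[OF sets_tor refl])
  then show ?thesis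
    using assms by (simp add: exp_mean_le_mean_exp(2))
qed

text \<open>Raising the reverse Hoelder inequality to the power \<open>p\<close> gives the Bellman
  argument its constant \<open>V powr p\<close>. The resulting \<open>W\<close> bounds the average
  of the weight by \<open>W * exp (mean h R)\<close>; reinserting this in the reverse Hoelder
  inequality gives the bound with exponent \<open>p\<close>.\<close>

lemma RHd_real_bounds:
  assumes p: "1 < p" and A: "RHd_const (ereal p) \<omega> \<le> ennreal V"
    and W_def: "W = exp (1 / reverse_holder.c p (V powr p) V)"
  shows "dyadic_bound (\<lambda>u. ennreal (exp (1 * u))) (ennreal W) h"
    and "dyadic_bound (\<lambda>u. ennreal (exp (p * u))) (ennreal ((V * W) powr p)) h"
proof -
  let ?x = "\<lambda>R. mean (\<lambda>z. exp (h z)) R"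
  have hm: "h \<in> borel_measurable borel"
    using borel_measurable_integrable[OF h] by (simp add: measurable_cong_sets[OF sets_tor refl])
  have D: "doubling_const \<omega> \<le> ennreal V" using A by (simp add: RHd_const_def)
  have up: "eavg h p R \<le> ennreal ((V * ?x R) powr p)" if R: "R \<in> drects" for R
  proof -
    note f = drects_borel_subset_pos[OF R]
    have "RH_rect (ereal p) \<omega> R \<le> ennreal V"
      using A R unfolding RHd_const_def by (meson SUP_upper order_trans max.cobounded1)
    then have "epow (eavg h p R) (1 / p) / ennreal (?x R) \<le> ennreal V"
      by (simp add: RH_rect_real[OF rep h f(1,2)] exp_mean_le_mean_exp(2)[OF R])
    then have "epow (eavg h p R) (1 / p) \<le> ennreal (V * ?x R)"
      using mean_exp_pos[OF R] V by (intro ennreal_divide_leD) auto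
    then have "eavg h p R \<le> ennreal ((V * ?x R) powr (1 / (1 / p)))"
      using mean_exp_pos[OF R] V p by (intro epow_leD) auto
    then show ?thesis by simp
  qed
  have ip: "integrable tor (\<lambda>z. exp (p * h z))"
    using up[OF T2_mem_drects] by (intro integrable_exp_if_eavg_finite hm) (auto simp: le_less_trans)
  interpret rh: reverse_holder h p "V powr p" V
  proof
    show "1 \<le> V powr p" using V p by (simp add: ge_one_powr_ge_zero)
    fix R assume R: "R \<in> drects"
    note f = drects_borel_subset_pos[OF R]
    have "ennreal (mean (\<lambda>z. exp (p * h z)) R) \<le> ennreal ((V * ?x R) powr p)"
      using up[OF R] eavg_real[OF rep h f(1,3) ip] by simp
    then show "mean (\<lambda>z. exp (p * h z)) R \<le> V powr p * ?x R powr p"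
      using V mean_exp_pos[OF R] by (simp add: powr_mult)
  qed (use h integrable_exp_h ip p V doubling_mean[OF D] in auto)
  show d1: "dyadic_bound (\<lambda>u. ennreal (exp (1 * u))) (ennreal W) h"
    using rh.dyadic_bound_exp by (simp add: W_def)
  have W0: "0 \<le> W" by (simp add: W_def)
  show "dyadic_bound (\<lambda>u. ennreal (exp (p * u))) (ennreal ((V * W) powr p)) h"
  proof (rule dyadic_boundI[OF rep h])
    fix R assume R: "R \<in> drects"
    have "(V * ?x R) powr p \<le> (V * (W * exp (mean h R))) powr p"
      using V p mean_exp_pos[OF R] mean_exp_le[OF W0 d1 R] by (intro powr_mono2 mult_left_mono) auto
    also have "\<dots> = (V * W) powr p * exp (p * mean h R)"
      using V W0 by (simp add: mult.assoc[symmetric] powr_mult powr_def[of "exp _"])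
    finally show "eavg h p R \<le> ennreal ((V * W) powr p * exp (p * mean h R))"
      using up[OF R] by (meson ennreal_leI order_trans)
  qed simp
qed

text \<open>An essential bound implies a reverse Hoelder inequality with exponent 2, since the
  square of the weight is at most its supremum times the weight. The 2 in \<open>2 * V\<close> only
  makes the bound on the essential supremum strict.\<close>

lemma RHd_infty_bounds:
  assumes A: "RHd_const \<infinity> \<omega> \<le> ennreal V"
    and W_def: "W = exp (1 / reverse_holder.c 2 (2 * V) V)"
  shows "dyadic_bound (\<lambda>u. ennreal (exp (1 * u))) (ennreal W) h"
    and "\<forall>R\<in>drects. AE z in tor. z \<in> R \<longrightarrow> 1 * (h z - mean h R) \<le> ln (2 * V * W)"
proof -
  let ?x = "\<lambda>R. mean (\<lambda>z. exp (h z)) R"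
  have hm[measurable]: "h \<in> borel_measurable borel"
    using borel_measurable_integrable[OF h] by (simp add: measurable_cong_sets[OF sets_tor refl])
  have D: "doubling_const \<omega> \<le> ennreal V" using A by (simp add: RHd_const_def)
  have up: "AE z in tor. z \<in> R \<longrightarrow> h z \<le> ln (2 * V * ?x R)" if R: "R \<in> drects" for R
  proof (rule AE_le_ess_sup[OF rep h])
    note f = drects_borel_subset_pos[OF R]
    show "R \<subseteq> T2" by (rule f)
    have "RH_rect \<infinity> \<omega> R \<le> ennreal V"
      using A R unfolding RHd_const_def by (meson SUP_upper order_trans max.cobounded1)
    then have "ess_sup_on R \<omega> / ennreal (?x R) \<le> ennreal V"
      by (simp add: RH_rect_def avg_weight(1)[OF rep h f(1,2)] exp_mean_le_mean_exp(2)[OF R])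
    then have "ess_sup_on R \<omega> \<le> ennreal (V * ?x R)"
      using mean_exp_pos[OF R] V by (intro ennreal_divide_leD) auto
    also have "\<dots> < ennreal (2 * V * ?x R)"
      using mean_exp_pos[OF R] V by (intro ennreal_lessI) auto
    finally show "ess_sup_on R \<omega> < ennreal (2 * V * ?x R)" .
    show "0 < 2 * V * ?x R" using mean_exp_pos[OF R] V by simp
  qed
  have sq: "AE z in tor. z \<in> R \<longrightarrow> exp (2 * h z) \<le> 2 * V * ?x R * exp (h z)" if R: "R \<in> drects" for R
    using up[OF R]
  proof eventually_elim
    case (elim z)
    show ?case
    proof
      assume "z \<in> R"
      with elim have "exp (h z) \<le> exp (ln (2 * V * ?x R))" by simp
      also have "\<dots> = 2 * V * ?x R" using mean_exp_pos[OF R] V by simp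
      finally have "exp (h z) * exp (h z) \<le> 2 * V * ?x R * exp (h z)" by (intro mult_right_mono) auto
      then show "exp (2 * h z) \<le> 2 * V * ?x R * exp (h z)" by (simp add: exp_add[symmetric])
    qed
  qed
  have i2: "integrable tor (\<lambda>z. exp (2 * h z))"
  proof (rule Bochner_Integration.integrable_bound)
    show "integrable tor (\<lambda>z. 2 * V * ?x T2 * exp (h z))" using integrable_exp_h by simp
    show "AE z in tor. norm (exp (2 * h z)) \<le> norm (2 * V * ?x T2 * exp (h z))"
      using sq[OF T2_mem_drects] AE_tor_T2
      by eventually_elim (use V mean_exp_pos[OF T2_mem_drects] in \<open>simp add: abs_mult\<close>)
  qed measurable
  interpret rh: reverse_holder h 2 "2 * V" V
  proof
    fix R assume R: "R \<in> drects"
    note f = drects_borel_subset_pos[OF R]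
    have "(\<integral>z. exp (2 * h z) * indicator R z \<partial>tor) \<le> (\<integral>z. 2 * V * ?x R * (exp (h z) * indicator R z) \<partial>tor)"
      by (intro integral_mono_AE integrable_indicator_tor i2 f integrable_mult_right integrable_exp_h)
        (use sq[OF R] in \<open>auto simp: indicator_def\<close>)
    also have "\<dots> = 2 * V * ?x R * (\<integral>z. exp (h z) * indicator R z \<partial>tor)" by simp
    finally have "(\<integral>z. exp (2 * h z) * indicator R z \<partial>tor) / measure tor R
        \<le> 2 * V * ?x R * (\<integral>z. exp (h z) * indicator R z \<partial>tor) / measure tor R"
      using f(3) by (intro divide_right_mono) auto
    then have "mean (\<lambda>z. exp (2 * h z)) R \<le> 2 * V * ?x R * ?x R"
      by (simp only: mean_def times_divide_eq_right)
    then show "mean (\<lambda>z. exp (2 * h z)) R \<le> 2 * V * ?x R powr 2"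
      using mean_exp_pos[OF R] by (simp add: power2_eq_square)
  qed (use h integrable_exp_h i2 V doubling_mean[OF D] in auto)
  show d1: "dyadic_bound (\<lambda>u. ennreal (exp (1 * u))) (ennreal W) h"
    using rh.dyadic_bound_exp by (simp add: W_def)
  have W0: "0 < W" by (simp add: W_def)
  show "\<forall>R\<in>drects. AE z in tor. z \<in> R \<longrightarrow> 1 * (h z - mean h R) \<le> ln (2 * V * W)"
  proof
    fix R assume R: "R \<in> drects"
    have "2 * V * ?x R \<le> 2 * V * (W * exp (mean h R))"
      using V mean_exp_le[OF less_imp_le[OF W0] d1 R] by (intro mult_left_mono) auto
    then have "ln (2 * V * ?x R) \<le> ln (2 * V * W * exp (mean h R))"
      using mean_exp_pos[OF R] V W0 by (subst ln_le_cancel_iff) (auto simp: mult.assoc)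
    also have "\<dots> = ln (2 * V * W) + mean h R" using V W0 by (simp add: ln_mult)
    finally show "AE z in tor. z \<in> R \<longrightarrow> 1 * (h z - mean h R) \<le> ln (2 * V * W)"
      using up[OF R] by (elim eventually_mono) auto
  qed
qed

end

section \<open>Estimates for the averaged weight\<close>

context averaging
begin

text \<open>One \<open>k\<close> has to serve all exponents \<open>r\<close> at once, so that
  \<open>exp (r * k)\<close> cancels between the factors of a class constant; hence the
  quantification over \<open>r\<close> and \<open>U\<close> inside.\<close>

definition centre :: "(real \<times> real) set \<Rightarrow> real \<Rightarrow> bool" where
  "centre Q k \<longleftrightarrow> \<bar>mean lam Q - k\<bar> \<le> 64 * W \<and>
    (\<forall>r U. 0 \<le> U \<longrightarrow> (AE st in tor. dyadic_bound (\<lambda>u. ennreal (exp (r * u))) (ennreal U) (\<lambda>z. g (st, z))) \<longrightarrow>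
       eavg lam r Q \<le> ennreal (16 * U * exp (32 * \<bar>r\<bar> * W) * exp (r * k))) \<and>
    (\<forall>r U. (AE st in tor. \<forall>R\<in>drects. AE z in tor. z \<in> R \<longrightarrow> r * (g (st, z) - mean (\<lambda>z. g (st, z)) R) \<le> U) \<longrightarrow>
       (AE z in tor. z \<in> Q \<longrightarrow> r * (lam z - k) \<le> U + 32 * \<bar>r\<bar> * W))"

lemma centre_mean: "centre Q k \<Longrightarrow> \<bar>mean lam Q - k\<bar> \<le> 64 * W"
  by (simp add: centre_def)

lemma centre_eavg:
  "centre Q k \<Longrightarrow> 0 \<le> U \<Longrightarrow>
    AE st in tor. dyadic_bound (\<lambda>u. ennreal (exp (r * u))) (ennreal U) (\<lambda>z. g (st, z)) \<Longrightarrow>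
    eavg lam r Q \<le> ennreal (16 * U * exp (32 * \<bar>r\<bar> * W) * exp (r * k))"
  unfolding centre_def by blast

lemma centre_AE:
  "centre Q k \<Longrightarrow>
    AE st in tor. \<forall>R\<in>drects. AE z in tor. z \<in> R \<longrightarrow> r * (g (st, z) - mean (\<lambda>z. g (st, z)) R) \<le> U \<Longrightarrow>
    AE z in tor. z \<in> Q \<longrightarrow> r * (lam z - k) \<le> U + 32 * \<bar>r\<bar> * W"
  unfolding centre_def by blast

lemma rect_centre:
  assumes "Q \<in> rects"
  obtains k where "Q \<in> sets borel" "Q \<subseteq> T2" "0 < measure tor Q" "centre Q k"
proof -
  obtain a n m where Q: "Q \<in> sets borel" "Q \<subseteq> T2"
    and near0: "\<forall>z\<in>Q. frac (fst z - fst a) < 1 / 2 ^ n \<and> frac (snd z - snd a) < 1 / 2 ^ m"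
    and size: "1 / 2 ^ n * (1 / 2 ^ m) \<le> 4 * measure tor Q"
    using rects_scale[OF assms] by blast
  note near = near0[rule_format]
  \<comment> \<open>The averaged mean part at the corner \<open>a\<close>, from which every point of
    \<open>Q\<close> is reached by forward steps shorter than the scale.\<close>
  define k where "k = (\<integral>st. cm n m st a \<partial>tor)"
  have "(0::real) < 1 / 2 ^ n * (1 / 2 ^ m)" by simp
  then have pos: "0 < measure tor Q" using size by linarith
  have i: "integrable tor (\<lambda>z. \<bar>lam z - k\<bar> * indicator Q z)"
    using integrable_lam Q by (intro integrable_indicator_tor integrable_abs) auto
  have "ennreal (\<integral>z. \<bar>lam z - k\<bar> * indicator Q z \<partial>tor) \<le> (\<integral>\<^sup>+z. ennreal (\<bar>lam z - k\<bar> * indicator Q z) \<partial>tor)"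
    by (rule ennreal_integral_le_nn_integral[OF i])
  also have "\<dots> = (\<integral>\<^sup>+z. ennreal \<bar>lam z - k\<bar> * indicator Q z \<partial>tor)"
    by (intro nn_integral_cong) (simp add: indicator_def)
  also have "\<dots> \<le> ennreal (64 * W) * emeasure tor Q"
    unfolding k_def by (rule nn_integral_abs_lam[OF Q(1) near size])
  finally have abs: "(\<integral>z. \<bar>lam z - k\<bar> * indicator Q z \<partial>tor) \<le> 64 * W * measure tor Q"
    using W by (simp add: tor.emeasure_eq_measure ennreal_mult[symmetric])
  have "(\<integral>z. (lam z - k) * indicator Q z \<partial>tor) = (\<integral>z. lam z * indicator Q z - k * indicator Q z \<partial>tor)"
    by (simp add: left_diff_distrib)
  also have "\<dots> = (mean lam Q - k) * measure tor Q"
    using integrable_indicator_tor[OF integrable_lam Q(1)] integrable_indicator_tor[of "\<lambda>_. k", OF _ Q(1)] Q(1) pos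
    by (subst Bochner_Integration.integral_diff) (auto simp: mean_def field_simps)
  finally have "\<bar>mean lam Q - k\<bar> * measure tor Q = \<bar>\<integral>z. (lam z - k) * indicator Q z \<partial>tor\<bar>"
    using pos by (simp add: abs_mult)
  also have "\<dots> \<le> (\<integral>z. \<bar>(lam z - k) * indicator Q z\<bar> \<partial>tor)" by (rule integral_abs_bound)
  also have "\<dots> = (\<integral>z. \<bar>lam z - k\<bar> * indicator Q z \<partial>tor)"
    by (intro Bochner_Integration.integral_cong) (auto simp: abs_mult)
  also note abs
  finally have mean: "\<bar>mean lam Q - k\<bar> \<le> 64 * W" using pos by simp
  have "centre Q k"
    unfolding centre_def
  proof (intro conjI mean allI impI)
    fix r U :: real
    assume U: "0 \<le> U" and bd: "AE st in tor. dyadic_bound (\<lambda>u. ennreal (exp (r * u))) (ennreal U) (\<lambda>z. g (st, z))"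
    have "(\<integral>\<^sup>+z. ennreal (exp (r * (lam z - k))) * indicator Q z \<partial>tor)
      \<le> ennreal (exp (32 * \<bar>r\<bar> * W)) * (16 * ennreal U * emeasure tor Q)"
      unfolding k_def by (rule nn_integral_exp_lam[OF Q(1) near size bd])
    also have "\<dots> = ennreal (16 * U * exp (32 * \<bar>r\<bar> * W)) * emeasure tor Q"
      using U by (simp add: ennreal_mult mult_ac)
    finally show "eavg lam r Q \<le> ennreal (16 * U * exp (32 * \<bar>r\<bar> * W) * exp (r * k))"
      using U by (intro eavg_leI lam_measurable Q pos) auto
  next
    fix r U :: real
    assume "AE st in tor. \<forall>R\<in>drects. AE z in tor. z \<in> R \<longrightarrow> r * (g (st, z) - mean (\<lambda>z. g (st, z)) R) \<le> U"
    from AE_lam_le[OF Q(1) near size this]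
    show "AE z in tor. z \<in> Q \<longrightarrow> r * (lam z - k) \<le> U + 32 * \<bar>r\<bar> * W" unfolding k_def .
  qed
  with that Q pos show ?thesis by blast
qed

lemma Ainf_one: "AE st in tor. dyadic_bound (\<lambda>u. ennreal (exp (1 * u))) (ennreal W) (\<lambda>z. g (st, z))"
  using Ainf by simp

context
  fixes \<omega> :: "real \<times> real \<Rightarrow> real"
  assumes rep: "AE z in tor. \<omega> z = exp (lam z)"
begin

text \<open>The torus is itself a rectangle, and its estimate with exponent 1 gives the
  integrability of the averaged weight.\<close>

lemma weight_average: "weight \<omega>"
proof -
  obtain k where "centre T2 k" using rect_centre[OF T2_mem_rects] .
  from centre_eavg[OF this W Ainf_one] have "integrable tor (\<lambda>z. exp (1 * lam z))"
    by (intro integrable_exp_if_eavg_finite lam_measurable) (auto simp: le_less_trans)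
  then show ?thesis by (intro integrable_exp_imp_weight[OF rep integrable_lam]) simp
qed

lemma exp_le_eavg_average:
  assumes "Q \<in> sets borel" "0 < measure tor Q" "\<bar>mean lam Q - k\<bar> \<le> 64 * W"
  shows "ennreal (exp (k - 64 * W)) \<le> eavg lam 1 Q"
proof -
  have "ennreal (exp (k - 64 * W)) \<le> ennreal (exp (1 * mean lam Q))"
    using assms by (intro ennreal_leI) auto
  also have "\<dots> \<le> eavg lam 1 Q" by (intro exp_mean_le_eavg integrable_lam assms)
  finally show ?thesis .
qed

lemma Ap_rect_infty_average:
  assumes "Q \<in> rects"
  shows "Ap_rect \<infinity> \<omega> Q \<le> ennreal (16 * W * exp (32 * W) * exp (64 * W))"
proof -
  obtain k where Q: "Q \<in> sets borel" "Q \<subseteq> T2" "0 < measure tor Q" and k: "centre Q k"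
    using rect_centre[OF assms] .
  note mean = centre_mean[OF k] and E = centre_eavg[OF k W Ainf_one]
  have "Ap_rect \<infinity> \<omega> Q = eavg lam 1 Q * ennreal (exp (- mean lam Q))"
    by (rule Ap_rect_infty[OF rep integrable_lam Q(1,2)])
  also have "\<dots> \<le> ennreal (16 * W * exp (32 * \<bar>1\<bar> * W) * exp (1 * k)) * ennreal (exp (64 * W - k))"
    using mean by (intro mult_mono E ennreal_leI) auto
  also have "\<dots> = ennreal (16 * W * exp (32 * W) * (exp k * exp (64 * W - k)))"
    using W by (simp add: ennreal_mult[symmetric] mult.assoc)
  also have "exp k * exp (64 * W - k) = exp (64 * W)" by (simp add: exp_add[symmetric])
  finally show ?thesis .
qed

text \<open>The dual average is at most a constant times \<open>exp (- k / (p - 1))\<close>; its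
  power \<open>p - 1\<close> cancels the factor \<open>exp k\<close> of the first average.\<close>

lemma Ap_rect_real_average:
  assumes "Q \<in> rects" and p: "1 < p" and U: "0 \<le> U"
    and bd: "AE st in tor. dyadic_bound (\<lambda>u. ennreal (exp ((- 1 / (p - 1)) * u))) (ennreal U) (\<lambda>z. g (st, z))"
  shows "Ap_rect (ereal p) \<omega> Q \<le> ennreal (16 * W * exp (32 * W) * (16 * U * exp (32 * \<bar>- 1 / (p - 1)\<bar> * W)) powr (p - 1))"
proof -
  let ?r = "- 1 / (p - 1)"
  obtain k where Q: "Q \<in> sets borel" "Q \<subseteq> T2" "0 < measure tor Q" and k: "centre Q k"
    using rect_centre[OF assms(1)] .
  note E = centre_eavg[OF k W Ainf_one] centre_eavg[OF k U bd]
  let ?C = "16 * U * exp (32 * \<bar>?r\<bar> * W)"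
  have "Ap_rect (ereal p) \<omega> Q = eavg lam 1 Q * epow (eavg lam ?r Q) (p - 1)"
    by (rule Ap_rect_real[OF rep integrable_lam Q(1,2) p])
  also have "\<dots> \<le> ennreal (16 * W * exp (32 * \<bar>1\<bar> * W) * exp (1 * k)) * epow (ennreal (?C * exp (?r * k))) (p - 1)"
    using p by (intro mult_mono E epow_mono) auto
  also have "epow (ennreal (?C * exp (?r * k))) (p - 1) = ennreal (?C powr (p - 1) * exp (- k))"
    using U p by (subst epow_ennreal) (auto simp: powr_mult powr_def[of "exp (- (k / (p - 1)))"])
  also have "ennreal (16 * W * exp (32 * \<bar>1\<bar> * W) * exp (1 * k)) * ennreal (?C powr (p - 1) * exp (- k))
     = ennreal (16 * W * exp (32 * W) * ?C powr (p - 1) * (exp k * exp (- k)))"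
    using W by (subst ennreal_mult[symmetric]) (auto simp: mult_ac)
  also have "exp k * exp (- k) = 1" by (simp add: exp_add[symmetric])
  finally show ?thesis by simp
qed

lemma Ap_rect_one_average:
  assumes "Q \<in> rects"
    and bd: "AE st in tor. \<forall>R\<in>drects. AE z in tor. z \<in> R \<longrightarrow> (- 1) * (g (st, z) - mean (\<lambda>z. g (st, z)) R) \<le> U"
  shows "Ap_rect 1 \<omega> Q \<le> ennreal (16 * W * exp (32 * W) * exp (U + 32 * W))"
proof -
  obtain k where Q: "Q \<in> sets borel" "Q \<subseteq> T2" "0 < measure tor Q" and k: "centre Q k"
    using rect_centre[OF assms(1)] .
  note E = centre_eavg[OF k W Ainf_one] and low = centre_AE[OF k bd]
  have "AE z in tor. z \<in> Q \<longrightarrow> k - U - 32 * W \<le> lam z" using low by (elim eventually_mono) auto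
  then have inf: "ennreal (exp (k - U - 32 * W)) \<le> ess_inf_on Q \<omega>"
    by (rule ess_inf_ge[OF rep integrable_lam Q(2)])
  have "Ap_rect 1 \<omega> Q = eavg lam 1 Q / ess_inf_on Q \<omega>"
    by (simp add: Ap_rect_def avg_weight(1)[OF rep integrable_lam Q(1,2)])
  also have "\<dots> \<le> ennreal (16 * W * exp (32 * \<bar>1\<bar> * W) * exp (1 * k) / exp (k - U - 32 * W))"
    using W by (intro ennreal_divide_le E inf) auto
  also have "16 * W * exp (32 * \<bar>1\<bar> * W) * exp (1 * k) / exp (k - U - 32 * W) = 16 * W * exp (32 * W) * (exp k / exp (k - U - 32 * W))"
    by simp
  also have "exp k / exp (k - U - 32 * W) = exp (U + 32 * W)" by (simp add: exp_diff[symmetric])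
  finally show ?thesis .
qed

lemma RH_rect_real_average:
  assumes "Q \<in> rects" and p: "1 < p" and U: "0 \<le> U"
    and bd: "AE st in tor. dyadic_bound (\<lambda>u. ennreal (exp (p * u))) (ennreal U) (\<lambda>z. g (st, z))"
  shows "RH_rect (ereal p) \<omega> Q \<le> ennreal ((16 * U * exp (32 * \<bar>p\<bar> * W)) powr (1 / p) * exp (64 * W))"
proof -
  obtain k where Q: "Q \<in> sets borel" "Q \<subseteq> T2" "0 < measure tor Q" and k: "centre Q k"
    using rect_centre[OF assms(1)] .
  note E = centre_eavg[OF k U bd]
  let ?C = "16 * U * exp (32 * \<bar>p\<bar> * W)"
  have "epow (eavg lam p Q) (1 / p) \<le> epow (ennreal (?C * exp (p * k))) (1 / p)"
    using p by (intro epow_mono E) auto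
  also have "\<dots> = ennreal (?C powr (1 / p) * exp k)"
    using U p by (subst epow_ennreal) (auto simp: powr_mult powr_def[of "exp (p * k)"])
  finally have num: "epow (eavg lam p Q) (1 / p) \<le> ennreal (?C powr (1 / p) * exp k)" .
  have "RH_rect (ereal p) \<omega> Q = epow (eavg lam p Q) (1 / p) / eavg lam 1 Q"
    by (rule RH_rect_real[OF rep integrable_lam Q(1,2)])
  also have "\<dots> \<le> ennreal (?C powr (1 / p) * exp k / exp (k - 64 * W))"
    by (intro ennreal_divide_le num exp_le_eavg_average centre_mean[OF k] Q) auto
  also have "?C powr (1 / p) * exp k / exp (k - 64 * W) = ?C powr (1 / p) * (exp k / exp (k - 64 * W))" by simp
  also have "exp k / exp (k - 64 * W) = exp (64 * W)" by (simp add: exp_diff[symmetric])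
  finally show ?thesis .
qed

text \<open>\<open>96 * W\<close> is the \<open>32 * W\<close> in the essential upper bound plus the
  \<open>64 * W\<close> lost when the denominator is bounded below through the mean of
  \<open>lam\<close>.\<close>

lemma RH_rect_infty_average:
  assumes "Q \<in> rects"
    and bd: "AE st in tor. \<forall>R\<in>drects. AE z in tor. z \<in> R \<longrightarrow> 1 * (g (st, z) - mean (\<lambda>z. g (st, z)) R) \<le> U"
  shows "RH_rect \<infinity> \<omega> Q \<le> ennreal (exp (U + 96 * W))"
proof -
  obtain k where Q: "Q \<in> sets borel" "Q \<subseteq> T2" "0 < measure tor Q" and k: "centre Q k"
    using rect_centre[OF assms(1)] .
  note high = centre_AE[OF k bd]
  have "AE z in tor. z \<in> Q \<longrightarrow> lam z \<le> k + U + 32 * W" using high by (elim eventually_mono) auto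
  then have sup: "ess_sup_on Q \<omega> \<le> ennreal (exp (k + U + 32 * W))"
    by (rule ess_sup_le[OF rep integrable_lam Q(2)])
  have "RH_rect \<infinity> \<omega> Q = ess_sup_on Q \<omega> / eavg lam 1 Q"
    by (simp add: RH_rect_def avg_weight(1)[OF rep integrable_lam Q(1,2)])
  also have "\<dots> \<le> ennreal (exp (k + U + 32 * W) / exp (k - 64 * W))"
    by (intro ennreal_divide_le sup exp_le_eavg_average centre_mean[OF k] Q) auto
  also have "exp (k + U + 32 * W) / exp (k - 64 * W) = exp (U + 96 * W)" by (simp add: exp_diff[symmetric])
  finally show ?thesis .
qed

end

end

text \<open>\<open>\<Phi>\<close> is the condition on the weights, \<open>\<Psi>\<close> what a
  class says about the logarithm beyond the exponential bound with exponent 1. The conclusion holds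
  for almost every \<open>st\<close> only, because the representative is tied to the family only
  there.\<close>

lemma family_averaging:
  assumes fam: "family_cond w" and W: "0 \<le> W"
    and wt: "\<forall>s\<in>{0..1}. \<forall>t\<in>{0..1}. weight (w s t) \<and> \<Phi> (w s t)"
    and bounds: "\<And>\<omega> h. AE z in tor. \<omega> z = exp (h z) \<Longrightarrow> integrable tor h \<Longrightarrow> weight \<omega> \<Longrightarrow> \<Phi> \<omega> \<Longrightarrow>
      dyadic_bound (\<lambda>u. ennreal (exp (1 * u))) (ennreal W) h \<and> \<Psi> h"
  obtains g where "averaging g W" "AE st in tor. \<Psi> (\<lambda>z. g (st, z))"
    "AE z in tor. Omega w z = exp (averaging.lam g z)"
proof -
  have wt': "weight (w s t)" if "s \<in> {0..1}" "t \<in> {0..1}" for s t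
    using wt that by blast
  obtain g where g: "integrable (tor \<Otimes>\<^sub>M tor) g"
    and rep: "AE st in tor. st \<in> T2 \<and> (AE z in tor. w (fst st) (snd st) z = exp (g (st, z)))"
    and Om: "AE z in tor. Omega w z = exp (\<integral>st. g (st, rot st z) \<partial>tor)"
    using family_representation[OF fam wt'] .
  have all: "AE st in tor. dyadic_bound (\<lambda>u. ennreal (exp (1 * u))) (ennreal W) (\<lambda>z. g (st, z)) \<and> \<Psi> (\<lambda>z. g (st, z))"
    using rep tor2.AE_integrable_fst'[OF g]
  proof eventually_elim
    case (elim st)
    then have "fst st \<in> {0..1}" "snd st \<in> {0..1}" by (auto simp: T2_def torus_def)
    then show ?case using elim wt by (intro bounds[of "w (fst st) (snd st)"]) auto
  qed
  have av: "averaging g W"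
    by (rule averaging.intro[OF g W]) (use all in \<open>auto elim: eventually_mono\<close>)
  show ?thesis
  proof (rule that[OF av])
    show "AE st in tor. \<Psi> (\<lambda>z. g (st, z))" using all by eventually_elim simp
    show "AE z in tor. Omega w z = exp (averaging.lam g z)" using Om by (simp add: averaging.lam_def[OF av])
  qed
qed

section \<open>Conclusion for each range of exponents\<close>

lemma inApI:
  assumes "weight \<omega>" "\<And>Q. Q \<in> rects \<Longrightarrow> Ap_rect p \<omega> Q \<le> ennreal C"
  shows "inAp p \<omega> \<and> Ap_const p \<omega> \<le> ennreal C"
proof -
  have "Ap_const p \<omega> \<le> ennreal C" unfolding Ap_const_def using assms by (intro SUP_least)
  then show ?thesis using assms(1) by (auto simp: inAp_def le_less_trans)
qed

lemma inRHI:
  assumes "weight \<omega>" "\<And>Q. Q \<in> rects \<Longrightarrow> RH_rect p \<omega> Q \<le> ennreal C"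
  shows "inRH p \<omega> \<and> RH_const p \<omega> \<le> ennreal C"
proof -
  have "RH_const p \<omega> \<le> ennreal C" unfolding RH_const_def using assms by (intro SUP_least)
  then show ?thesis using assms(1) by (auto simp: inRH_def le_less_trans)
qed

lemma Ap_average_one:
  assumes "1 \<le> V"
  shows "\<exists>C::real. \<forall>w. family_cond w \<and> (\<forall>s\<in>{0..1}. \<forall>t\<in>{0..1}. weight (w s t) \<and> Apd_const 1 (w s t) \<le> ennreal V)
    \<longrightarrow> inAp 1 (Omega w) \<and> Ap_const 1 (Omega w) \<le> ennreal C"
proof (intro exI allI impI)
  let ?W = "2 * V"
  fix w assume w: "family_cond w \<and> (\<forall>s\<in>{0..1}. \<forall>t\<in>{0..1}. weight (w s t) \<and> Apd_const 1 (w s t) \<le> ennreal V)"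
  obtain g where av: "averaging g ?W"
    and bd: "AE st in tor. \<forall>R\<in>drects. AE z in tor. z \<in> R \<longrightarrow> (- 1) * (g (st, z) - mean (\<lambda>z. g (st, z)) R) \<le> ln (2 * V)"
    and rep: "AE z in tor. Omega w z = exp (averaging.lam g z)"
    by (rule family_averaging[where w = w and W = "?W" and \<Phi> = "\<lambda>\<omega>. Apd_const 1 \<omega> \<le> ennreal V"
          and \<Psi> = "\<lambda>h. \<forall>R\<in>drects. AE z in tor. z \<in> R \<longrightarrow> (- 1) * (h z - mean h R) \<le> ln (2 * V)"])
      (use w assms Apd_one_bounds in auto)
  interpret averaging g ?W by (rule av)
  show "inAp 1 (Omega w) \<and> Ap_const 1 (Omega w) \<le> ennreal (16 * ?W * exp (32 * ?W) * exp (ln (2 * V) + 32 * ?W))"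
    by (intro inApI weight_average[OF rep] Ap_rect_one_average[OF rep _ bd])
qed

lemma Ap_average_infty:
  assumes "1 \<le> V"
  shows "\<exists>C::real. \<forall>w. family_cond w \<and> (\<forall>s\<in>{0..1}. \<forall>t\<in>{0..1}. weight (w s t) \<and> Apd_const \<infinity> (w s t) \<le> ennreal V)
    \<longrightarrow> inAp \<infinity> (Omega w) \<and> Ap_const \<infinity> (Omega w) \<le> ennreal C"
proof (intro exI allI impI)
  fix w assume w: "family_cond w \<and> (\<forall>s\<in>{0..1}. \<forall>t\<in>{0..1}. weight (w s t) \<and> Apd_const \<infinity> (w s t) \<le> ennreal V)"
  obtain g where av: "averaging g V" and rep: "AE z in tor. Omega w z = exp (averaging.lam g z)"
    by (rule family_averaging[where w = w and W = V and \<Phi> = "\<lambda>\<omega>. Apd_const \<infinity> \<omega> \<le> ennreal V" and \<Psi> = "\<lambda>_. True"])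
      (use w assms Apd_infty_bounds in auto)
  interpret averaging g V by (rule av)
  show "inAp \<infinity> (Omega w) \<and> Ap_const \<infinity> (Omega w) \<le> ennreal (16 * V * exp (32 * V) * exp (64 * V))"
    by (intro inApI weight_average[OF rep] Ap_rect_infty_average[OF rep])
qed

lemma Ap_average_real:
  assumes "1 \<le> V" "1 < p"
  shows "\<exists>C::real. \<forall>w. family_cond w \<and> (\<forall>s\<in>{0..1}. \<forall>t\<in>{0..1}. weight (w s t) \<and> Apd_const (ereal p) (w s t) \<le> ennreal V)
    \<longrightarrow> inAp (ereal p) (Omega w) \<and> Ap_const (ereal p) (Omega w) \<le> ennreal C"
proof (intro exI allI impI)
  let ?U = "V powr (1 / (p - 1))"
  fix w assume w: "family_cond w \<and> (\<forall>s\<in>{0..1}. \<forall>t\<in>{0..1}. weight (w s t) \<and> Apd_const (ereal p) (w s t) \<le> ennreal V)"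
  obtain g where av: "averaging g V"
    and bd: "AE st in tor. dyadic_bound (\<lambda>u. ennreal (exp ((- 1 / (p - 1)) * u))) (ennreal ?U) (\<lambda>z. g (st, z))"
    and rep: "AE z in tor. Omega w z = exp (averaging.lam g z)"
  proof (rule family_averaging[where w = w and W = V and \<Phi> = "\<lambda>\<omega>. Apd_const (ereal p) \<omega> \<le> ennreal V"
        and \<Psi> = "\<lambda>h. dyadic_bound (\<lambda>u. ennreal (exp ((- 1 / (p - 1)) * u))) (ennreal ?U) h"])
    show "dyadic_bound (\<lambda>u. ennreal (exp (1 * u))) (ennreal V) h \<and>
        dyadic_bound (\<lambda>u. ennreal (exp ((- 1 / (p - 1)) * u))) (ennreal ?U) h"
      if "AE z in tor. \<omega> z = exp (h z)" "integrable tor h" "Apd_const (ereal p) \<omega> \<le> ennreal V" for \<omega> h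
      using Apd_real_bounds[OF that(1,2) _ assms(2) that(3)] assms(1) by linarith
  qed (use w assms in auto)
  interpret averaging g V by (rule av)
  have U: "0 \<le> ?U" by simp
  show "inAp (ereal p) (Omega w) \<and> Ap_const (ereal p) (Omega w)
      \<le> ennreal (16 * V * exp (32 * V) * (16 * ?U * exp (32 * \<bar>- 1 / (p - 1)\<bar> * V)) powr (p - 1))"
    by (intro inApI weight_average[OF rep] Ap_rect_real_average[OF rep _ assms(2) U bd])
qed

lemma RH_average_real:
  assumes "1 \<le> V" "1 < p"
  shows "\<exists>C::real. \<forall>w. family_cond w \<and> (\<forall>s\<in>{0..1}. \<forall>t\<in>{0..1}. weight (w s t) \<and> RHd_const (ereal p) (w s t) \<le> ennreal V)
    \<longrightarrow> inRH (ereal p) (Omega w) \<and> RH_const (ereal p) (Omega w) \<le> ennreal C"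
proof (intro exI allI impI)
  let ?W = "exp (1 / reverse_holder.c p (V powr p) V)"
  let ?U = "(V * ?W) powr p"
  fix w assume w: "family_cond w \<and> (\<forall>s\<in>{0..1}. \<forall>t\<in>{0..1}. weight (w s t) \<and> RHd_const (ereal p) (w s t) \<le> ennreal V)"
  obtain g where av: "averaging g ?W"
    and bd: "AE st in tor. dyadic_bound (\<lambda>u. ennreal (exp (p * u))) (ennreal ?U) (\<lambda>z. g (st, z))"
    and rep: "AE z in tor. Omega w z = exp (averaging.lam g z)"
  proof (rule family_averaging[where w = w and W = ?W and \<Phi> = "\<lambda>\<omega>. RHd_const (ereal p) \<omega> \<le> ennreal V"
        and \<Psi> = "\<lambda>h. dyadic_bound (\<lambda>u. ennreal (exp (p * u))) (ennreal ?U) h"])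
    show "dyadic_bound (\<lambda>u. ennreal (exp (1 * u))) (ennreal ?W) h \<and>
        dyadic_bound (\<lambda>u. ennreal (exp (p * u))) (ennreal ?U) h"
      if "AE z in tor. \<omega> z = exp (h z)" "integrable tor h" "weight \<omega>" "RHd_const (ereal p) \<omega> \<le> ennreal V" for \<omega> h
      using RHd_real_bounds[OF that(1-3) assms that(4) refl] by blast
  qed (use w in auto)
  interpret averaging g ?W by (rule av)
  have U: "0 \<le> ?U" by simp
  show "inRH (ereal p) (Omega w) \<and> RH_const (ereal p) (Omega w)
      \<le> ennreal ((16 * ?U * exp (32 * \<bar>p\<bar> * ?W)) powr (1 / p) * exp (64 * ?W))"
    by (intro inRHI weight_average[OF rep] RH_rect_real_average[OF rep _ assms(2) U bd])
qed

lemma RH_average_infty: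
  assumes "1 \<le> V"
  shows "\<exists>C::real. \<forall>w. family_cond w \<and> (\<forall>s\<in>{0..1}. \<forall>t\<in>{0..1}. weight (w s t) \<and> RHd_const \<infinity> (w s t) \<le> ennreal V)
    \<longrightarrow> inRH \<infinity> (Omega w) \<and> RH_const \<infinity> (Omega w) \<le> ennreal C"
proof (intro exI allI impI)
  let ?W = "exp (1 / reverse_holder.c 2 (2 * V) V)"
  fix w assume w: "family_cond w \<and> (\<forall>s\<in>{0..1}. \<forall>t\<in>{0..1}. weight (w s t) \<and> RHd_const \<infinity> (w s t) \<le> ennreal V)"
  obtain g where av: "averaging g ?W"
    and bd: "AE st in tor. \<forall>R\<in>drects. AE z in tor. z \<in> R \<longrightarrow> 1 * (g (st, z) - mean (\<lambda>z. g (st, z)) R) \<le> ln (2 * V * ?W)"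
    and rep: "AE z in tor. Omega w z = exp (averaging.lam g z)"
  proof (rule family_averaging[where w = w and W = ?W and \<Phi> = "\<lambda>\<omega>. RHd_const \<infinity> \<omega> \<le> ennreal V"
        and \<Psi> = "\<lambda>h. \<forall>R\<in>drects. AE z in tor. z \<in> R \<longrightarrow> 1 * (h z - mean h R) \<le> ln (2 * V * ?W)"])
    show "dyadic_bound (\<lambda>u. ennreal (exp (1 * u))) (ennreal ?W) h \<and>
        (\<forall>R\<in>drects. AE z in tor. z \<in> R \<longrightarrow> 1 * (h z - mean h R) \<le> ln (2 * V * ?W))"
      if "AE z in tor. \<omega> z = exp (h z)" "integrable tor h" "weight \<omega>" "RHd_const \<infinity> \<omega> \<le> ennreal V" for \<omega> h
      using RHd_infty_bounds[OF that(1-3) assms that(4) refl] by blast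
  qed (use w in auto)
  interpret averaging g ?W by (rule av)
  show "inRH \<infinity> (Omega w) \<and> RH_const \<infinity> (Omega w) \<le> ennreal (exp (ln (2 * V * ?W) + 96 * ?W))"
    by (intro inRHI weight_average[OF rep] RH_rect_infty_average[OF rep _ bd])
qed

theorem mainTheorem7:
  shows "(\<forall>(p::ereal) (V::real). 1 \<le> p \<longrightarrow>
           (\<exists>C::real. \<forall>w :: real \<Rightarrow> real \<Rightarrow> real \<times> real \<Rightarrow> real.
              family_cond w
              \<and> (\<forall>s\<in>{0..1}. \<forall>t\<in>{0..1}. inApd p (w s t) \<and> Apd_const p (w s t) \<le> ennreal V)
              \<longrightarrow> inAp p (Omega w) \<and> Ap_const p (Omega w) \<le> ennreal C))
       \<and> (\<forall>(p::ereal) (V::real). 1 < p \<longrightarrow>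
           (\<exists>C::real. \<forall>w :: real \<Rightarrow> real \<Rightarrow> real \<times> real \<Rightarrow> real.
              family_cond w
              \<and> (\<forall>s\<in>{0..1}. \<forall>t\<in>{0..1}. inRHd p (w s t) \<and> RHd_const p (w s t) \<le> ennreal V)
              \<longrightarrow> inRH p (Omega w) \<and> RH_const p (Omega w) \<le> ennreal C))"
proof (intro conjI allI impI)
  fix p :: ereal and V :: real
  \<comment> \<open>The constants are built for bounds of at least 1. Enlarging \<open>V\<close>
    weakens the hypothesis on the weights, and the result still depends only on \<open>p\<close> and
    \<open>V\<close>.\<close>
  let ?V = "max 1 V"
  assume p: "1 \<le> p"
  have V: "1 \<le> ?V" and le: "x \<le> ennreal V \<Longrightarrow> x \<le> ennreal ?V" for x
    by (auto elim: order_trans intro: ennreal_leI)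
  have "\<exists>C::real. \<forall>w. family_cond w \<and> (\<forall>s\<in>{0..1}. \<forall>t\<in>{0..1}. weight (w s t) \<and> Apd_const p (w s t) \<le> ennreal ?V)
    \<longrightarrow> inAp p (Omega w) \<and> Ap_const p (Omega w) \<le> ennreal C"
  proof (cases p)
    case (real q)
    show ?thesis
    proof (cases "q = 1")
      case True
      then show ?thesis using Ap_average_one[OF V] real by (simp add: one_ereal_def)
    next
      case False
      then have "1 < q" using p real by (simp add: one_ereal_def)
      then show ?thesis using Ap_average_real[OF V] real by simp
    qed
  next
    case PInf
    then show ?thesis using Ap_average_infty[OF V] by simp
  next
    case MInf
    then show ?thesis using p by simp
  qed
  then obtain C where C: "family_cond w \<and> (\<forall>s\<in>{0..1}. \<forall>t\<in>{0..1}. weight (w s t) \<and> Apd_const p (w s t) \<le> ennreal ?V)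
    \<Longrightarrow> inAp p (Omega w) \<and> Ap_const p (Omega w) \<le> ennreal C" for w
    by blast
  show "\<exists>C::real. \<forall>w. family_cond w \<and> (\<forall>s\<in>{0..1}. \<forall>t\<in>{0..1}. inApd p (w s t) \<and> Apd_const p (w s t) \<le> ennreal V)
    \<longrightarrow> inAp p (Omega w) \<and> Ap_const p (Omega w) \<le> ennreal C"
    by (intro exI[of _ C] allI impI C) (auto simp: inApd_def intro: le)
next
  fix p :: ereal and V :: real
  let ?V = "max 1 V"
  assume p: "1 < p"
  have V: "1 \<le> ?V" and le: "x \<le> ennreal V \<Longrightarrow> x \<le> ennreal ?V" for x
    by (auto elim: order_trans intro: ennreal_leI)
  have "\<exists>C::real. \<forall>w. family_cond w \<and> (\<forall>s\<in>{0..1}. \<forall>t\<in>{0..1}. weight (w s t) \<and> RHd_const p (w s t) \<le> ennreal ?V)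
    \<longrightarrow> inRH p (Omega w) \<and> RH_const p (Omega w) \<le> ennreal C"
  proof (cases p)
    case (real q)
    then show ?thesis using RH_average_real[OF V, of q] p by (simp add: one_ereal_def)
  next
    case PInf
    then show ?thesis using RH_average_infty[OF V] by simp
  next
    case MInf
    then show ?thesis using p by simp
  qed
  then obtain C where C: "family_cond w \<and> (\<forall>s\<in>{0..1}. \<forall>t\<in>{0..1}. weight (w s t) \<and> RHd_const p (w s t) \<le> ennreal ?V)
    \<Longrightarrow> inRH p (Omega w) \<and> RH_const p (Omega w) \<le> ennreal C" for w
    by blast
  show "\<exists>C::real. \<forall>w. family_cond w \<and> (\<forall>s\<in>{0..1}. \<forall>t\<in>{0..1}. inRHd p (w s t) \<and> RHd_const p (w s t) \<le> ennreal V)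
    \<longrightarrow> inRH p (Omega w) \<and> RH_const p (Omega w) \<le> ennreal C"
    by (intro exI[of _ C] allI impI C) (auto simp: inRHd_def intro: le)
qed

end
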